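(* Let $(\Gamma_n)_{n\geqslant 1}$, $W_n$ be as in the context. For every $n\geqslant 1$ the map $H_\ast(BW_{n-1})\to H_\ast(BW_n)$ induced by the inclusion $W_{n-1}\hookrightarrow W_n$ is an isomorphism in all degrees $\ast$ with $2\ast\leqslant n$, for homology with arbitrary constant coefficients.
   Context: A Coxeter matrix on a set $S$ is a symmetric matrix $(m_{st})$ with entries in $\mathbb{N}\cup\{\infty\}$, $m_{ss}=1$, $m_{st}\geqslant 2$ for $s\neq t$; its Coxeter group is $\langle S\mid (st)^{m_{st}}=e\rangle$ (no relation when $m_{st}=\infty$). The Coxeter diagram has vertex set $S$ and an edge $\{s,t\}$ whenever $m_{st}\geqslant 3$, labelled by $m_{st}$ when $m_{st}\geqslant 4$; an unlabelled edge means $m_{st}=3$, no edge means $m_{st}=2$. Standing setup: $\Gamma_1$ is an arbitrary finite Coxeter diagram with a preferred vertex $s_1$. For $n\geqslant 2$, $\Gamma_n$ is obtained from $\Gamma_{n-1}$ by adding one new vertex $s_n$ (the preferred vertex of $\Gamma_n$) joined by an unlabelled edge to $s_{n-1}$ and to no other vertex. Let $\Gamma_0$ be $\Gamma_1$ with $s_1$ deleted, and $\Gamma_{-1}$ be $\Gamma_1$ with $s_1$ and all vertices joined to $s_1$ by an edge deleted. For $n\geqslant -1$ let $S_n$ be the vertex set of $\Gamma_n$ and $W_n$ the associated Coxeter group; thus $S_{-1}\subset S_0\subset S_1\subset\cdots$, $S_n=S_0\cup\{s_1,\dots,s_n\}$, and for $m\leqslant n$ we identify $W_m$ with the standard parabolic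 subgroup of $W_n$ generated by $S_m$. $BG$ denotes the classifying space of a group $G$. The groups $W_n$ need not be finite. *)

theory Defs
  imports "HOL-Library.Extended_Nat" "HOL-Algebra.Group"
begin

text \<open>A Coxeter matrix on S is m :: 'v => 'v => enat (infinity = no relation).
 The Coxeter group is the set of words over S modulo the congruence generated by
 the relators (s t)^(m s t) for s, t in S with m s t finite (for s = t this is s s).\<close>

inductive_set cox_rel :: "'v set \<Rightarrow> ('v \<Rightarrow> 'v \<Rightarrow> enat) \<Rightarrow> ('v list \<times> 'v list) set"
  for S m where
  refl: "w \<in> lists S \<Longrightarrow> (w, w) \<in> cox_rel S m"
| sym: "(u, v) \<in> cox_rel S m \<Longrightarrow> (v, u) \<in> cox_rel S m"
| trans: "(u, v) \<in> cox_rel S m \<Longrightarrow> (v, w) \<in> cox_rel S m \<Longrightarrow> (u, w) \<in> cox_rel S m"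
| relator: "u \<in> lists S \<Longrightarrow> v \<in> lists S \<Longrightarrow> s \<in> S \<Longrightarrow> t \<in> S \<Longrightarrow> m s t = enat k \<Longrightarrow>
     (u @ concat (replicate k [s, t]) @ v, u @ v) \<in> cox_rel S m"

definition coxeter_group :: "'v set \<Rightarrow> ('v \<Rightarrow> 'v \<Rightarrow> enat) \<Rightarrow> 'v list set monoid" where
  "coxeter_group S m =
     \<lparr> carrier = lists S // cox_rel S m,
       mult = (\<lambda>X Y. cox_rel S m `` {(SOME x. x \<in> X) @ (SOME y. y \<in> Y)}),
       one = cox_rel S m `` {[]} \<rparr>"

text \<open>The map W_T -> W_S induced by inclusion T \<subseteq> S of generating sets.\<close>
definition parabolic_incl :: "'v set \<Rightarrow> ('v \<Rightarrow> 'v \<Rightarrow> enat) \<Rightarrow> 'v list set \<Rightarrow> 'v list set" where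
  "parabolic_incl S m X = cox_rel S m `` X"

definition is_coxeter_matrix :: "'v set \<Rightarrow> ('v \<Rightarrow> 'v \<Rightarrow> enat) \<Rightarrow> bool" where
  "is_coxeter_matrix S m \<longleftrightarrow>
     (\<forall>s\<in>S. \<forall>t\<in>S. m s t = m t s) \<and> (\<forall>s\<in>S. m s s = 1) \<and>
     (\<forall>s\<in>S. \<forall>t\<in>S. s \<noteq> t \<longrightarrow> m s t \<ge> 2)"

text \<open>Vertices: Inl a for a in S_0 (the vertices of Gamma_1 other than s_1), Inr i for s_i (i \<ge> 1).
 Gamma_1 is given by a Coxeter matrix M0 on S_0 and the labels m1 a = m_{s_1 a}.
 The matrix below restricted to S_n is the Coxeter matrix of Gamma_n.\<close>

definition gamma_matrix :: "('a \<Rightarrow> 'a \<Rightarrow> enat) \<Rightarrow> ('a \<Rightarrow> enat) \<Rightarrow> ('a + nat) \<Rightarrow> ('a + nat) \<Rightarrow> enat" where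
  "gamma_matrix M0 m1 x y =
     (case (x, y) of
        (Inl a, Inl b) \<Rightarrow> M0 a b
      | (Inl a, Inr j) \<Rightarrow> (if j = 1 then m1 a else 2)
      | (Inr i, Inl b) \<Rightarrow> (if i = 1 then m1 b else 2)
      | (Inr i, Inr j) \<Rightarrow> (if i = j then 1 else if i = j + 1 \<or> j = i + 1 then 3 else 2))"

definition gamma_vertices :: "'a set \<Rightarrow> nat \<Rightarrow> ('a + nat) set" where
  "gamma_vertices S0 n = Inl ` S0 \<union> Inr ` {1..n}"

definition W :: "'a set \<Rightarrow> ('a \<Rightarrow> 'a \<Rightarrow> enat) \<Rightarrow> ('a \<Rightarrow> enat) \<Rightarrow> nat \<Rightarrow> ('a + nat) list set monoid" where
  "W S0 M0 m1 n = coxeter_group (gamma_vertices S0 n) (gamma_matrix M0 m1)"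

text \<open>Inhomogeneous bar complex: C_k(G;A) = finitely supported A-valued functions on G^k
 (tuples as lists of length k), with trivial action of G on A.\<close>

definition bar_chains :: "('g, 'b) monoid_scheme \<Rightarrow> nat \<Rightarrow> ('g list \<Rightarrow> 'c::ab_group_add) set" where
  "bar_chains G k = {f. finite {x. f x \<noteq> 0} \<and>
      (\<forall>x. f x \<noteq> 0 \<longrightarrow> x \<in> lists (carrier G) \<and> length x = k)}"

definition bar_face :: "('g, 'b) monoid_scheme \<Rightarrow> nat \<Rightarrow> nat \<Rightarrow> 'g list \<Rightarrow> 'g list" where
  "bar_face G k i x =
     (if i = 0 then tl x
      else if i = k then butlast x
      else take (i - 1) x @ [x ! (i - 1) \<otimes>\<^bsub>G\<^esub> x ! i] @ drop (i + 1) x)"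

definition bar_d :: "('g, 'b) monoid_scheme \<Rightarrow> nat \<Rightarrow> ('g list \<Rightarrow> 'c::ab_group_add) \<Rightarrow> 'g list \<Rightarrow> 'c" where
  "bar_d G k f = (if k = 0 then (\<lambda>_. 0) else
     (\<lambda>y. \<Sum>x\<in>{x. f x \<noteq> 0}. \<Sum>i\<in>{0..k}.
        if bar_face G k i x = y then (if even i then f x else - f x) else 0))"

definition bar_cycles :: "('g, 'b) monoid_scheme \<Rightarrow> nat \<Rightarrow> ('g list \<Rightarrow> 'c::ab_group_add) set" where
  "bar_cycles G k = {f \<in> bar_chains G k. bar_d G k f = (\<lambda>_. 0)}"

definition bar_boundaries :: "('g, 'b) monoid_scheme \<Rightarrow> nat \<Rightarrow> ('g list \<Rightarrow> 'c::ab_group_add) set" where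
  "bar_boundaries G k = bar_d G (Suc k) ` bar_chains G (Suc k)"

definition bar_push :: "('g \<Rightarrow> 'h) \<Rightarrow> ('g list \<Rightarrow> 'c::ab_group_add) \<Rightarrow> 'h list \<Rightarrow> 'c" where
  "bar_push \<phi> f = (\<lambda>y. \<Sum>x\<in>{x. f x \<noteq> 0 \<and> map \<phi> x = y}. f x)"

text \<open>The induced map H_k(G;A) -> H_k(H;A), [z] |-> [push z], is bijective
 (it is a homomorphism, so injectivity = trivial kernel).\<close>
definition induces_homology_iso ::
  "('g, 'b) monoid_scheme \<Rightarrow> ('h, 'd) monoid_scheme \<Rightarrow> ('g \<Rightarrow> 'h) \<Rightarrow> nat \<Rightarrow> 'c::ab_group_add itself \<Rightarrow> bool" where
  "induces_homology_iso G H \<phi> k A \<longleftrightarrow>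
     (\<forall>z \<in> (bar_cycles G k :: ('g list \<Rightarrow> 'c) set).
         bar_push \<phi> z \<in> bar_boundaries H k \<longrightarrow> z \<in> bar_boundaries G k) \<and>
     (\<forall>z \<in> (bar_cycles H k :: ('h list \<Rightarrow> 'c) set).
         \<exists>z' \<in> bar_cycles G k. (\<lambda>y. z y - bar_push \<phi> z' y) \<in> bar_boundaries H k)"

end

(*
  Let W_n act on the complex D whose simplices with k vertices are the cosets of W_(n-k). Its
  rows are exact below the top degree, so the double complex of bar chains with coefficients
  in the chains of D has acyclic rows, while its columns compute the homology of the groups
  W_(n-k). The faces of D are translates of one another by elements centralising the smaller
  group, so on homology the horizontal maps are alternately the stabilisation map and zero, and
  stability follows by induction on n from a diagram chase.

  Acyclicity of D: the groups act faithfully in the geometric representation, and the vertices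
  of D are the translates of the functionals delta_0, ..., delta_n on it. The simplices are the
  injective words with letters in one of the chambers {delta_0 g, ..., delta_n g}. Ordered by the
  minimal length of g, the chambers form a shelling, by the exchange condition; hence the layers
  of the length filtration are complexes of injective words that use all letters of a given set,
  and these are exact below the top degree.
*)

theory Submission
  imports Defs "HOL-Library.Poly_Mapping"
begin

section \<open>Finitely supported chains\<close>

text \<open>W_n may be infinite, so cosets, stabilisers and lengths are all read off one faithful
  linear representation. The functionals come from the rows of the Cartan matrix: along the tail of
  the diagram the row of s_i is \<delta>_i - \<delta>_{i-1}, so s_i exchanges these two functionals
  and fixes the others, while \<delta>_0 records how s_1 is attached to \<Gamma>_0. On W_i the
  functional \<delta>_i is dominant, and its stabiliser is therefore the parabolic subgroup W_{i-1},
  down to W_{-1} for i = 0. A coset thus becomes a word of functionals, and taking a face becomes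
  deleting a letter.

  A chamber does not determine a coset of the symmetric group generated by s_1, ..., s_n, because
  W_{-1} fixes every \<delta>_i. The rank of a chamber is therefore a minimum over all elements that
  define it, and the shelling has to tolerate chambers of equal rank.

  The slope one half comes from the zero maps: starting in column 0 and degree q, the chase meets a
  zero map first, and has to use surjectivity for index n - 2 in degree q - 1.\<close>

abbreviation "single \<equiv> Poly_Mapping.single"
abbreviation "keys \<equiv> Poly_Mapping.keys"
abbreviation "lookup \<equiv> Poly_Mapping.lookup"

definition lin :: "('k \<Rightarrow> 'c::ab_group_add \<Rightarrow> 'd::ab_group_add) \<Rightarrow> ('k \<Rightarrow>\<^sub>0 'c) \<Rightarrow> 'd" where
  "lin D z = (\<Sum>x\<in>keys z. D x (lookup z x))"

lemma additive_lin:
  assumes "\<And>x. additive (D x)"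
  shows "additive (lin D)"
proof
  fix f g :: "'a \<Rightarrow>\<^sub>0 'b"
  show "lin D (f + g) = lin D f + lin D g"
    unfolding lin_def
    by (rule setsum_keys_plus_distrib)
      (simp_all add: additive.zero[OF assms] additive.add[OF assms])
qed

lemma lin_single: "additive (D x) \<Longrightarrow> lin D (single x c) = D x c"
  by (auto simp: lin_def additive.zero)

lemma additive_single: "additive (single x)"
  by standard (simp add: single_add)

lemma additive_comp: "additive f \<Longrightarrow> additive g \<Longrightarrow> additive (\<lambda>x. f (g x))"
  by (simp add: additive_def)

lemma additive_plus: "additive f \<Longrightarrow> additive g \<Longrightarrow> additive (\<lambda>x. f x + g x)"
  by (simp add: additive_def algebra_simps)

lemma additive_minus: "additive f \<Longrightarrow> additive g \<Longrightarrow> additive (\<lambda>x. f x - g x)"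
  by (simp add: additive_def algebra_simps)

lemma additive_uminus: "additive f \<Longrightarrow> additive (\<lambda>x. - f x)"
  by (simp add: additive_def)

lemma additive_0: "additive (\<lambda>x. 0)"
  by (simp add: additive_def)

lemma additive_id: "additive (\<lambda>x. x)"
  by (simp add: additive_def)

lemma chain_expand: "z = (\<Sum>x\<in>keys z. single x (lookup z x))"
proof (rule poly_mapping_eqI)
  fix k
  have "lookup (\<Sum>x\<in>keys z. single x (lookup z x)) k = (\<Sum>x\<in>keys z. if x = k then lookup z x else 0)"
    by (simp add: lookup_sum lookup_single when_def)
  also have "\<dots> = lookup z k"
    by (simp add: in_keys_iff)
  finally show "lookup z k = lookup (\<Sum>x\<in>keys z. single x (lookup z x)) k" by simp
qed

lemma additive_expand:
  assumes "additive F"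
  shows "F z = (\<Sum>x\<in>keys z. F (single x (lookup z x)))"
  by (subst chain_expand[of z]) (simp add: additive.sum[OF assms])

text \<open>Identities between additive maps are checked on generators. Only generators in the
  support of the given z matter, so what is known about that support, such as lengths of words or
  membership in a subgroup, may be used.\<close>

lemma additive_eqI:
  assumes "additive F" "additive G" "\<And>x c. x \<in> keys z \<Longrightarrow> F (single x c) = G (single x c)"
  shows "F z = G z"
  by (simp add: additive_expand[OF assms(1), of z] additive_expand[OF assms(2), of z] assms(3))

lemma keys_sum_subset: "keys (sum f A) \<subseteq> (\<Union>x\<in>A. keys (f x))"
proof (induction A rule: infinite_finite_induct)
  case (insert x F)
  then show ?case using keys_add[of "f x" "sum f F"] by auto
qed auto

lemma keys_uminus_chain: "keys (- z) = keys (z :: 'k \<Rightarrow>\<^sub>0 'c::ab_group_add)"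
  by (simp add: keys.rep_eq)

lemma keys_minus_subset: "keys (f - g) \<subseteq> keys f \<union> keys (g :: 'k \<Rightarrow>\<^sub>0 'c::ab_group_add)"
  using keys_add[of f "- g"] by (simp add: keys_uminus_chain)

lemma keys_additive:
  assumes "additive F" "v \<in> keys (F z)"
  obtains u where "u \<in> keys z" "v \<in> keys (F (single u (lookup z u)))"
proof -
  have "keys (F z) \<subseteq> (\<Union>x\<in>keys z. keys (F (single x (lookup z x))))"
    by (subst additive_expand[OF assms(1)]) (rule keys_sum_subset)
  with assms(2) that show ?thesis by blast
qed

lemma keys_additive_subset:
  assumes "additive F" "\<And>u c. u \<in> keys z \<Longrightarrow> keys (F (single u c)) \<subseteq> S"
  shows "keys (F z) \<subseteq> S"
  using keys_additive[OF assms(1)] assms(2) by blast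

definition push :: "('k \<Rightarrow> 'l) \<Rightarrow> ('k \<Rightarrow>\<^sub>0 'c::ab_group_add) \<Rightarrow> ('l \<Rightarrow>\<^sub>0 'c)" where
  "push f = lin (\<lambda>x. single (f x))"

lemma additive_push: "additive (push f)"
  unfolding push_def by (rule additive_lin) (rule additive_single)

lemma push_single [simp]: "push f (single x c) = single (f x) c"
  by (simp add: push_def lin_single additive_single)

lemmas push_add = additive.add[OF additive_push]
  and push_diff = additive.diff[OF additive_push]
  and push_zero = additive.zero[OF additive_push]
  and push_sum = additive.sum[OF additive_push]

lemma keys_push: "keys (push f z) \<subseteq> f ` keys z"
  by (rule keys_additive_subset[OF additive_push]) auto

lemma push_push: "push f (push g z) = push (\<lambda>x. f (g x)) z"
  by (rule additive_eqI[of "\<lambda>z. push f (push g z)" "push (\<lambda>x. f (g x))"])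
     (rule additive_comp[OF additive_push additive_push], rule additive_push, simp)

lemma push_cong: "(\<And>x. x \<in> keys z \<Longrightarrow> f x = g x) \<Longrightarrow> push f z = push g z"
  by (rule additive_eqI[of "push f" "push g"]) (auto intro: additive_push)

lemma push_id [simp]: "push (\<lambda>x. x) z = z"
  by (rule additive_eqI[of "push (\<lambda>x. x)" "\<lambda>x. x"]) (auto intro: additive_push additive_id)

lemma lookup_push_inj:
  assumes "inj f"
  shows "lookup (push f z) (f x) = lookup z x"
proof -
  have "lookup (push f z) (f x) = (\<Sum>y\<in>keys z. if y = x then lookup z y else 0)"
    using assms by (simp add: push_def lin_def lookup_sum lookup_single when_def inj_eq)
  also have "\<dots> = lookup z x" by (simp add: in_keys_iff)
  finally show ?thesis .
qed

lemma keys_push_inj: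
  assumes "inj f"
  shows "keys (push f z) = f ` keys z"
  using keys_push[of f z] lookup_push_inj[OF assms, of z] by (auto simp: in_keys_iff)

text \<open>The projection onto chains supported in \<open>S\<close>. It need not commute with a
  boundary; controlling the error is the point of the block argument below.\<close>

definition cut :: "'k set \<Rightarrow> ('k \<Rightarrow>\<^sub>0 'c::ab_group_add) \<Rightarrow> ('k \<Rightarrow>\<^sub>0 'c)" where
  "cut S = lin (\<lambda>x c. if x \<in> S then single x c else 0)"

lemma lookup_cut: "lookup (cut S z) x = (if x \<in> S then lookup z x else 0)"
proof -
  have "lookup (cut S z) x = (\<Sum>y\<in>keys z. if y = x then (if x \<in> S then lookup z x else 0) else 0)"
    unfolding cut_def lin_def lookup_sum by (rule sum.cong) (auto simp: lookup_single when_def)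
  also have "\<dots> = (if x \<in> S then lookup z x else 0)" by (simp add: in_keys_iff)
  finally show ?thesis .
qed

lemma keys_cut: "keys (cut S z) = keys z \<inter> S"
  by (auto simp: in_keys_iff lookup_cut split: if_splits)

lemma cut_split: "z = cut S z + cut (- S) z"
  by (rule poly_mapping_eqI) (simp add: lookup_add lookup_cut)

text \<open>A filtration argument without quotient complexes. The level \<rho> never rises under
  \<open>bd\<close>, and inside the top level the label is preserved, so the top layer is a direct
  sum of blocks indexed by labels. If each block can be pushed below level r by a boundary, so can
  z. The same lemma serves prefixes of words, facets of a shelling and bar tuples.\<close>

lemma block_step:
  fixes bd :: "('k \<Rightarrow>\<^sub>0 'c::ab_group_add) \<Rightarrow> ('k \<Rightarrow>\<^sub>0 'c)" and \<rho> :: "'k \<Rightarrow> nat" and lab :: "'k \<Rightarrow> 'l"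
  assumes add: "additive bd"
    and z: "keys z \<subseteq> {u \<in> X. \<rho> u \<le> r}" and dz: "keys (bd z) \<subseteq> {u. \<rho> u < r}"
    and mono: "\<And>u c v. u \<in> X \<Longrightarrow> \<rho> u \<le> r \<Longrightarrow> v \<in> keys (bd (single u c)) \<Longrightarrow>
      \<rho> v \<le> \<rho> u \<and> (\<rho> u = r \<and> \<rho> v = r \<longrightarrow> lab v = lab u)"
    and blk: "\<And>l y. keys y \<subseteq> {u \<in> X. \<rho> u = r \<and> lab u = l} \<Longrightarrow> keys (bd y) \<subseteq> {u. \<rho> u < r} \<Longrightarrow>
      \<exists>b. keys b \<subseteq> Y \<and> keys (y - bd b) \<subseteq> {u \<in> X. \<rho> u < r}"
  shows "\<exists>b. keys b \<subseteq> Y \<and> keys (z - bd b) \<subseteq> {u \<in> X. \<rho> u < r}"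
proof -
  define blo where "blo l = cut {u. \<rho> u = r \<and> lab u = l} z" for l
  define lo where "lo = cut {u. \<rho> u < r} z"
  define \<Lambda> where "\<Lambda> = lab ` keys z"
  have fin: "finite \<Lambda>" by (simp add: \<Lambda>_def)
  have decomp: "z = lo + (\<Sum>l\<in>\<Lambda>. blo l)"
  proof (rule poly_mapping_eqI)
    fix x
    show "lookup z x = lookup (lo + (\<Sum>l\<in>\<Lambda>. blo l)) x"
    proof (cases "x \<in> keys z")
      case True
      then have "\<rho> x \<le> r" using z by auto
      have "(\<Sum>l\<in>\<Lambda>. lookup (blo l) x) = (\<Sum>l\<in>\<Lambda>. if l = lab x then (if \<rho> x = r then lookup z x else 0) else 0)"
        by (rule sum.cong) (auto simp: blo_def lookup_cut)
      also have "\<dots> = (if \<rho> x = r then lookup z x else 0)"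
        using True fin by (simp add: \<Lambda>_def)
      finally show ?thesis using \<open>\<rho> x \<le> r\<close>
        by (auto simp: lookup_add lookup_sum lo_def lookup_cut)
    next
      case False
      then show ?thesis
        by (auto simp: lookup_add lookup_sum lo_def blo_def lookup_cut in_keys_iff intro!: sum.neutral)
    qed
  qed
  have "\<exists>b. keys b \<subseteq> Y \<and> keys (blo l - bd b) \<subseteq> {u \<in> X. \<rho> u < r}" for l
  proof (rule blk)
    show "keys (blo l) \<subseteq> {u \<in> X. \<rho> u = r \<and> lab u = l}"
      using z by (auto simp: blo_def keys_cut)
    show "keys (bd (blo l)) \<subseteq> {u. \<rho> u < r}"
    proof
      fix v assume v: "v \<in> keys (bd (blo l))"
      then obtain u where u: "u \<in> keys (blo l)" "v \<in> keys (bd (single u (lookup (blo l) u)))"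
        using keys_additive[OF add] by blast
      have uX: "u \<in> X" "\<rho> u = r" "lab u = l" using u(1) z by (auto simp: blo_def keys_cut)
      have le: "\<rho> v \<le> r" and lb: "\<rho> v = r \<Longrightarrow> lab v = l" using mono[OF _ _ u(2)] uX by auto
      show "v \<in> {u. \<rho> u < r}"
      proof (rule ccontr)
        assume "v \<notin> {u. \<rho> u < r}"
        then have rv: "\<rho> v = r" using le by simp
        then have lv: "lab v = l" using lb by simp
        \<comment> \<open>A boundary term at level r keeps its label, so nothing outside the block l
          reaches v. The coefficient of v is then the same in \<open>bd z\<close>, which contradicts
          \<open>dz\<close>.\<close>
        have nk: "v \<notin> keys (bd (cut (- {u. \<rho> u = r \<and> lab u = l}) z))"
        proof
          assume "v \<in> keys (bd (cut (- {u. \<rho> u = r \<and> lab u = l}) z))"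
          then obtain w where w: "w \<in> keys (cut (- {u. \<rho> u = r \<and> lab u = l}) z)"
              "v \<in> keys (bd (single w (lookup (cut (- {u. \<rho> u = r \<and> lab u = l}) z) w)))"
            using keys_additive[OF add] by blast
          have wX: "w \<in> X" "\<rho> w \<le> r" "\<not> (\<rho> w = r \<and> lab w = l)" using w(1) z by (auto simp: keys_cut)
          show False using mono[OF wX(1,2) w(2)] wX rv lv by auto
        qed
        have "bd z = bd (blo l) + bd (cut (- {u. \<rho> u = r \<and> lab u = l}) z)"
          unfolding blo_def additive.add[OF add, symmetric] by (rule arg_cong[OF cut_split])
        then have "lookup (bd z) v = lookup (bd (blo l)) v"
          using nk by (simp add: lookup_add in_keys_iff)
        then have "v \<in> keys (bd z)" using v by (simp add: in_keys_iff)
        then show False using dz rv by auto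
      qed
    qed
  qed
  then have "\<exists>b. \<forall>l. keys (b l) \<subseteq> Y \<and> keys (blo l - bd (b l)) \<subseteq> {u \<in> X. \<rho> u < r}"
    by (intro choice allI)
  then obtain b where b: "\<And>l. keys (b l) \<subseteq> Y" "\<And>l. keys (blo l - bd (b l)) \<subseteq> {u \<in> X. \<rho> u < r}"
    by auto
  define bb where "bb = (\<Sum>l\<in>\<Lambda>. b l)"
  have "z - bd bb = lo + (\<Sum>l\<in>\<Lambda>. blo l - bd (b l))"
    by (subst decomp) (simp add: bb_def additive.sum[OF add] sum_subtractf)
  moreover have "keys (lo + (\<Sum>l\<in>\<Lambda>. blo l - bd (b l))) \<subseteq> {u \<in> X. \<rho> u < r}"
  proof (rule subset_trans[OF keys_add Un_least])
    show "keys lo \<subseteq> {u \<in> X. \<rho> u < r}" using z by (auto simp: lo_def keys_cut)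
    show "keys (\<Sum>l\<in>\<Lambda>. blo l - bd (b l)) \<subseteq> {u \<in> X. \<rho> u < r}"
      using keys_sum_subset[of "\<lambda>l. blo l - bd (b l)" \<Lambda>] b(2) by blast
  qed
  ultimately have "keys (z - bd bb) \<subseteq> {u \<in> X. \<rho> u < r}" by simp
  moreover have "keys bb \<subseteq> Y" using keys_sum_subset[of b \<Lambda>] b(1) unfolding bb_def by blast
  ultimately show ?thesis by blast
qed

section \<open>The boundary on lists\<close>

text \<open>The augmented boundary of ordered words: a one-letter word has the empty word as its
  boundary. In this recursive form, prefixing a letter is visibly a contracting homotopy.\<close>

primrec list_bd :: "'a list \<Rightarrow> 'c::ab_group_add \<Rightarrow> ('a list \<Rightarrow>\<^sub>0 'c)" where
  "list_bd [] c = 0"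
| "list_bd (x # xs) c = single xs c - push ((#) x) (list_bd xs c)"

lemma additive_list_bd: "additive (list_bd xs)"
proof (induction xs)
  case (Cons x xs)
  then show ?case
    unfolding list_bd.simps
    by (intro additive_minus additive_single additive_comp[OF additive_push])
qed (simp add: additive_def)

definition bdl :: "('a list \<Rightarrow>\<^sub>0 'c::ab_group_add) \<Rightarrow> ('a list \<Rightarrow>\<^sub>0 'c)" where
  "bdl = lin list_bd"

lemma additive_bdl: "additive bdl"
  unfolding bdl_def by (rule additive_lin) (rule additive_list_bd)

lemmas additive_intros = additive_id additive_0 additive_plus additive_minus additive_uminus
  additive_comp[OF additive_bdl] additive_comp[OF additive_push]

lemma bdl_single [simp]: "bdl (single xs c) = list_bd xs c"
  by (simp add: bdl_def lin_single additive_list_bd)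

lemma bdl_push_Cons: "bdl (push ((#) x) z) = z - push ((#) x) (bdl z)"
  by (rule additive_eqI[of "\<lambda>z. bdl (push ((#) x) z)" "\<lambda>z. z - push ((#) x) (bdl z)"])
    (intro additive_intros, intro additive_intros, simp)

lemma bdl_list_bd: "bdl (list_bd xs c) = 0"
  by (induction xs) (simp_all add: additive.zero[OF additive_bdl] additive.diff[OF additive_bdl]
      bdl_push_Cons push_zero)

definition del :: "nat \<Rightarrow> 'a list \<Rightarrow> 'a list" where
  "del i xs = take i xs @ drop (Suc i) xs"

definition sg :: "nat \<Rightarrow> 'c::ab_group_add \<Rightarrow> 'c" where
  "sg i c = (if even i then c else - c)"

lemma list_bd_sum: "list_bd xs c = (\<Sum>i<length xs. single (del i xs) (sg i c))"
proof (induction xs)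
  case (Cons x xs)
  have "push ((#) x) (list_bd xs c) = (\<Sum>i<length xs. - single (del (Suc i) (x # xs)) (sg (Suc i) c))"
    unfolding Cons.IH push_sum
    by (rule sum.cong) (auto simp: del_def sg_def single_uminus)
  then show ?case
    unfolding list_bd.simps length_Cons sum.lessThan_Suc_shift
    by (simp add: del_def sg_def sum_negf)
qed simp

lemma keys_list_bd: "keys (list_bd xs c) \<subseteq> {del i xs |i. i < length xs}"
  unfolding list_bd_sum using keys_sum_subset[of "\<lambda>i. single (del i xs) (sg i c)" "{..<length xs}"]
  by (fastforce split: if_splits)

lemma length_del: "i < length xs \<Longrightarrow> length (del i xs) = length xs - 1"
  by (auto simp: del_def)

lemma set_del: "set (del i xs) \<subseteq> set xs"
  by (auto simp: del_def dest: in_set_takeD in_set_dropD)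

lemma distinct_del: "distinct xs \<Longrightarrow> distinct (del i xs)"
  by (auto simp: del_def distinct_append set_take_disj_set_drop_if_distinct)

lemma map_del: "map f (del i xs) = del i (map f xs)"
  by (simp add: del_def take_map drop_map)

lemma push_map_list_bd: "push (map f) (list_bd xs c) = list_bd (map f xs) c"
  by (simp add: list_bd_sum push_sum map_del)

text \<open>Separates the faces according to whether the deleted letter lies before the marked
  letter \<open>a\<close>, is \<open>a\<close> itself, or lies after it. Only faces of the last kind
  keep the prefix.\<close>

lemma list_bd_append_Cons:
  "list_bd (x @ a # y) c =
    push (\<lambda>x'. x' @ a # y) (list_bd x c) + single (x @ y) (sg (length x) c)
    + push (\<lambda>y'. x @ a # y') (list_bd y (sg (Suc (length x)) c))"
proof (induction x arbitrary: c)
  case Nil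
  show ?case by (simp add: sg_def push_zero additive.minus[OF additive_list_bd] additive.minus[OF additive_push])
next
  case (Cons b x)
  show ?case
    by (simp add: Cons.IH push_add push_diff push_push)
       (simp add: sg_def single_uminus additive.minus[OF additive_list_bd] additive.minus[OF additive_push])
qed

lemma additive_sg: "additive (sg n)"
  by (simp add: additive_def sg_def)

lemma sg_additive: "additive F \<Longrightarrow> F (sg n c) = sg n (F c)"
  by (simp add: sg_def additive.minus)

lemma keys_sg: "keys (sg n z) = keys z"
  by (simp add: sg_def keys_uminus_chain)

lemma sg_sg [simp]: "sg n (sg n c) = c"
  by (simp add: sg_def)

lemma del_append:
  "del i (xs @ ys) = (if i < length xs then del i xs @ ys else xs @ del (i - length xs) ys)"
  by (auto simp: del_def Suc_diff_le)

lemma del_Cons: "del i (a # y) = (case i of 0 \<Rightarrow> y | Suc j \<Rightarrow> a # del j y)"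
  by (auto simp: del_def split: nat.split)

section \<open>Injective words\<close>

definition inj_words :: "'a set \<Rightarrow> nat \<Rightarrow> 'a list set" where
  "inj_words L k = {xs. distinct xs \<and> set xs \<subseteq> L \<and> length xs = k}"

lemma keys_bdl_subset:
  assumes "\<And>u i. u \<in> keys z \<Longrightarrow> i < length u \<Longrightarrow> del i u \<in> S"
  shows "keys (bdl z) \<subseteq> S"
  by (rule keys_additive_subset[OF additive_bdl]) (use keys_list_bd assms in fastforce)

lemma keys_bdl_inj_words: "keys z \<subseteq> inj_words L (Suc k) \<Longrightarrow> keys (bdl z) \<subseteq> inj_words L k"
  by (rule keys_bdl_subset)
    (use set_del in \<open>fastforce simp: inj_words_def distinct_del length_del\<close>)

lemma bdl_bdl: "bdl (bdl z) = 0"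
  by (rule additive_eqI[of "\<lambda>z. bdl (bdl z)" "\<lambda>z. 0"])
    (intro additive_intros, intro additive_intros, simp add: bdl_list_bd)

text \<open>The words that do not use all the letters of \<open>F\<close> form a subcomplex; the quotient is exact
  below the top degree. A letter \<open>a\<close> outside \<open>F\<close> provides the contraction \<open>x \<mapsto> a x\<close> on the words that
  do not contain \<open>a\<close> or start with it, and the words \<open>x a y\<close> with a fixed prefix \<open>x \<noteq> []\<close> form a
  complex of the same kind with fewer letters.\<close>

lemma inj_words_exact:
  fixes z :: "'a list \<Rightarrow>\<^sub>0 'c::ab_group_add"
  assumes "finite L" "F \<subseteq> L" "keys z \<subseteq> inj_words L k" "k < card L"
    and "keys (bdl z) \<subseteq> {xs. \<not> F \<subseteq> set xs}"
  shows "\<exists>b. keys b \<subseteq> inj_words L (Suc k) \<and> keys (z - bdl b) \<subseteq> {xs. \<not> F \<subseteq> set xs}"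
  using assms
proof (induction "card L" arbitrary: L F z k rule: less_induct)
  case (less L F z k)
  show ?case
  proof (cases "F = L")
    case True
    \<comment> \<open>When every letter is required, a word of length k < card L is too short to
      contain them all, so the quotient vanishes.\<close>
    have "\<not> F \<subseteq> set xs" if "xs \<in> keys z" for xs
    proof
      assume "F \<subseteq> set xs"
      then have "card L \<le> card (set xs)" using True card_mono by blast
      moreover have "card (set xs) = k"
        using that less.prems(3) by (auto simp: inj_words_def distinct_card)
      ultimately show False using less.prems(4) by simp
    qed
    then show ?thesis
      by (intro exI[of _ 0]) (auto simp: additive.zero[OF additive_bdl])
  next
    case False
    then obtain a where a: "a \<in> L" "a \<notin> F" using less.prems(2) by blast
    define pre where "pre xs = takeWhile (\<lambda>x. x \<noteq> a) xs" for xs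
    \<comment> \<open>Level 0 is the subcomplex to be ignored. Words without \<open>a\<close> and
      words starting with \<open>a\<close> share level 1, because prefixing \<open>a\<close> pairs
      them; a nonempty prefix of length p before the first \<open>a\<close> gives level p +
      1.\<close>
    define \<rho> where "\<rho> xs = (if \<not> F \<subseteq> set xs then 0 else if a \<notin> set xs then 1 else Suc (length (pre xs)))"
      for xs
    have pre: "pre (x @ a # y) = x" if "a \<notin> set x" for x y
      using that unfolding pre_def by (induction x) auto
    have rho: "\<rho> (x @ a # y) = (if F \<subseteq> set x \<union> set y then Suc (length x) else 0)" if "a \<notin> set x" for x y
      using pre[OF that] a(2) by (auto simp: \<rho>_def)
    have rho_le1: "\<rho> u \<le> 1" if "a \<notin> set u" for u using that by (simp add: \<rho>_def)
    \<comment> \<open>The prefix serves as a label only from level 2 on: a word without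
      \<open>a\<close> is its own prefix, and deletions change it.\<close>
    have mono: "\<rho> (del i u) \<le> \<rho> u \<and> (\<rho> u = r \<and> \<rho> (del i u) = r \<and> r \<ge> 2 \<longrightarrow> pre (del i u) = pre u)"
      if u: "distinct u" "i < length u" for i u r
    proof (cases "a \<in> set u")
      case False
      then have "a \<notin> set (del i u)" using set_del by fastforce
      moreover have "F \<subseteq> set (del i u) \<Longrightarrow> F \<subseteq> set u" using set_del by fastforce
      ultimately show ?thesis using False by (auto simp: \<rho>_def)
    next
      case True
      then obtain x y where xy: "u = x @ a # y" "a \<notin> set x" using split_list_first by metis
      then have ay: "a \<notin> set y" using u(1) by auto
      consider "i < length x" | "i = length x" | "i > length x" by linarith
      then show ?thesis
      proof cases
        case 1
        then have e: "del i u = del i x @ a # y" by (simp add: xy(1) del_append)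
        have "a \<notin> set (del i x)" using xy(2) set_del by fastforce
        then have "\<rho> (del i u) = (if F \<subseteq> set (del i x) \<union> set y then length x else 0)"
          using 1 length_del[OF 1] by (cases "length x") (auto simp: e rho)
        moreover have "\<rho> u = (if F \<subseteq> set x \<union> set y then Suc (length x) else 0)"
          by (simp add: xy rho)
        moreover have "F \<subseteq> set (del i x) \<union> set y \<Longrightarrow> F \<subseteq> set x \<union> set y" using set_del by fastforce
        ultimately show ?thesis by auto
      next
        case 2
        then have e: "del i u = x @ y" by (simp add: xy(1) del_append del_Cons)
        then have "\<rho> (del i u) \<le> 1" using rho_le1 xy(2) ay by simp
        moreover have "\<rho> (del i u) = 0 \<or> \<rho> u \<ge> 1" using e xy by (auto simp: \<rho>_def)
        ultimately show ?thesis by auto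
      next
        case 3
        then obtain j where "i = Suc (length x + j)" using less_imp_Suc_add by blast
        then have e: "del i u = x @ a # del j y" by (simp add: xy(1) del_append del_Cons)
        have "F \<subseteq> set x \<union> set (del j y) \<Longrightarrow> F \<subseteq> set x \<union> set y" using set_del by fastforce
        moreover have "\<rho> u = (if F \<subseteq> set x \<union> set y then Suc (length x) else 0)" "pre u = x"
          using xy(2) by (simp_all add: xy(1) rho pre)
        moreover have "\<rho> (del i u) = (if F \<subseteq> set x \<union> set (del j y) then Suc (length x) else 0)"
            "pre (del i u) = x"
          using xy(2) by (simp_all add: e rho pre)
        ultimately show ?thesis by auto
      qed
    qed
    have claim: "\<exists>b. keys b \<subseteq> inj_words L (Suc k) \<and> keys (z - bdl b) \<subseteq> {xs. \<not> F \<subseteq> set xs}"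
      if "keys z \<subseteq> {u \<in> inj_words L k. \<rho> u \<le> r}" "keys (bdl z) \<subseteq> {xs. \<not> F \<subseteq> set xs}" for r and z :: "'a list \<Rightarrow>\<^sub>0 'c"
      using that
    proof (induction r arbitrary: z)
      case 0
      then have "keys z \<subseteq> {xs. \<not> F \<subseteq> set xs}" by (auto simp: \<rho>_def split: if_splits)
      then show ?case
        by (intro exI[of _ 0]) (auto simp: additive.zero[OF additive_bdl])
    next
      case (Suc r)
      show ?case
      proof (cases "r = 0")
        case True
        \<comment> \<open>Cone off the part of z that avoids \<open>a\<close>. In z - d(a z0) every
          word contains \<open>a\<close>; those not starting with \<open>a\<close> come from z and
          have a nonempty prefix, so level at most 1 forces them down to level 0.\<close>
        define z0 where "z0 = cut {u. a \<notin> set u} z"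
        define b where "b = push ((#) a) z0"
        have kb: "keys b \<subseteq> inj_words L (Suc k)"
        proof
          fix v assume "v \<in> keys b"
          then obtain u where "v = a # u" "u \<in> keys z0" using keys_push[of "(#) a" z0] by (auto simp: b_def)
          then show "v \<in> inj_words L (Suc k)"
            using Suc.prems(1) a(1) by (auto simp: z0_def keys_cut inj_words_def)
        qed
        define z' where "z' = z - bdl b"
        have z'_eq: "z' = z - z0 + push ((#) a) (bdl z0)"
          by (simp add: z'_def b_def bdl_push_Cons)
        have kz': "keys z' \<subseteq> inj_words L k"
          using keys_minus_subset[of z "bdl b"] keys_bdl_inj_words[OF kb] Suc.prems(1)
          unfolding z'_def by blast
        define A where "A = {u. u \<noteq> [] \<and> hd u = a}"
        define y where "y = push tl (cut A z')"
        define n where "n = cut (- A) z'"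
        have "push ((#) a) y = push (\<lambda>u. u) (cut A z')"
          unfolding y_def push_push by (rule push_cong) (auto simp: keys_cut A_def)
        then have py: "push ((#) a) y = cut A z'" by simp
        have z'_split: "z' = push ((#) a) y + n"
          unfolding py n_def by (rule cut_split)
        have kn: "keys n \<subseteq> {xs. \<not> F \<subseteq> set xs}"
        proof
          fix v assume v: "v \<in> keys n"
          then have vA: "v \<notin> A" and vz': "v \<in> keys z'" by (auto simp: n_def keys_cut)
          have "v \<notin> keys (push ((#) a) (bdl z0))"
            using keys_push[of "(#) a" "bdl z0"] vA by (auto simp: A_def)
          then have "v \<in> keys (z - z0)" using vz' by (simp add: z'_eq in_keys_iff lookup_add)
          then have vz: "v \<in> keys z" "a \<in> set v"
            by (auto simp: z0_def in_keys_iff lookup_minus lookup_cut split: if_splits)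
          then obtain x w where xw: "v = x @ a # w" "a \<notin> set x" using split_list_first by metis
          have "x \<noteq> []" using vA xw by (auto simp: A_def)
          moreover have "\<rho> v \<le> 1" using vz(1) Suc.prems(1) True by auto
          ultimately have "\<not> F \<subseteq> set x \<union> set w" using rho[OF xw(2), of w] xw(1) by (auto split: if_splits)
          then show "v \<in> {xs. \<not> F \<subseteq> set xs}" using xw a(2) by auto
        qed
        have kbn: "keys (bdl n) \<subseteq> {xs. \<not> F \<subseteq> set xs}"
          by (rule keys_bdl_subset) (use kn set_del in fastforce)
        have bz': "bdl z' = bdl z"
          by (simp add: z'_def additive.diff[OF additive_bdl] bdl_bdl)
        have bz'2: "bdl z' = y - push ((#) a) (bdl y) + bdl n"
          by (subst z'_split) (simp add: additive.add[OF additive_bdl] bdl_push_Cons)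
        \<comment> \<open>Compare coefficients at v, which is free of \<open>a\<close>, in d z' = y
          - a d y + d n. If v used all of \<open>F\<close>, neither a d y nor d n could cancel it,
          whereas d z' = d z lies in level 0.\<close>
        have ky: "\<not> F \<subseteq> set v" if v: "v \<in> keys y" for v
        proof
          assume F: "F \<subseteq> set v"
          obtain u where "v = tl u" "u \<in> keys (cut A z')"
            using v keys_push[of tl "cut A z'"] unfolding y_def by blast
          then have "a # v \<in> keys z'" by (auto simp: keys_cut A_def)
          then have "a \<notin> set v" using kz' by (auto simp: inj_words_def)
          then have "v \<notin> keys (push ((#) a) (bdl y))" using keys_push[of "(#) a" "bdl y"] by auto
          moreover have "v \<notin> keys (bdl n)" using kbn F by auto
          ultimately have "lookup (bdl z') v = lookup y v"
            by (simp add: bz'2 lookup_add lookup_minus in_keys_iff)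
          moreover have "v \<notin> keys (bdl z')" using Suc.prems(2) F bz' by auto
          ultimately show False using v by (simp add: in_keys_iff)
        qed
        have "keys z' \<subseteq> {xs. \<not> F \<subseteq> set xs}"
        proof
          fix v assume "v \<in> keys z'"
          then have "v \<in> keys (push ((#) a) y) \<or> v \<in> keys n"
            using keys_add[of "push ((#) a) y" n] unfolding z'_split[symmetric] by blast
          then show "v \<in> {xs. \<not> F \<subseteq> set xs}"
          proof
            assume "v \<in> keys (push ((#) a) y)"
            then obtain w where "v = a # w" "w \<in> keys y" using keys_push[of "(#) a" y] by blast
            then show ?thesis using ky[of w] a(2) by auto
          qed (use kn in blast)
        qed
        then show ?thesis using kb z'_def by blast
      next
        case False
        have "\<exists>b. keys b \<subseteq> inj_words L (Suc k) \<and> keys (z - bdl b) \<subseteq> {u \<in> inj_words L k. \<rho> u < Suc r}"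
        proof (rule block_step[OF additive_bdl, where lab = pre])
          show "keys z \<subseteq> {u \<in> inj_words L k. \<rho> u \<le> Suc r}" by (rule Suc.prems(1))
          show "keys (bdl z) \<subseteq> {u. \<rho> u < Suc r}"
            using Suc.prems(2) by (auto simp: \<rho>_def)
          show "\<rho> v \<le> \<rho> u \<and> (\<rho> u = Suc r \<and> \<rho> v = Suc r \<longrightarrow> pre v = pre u)"
            if u: "u \<in> inj_words L k" and v: "v \<in> keys (bdl (single u c))" for u c v
          proof -
            obtain i where "v = del i u" "i < length u" using v keys_list_bd[of u c] by auto
            moreover have "distinct u" using u by (simp add: inj_words_def)
            ultimately show ?thesis using mono[of u i "Suc r"] False by auto
          qed
        next
          fix x and y :: "'a list \<Rightarrow>\<^sub>0 'c" assume y: "keys y \<subseteq> {u \<in> inj_words L k. \<rho> u = Suc r \<and> pre u = x}"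
            and dy: "keys (bdl y) \<subseteq> {u. \<rho> u < Suc r}"
          show "\<exists>b. keys b \<subseteq> inj_words L (Suc k) \<and> keys (y - bdl b) \<subseteq> {u \<in> inj_words L k. \<rho> u < Suc r}"
          proof (cases "keys y = {}")
            case True
            then show ?thesis
              by (intro exI[of _ 0]) (auto simp: additive.zero[OF additive_bdl])
          next
            case ne: False
            have form: "\<exists>w. u = x @ a # w \<and> a \<notin> set x \<and> length x = r" if "u \<in> keys y" for u
            proof -
              have 1: "\<rho> u = Suc r" "pre u = x" using that y by auto
              then have "a \<in> set u" using False rho_le1[of u] by fastforce
              then obtain x' w where xw: "u = x' @ a # w" "a \<notin> set x'" using split_list_first by metis
              then have "x' = x" using pre 1(2) by simp
              then show ?thesis using xw rho[OF xw(2), of w] 1(1) by (auto split: if_splits)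
            qed
            obtain u0 where "u0 \<in> keys y" using ne by blast
            then obtain w0 where u0: "u0 \<in> keys y" "u0 = x @ a # w0" and x: "a \<notin> set x" "length x = r"
              using form by blast
            then have u0': "u0 \<in> inj_words L k" using y by auto
            then have dx: "distinct x" "set x \<subseteq> L" "length w0 + Suc r = k"
              using u0(2) x(2) by (auto simp: inj_words_def)
            \<comment> \<open>The suffix behind x a is an injective word in the remaining letters,
              and it has to supply the letters of \<open>F\<close> that x does not contain. Both k
              and the number of letters drop by r + 1, which preserves the bound for the
              induction.\<close>
            define L' where "L' = L - insert a (set x)"
            have cL': "card L' = card L - Suc r"
              using dx x a(1) less.prems(1) unfolding L'_def
              by (subst card_Diff_subset) (auto simp: distinct_card)
            have cL: "Suc r \<le> card L" using less.prems(4) dx(3) by simp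
            define F' where "F' = F - set x"
            define \<zeta> where "\<zeta> = push (drop (Suc r)) y"
            define J where "J = (\<lambda>w. x @ a # w)"
            have injJ: "inj J" by (auto simp: J_def inj_def)
            have y_eq: "y = push J \<zeta>"
            proof -
              have "push J \<zeta> = push (\<lambda>u. u) y"
                unfolding \<zeta>_def push_push by (rule push_cong) (use form in \<open>fastforce simp: J_def\<close>)
              then show ?thesis by simp
            qed
            have kz: "keys \<zeta> \<subseteq> inj_words L' (k - Suc r)"
            proof
              fix w assume "w \<in> keys \<zeta>"
              then have "J w \<in> keys y" using y_eq keys_push_inj[OF injJ, of \<zeta>] by auto
              then have "J w \<in> inj_words L k" using y by auto
              then show "w \<in> inj_words L' (k - Suc r)"
                using x(2) by (auto simp: J_def inj_words_def L'_def)
            qed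
            \<comment> \<open>\<open>R\<close> collects the faces that delete a letter of x or the
              letter \<open>a\<close>. All of them fall to a lower level, so modulo lower levels the
              boundary acts on the suffix alone, up to the sign of r + 1.\<close>
            define R where "R w c = push (\<lambda>x'. x' @ a # w) (list_bd x c) + single (x @ w) (sg r c)"
              for w and c :: 'c
            have addR: "additive (R w)" for w
              unfolding R_def
              by (intro additive_plus additive_comp[OF additive_push] additive_list_bd
                  additive_comp[OF additive_single] additive_sg)
            have bdJ: "bdl (push J t) = lin R t + sg (Suc r) (push J (bdl t))" for t
            proof (rule additive_eqI[of "\<lambda>t. bdl (push J t)"])
              show "additive (\<lambda>t. bdl (push J t))"
                by (intro additive_comp[OF additive_bdl] additive_push)
              show "additive (\<lambda>t. lin R t + sg (Suc r) (push J (bdl t)))"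
                by (intro additive_plus additive_lin addR additive_comp[OF additive_sg]
                    additive_comp[OF additive_push] additive_bdl)
              show "bdl (push J (single w c)) = lin R (single w c) + sg (Suc r) (push J (bdl (single w c)))"
                for w c
                by (simp add: lin_single[OF addR])
                   (simp add: J_def list_bd_append_Cons R_def x(2)
                    sg_additive[OF additive_list_bd] sg_additive[OF additive_push])
            qed
            have kR: "keys (lin R t) \<subseteq> {u. \<rho> u < Suc r}" if t: "keys t \<subseteq> inj_words L' q" for t q
            proof (rule keys_additive_subset[OF additive_lin[OF addR]])
              fix w and c :: 'c assume "w \<in> keys t"
              then have aw: "a \<notin> set w" using t by (auto simp: inj_words_def L'_def)
              have "keys (R w c) \<subseteq> keys (push (\<lambda>x'. x' @ a # w) (list_bd x c)) \<union> keys (single (x @ w) (sg r c))"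
                unfolding R_def by (rule keys_add)
              also have "\<dots> \<subseteq> {del i x @ a # w |i. i < length x} \<union> {x @ w}"
                using keys_push[of "\<lambda>x'. x' @ a # w" "list_bd x c"] keys_list_bd[of x c]
                by (fastforce split: if_splits)
              also have "\<dots> \<subseteq> {u. \<rho> u < Suc r}"
              proof -
                have "\<rho> (del i x @ a # w) < Suc r" if "i < length x" for i
                proof -
                  have "a \<notin> set (del i x)" using x set_del by fastforce
                  then show ?thesis using that x(2) length_del[OF that] by (simp add: rho)
                qed
                moreover have "\<rho> (x @ w) < Suc r"
                  using rho_le1[of "x @ w"] x(1) aw False by simp
                ultimately show ?thesis by blast
              qed
              finally show "keys (lin R (single w c)) \<subseteq> {u. \<rho> u < Suc r}"
                by (simp add: lin_single[OF addR])
            qed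
            have dz: "keys (bdl \<zeta>) \<subseteq> {v. \<not> F' \<subseteq> set v}"
            proof (rule ccontr)
              assume "\<not> ?thesis"
              then obtain v where v: "v \<in> keys (bdl \<zeta>)" "F' \<subseteq> set v" by auto
              then have "J v \<in> keys (sg (Suc r) (push J (bdl \<zeta>)))"
                by (auto simp: keys_sg keys_push_inj[OF injJ])
              moreover have rv: "\<rho> (J v) = Suc r"
                using v(2) rho[OF x(1), of v] x(2) by (auto simp: J_def F'_def)
              moreover have "J v \<notin> keys (lin R \<zeta>)" using kR[OF kz] rv by auto
              ultimately have "J v \<in> keys (bdl y)"
                by (simp add: y_eq bdJ in_keys_iff lookup_add)
              then show False using dy rv by auto
            qed
            have "\<exists>b. keys b \<subseteq> inj_words L' (Suc (k - Suc r)) \<and> keys (\<zeta> - bdl b) \<subseteq> {xs. \<not> F' \<subseteq> set xs}"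
            proof (rule less.hyps[OF _ _ _ kz _ dz])
              show "card L' < card L" using cL' cL by simp
              show "k - Suc r < card L'" using cL' cL less.prems(4) dx(3) by simp
              show "finite L'" using less.prems(1) by (simp add: L'_def)
              show "F' \<subseteq> L'" using less.prems(2) a(2) by (auto simp: F'_def L'_def)
            qed
            then obtain \<beta> where \<beta>: "keys \<beta> \<subseteq> inj_words L' (Suc (k - Suc r))"
                "keys (\<zeta> - bdl \<beta>) \<subseteq> {xs. \<not> F' \<subseteq> set xs}" by blast
            define b where "b = sg (Suc r) (push J \<beta>)"
            have kb: "keys b \<subseteq> inj_words L (Suc k)"
            proof -
              have "J w \<in> inj_words L (Suc k)" if "w \<in> inj_words L' (Suc (k - Suc r))" for w
                using that x dx a(1) by (auto simp: J_def inj_words_def L'_def)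
              then show ?thesis using \<beta>(1) by (auto simp: b_def keys_sg keys_push_inj[OF injJ])
            qed
            have "bdl b = sg (Suc r) (lin R \<beta>) + push J (bdl \<beta>)"
              by (simp add: b_def sg_additive[OF additive_bdl] bdJ additive.add[OF additive_sg])
            then have yb: "y - bdl b = push J (\<zeta> - bdl \<beta>) - sg (Suc r) (lin R \<beta>)"
              by (simp add: y_eq push_diff)
            have "keys (push J (\<zeta> - bdl \<beta>)) \<subseteq> {u. \<rho> u < Suc r}"
            proof
              fix u assume "u \<in> keys (push J (\<zeta> - bdl \<beta>))"
              then obtain v where v: "u = J v" "\<not> F' \<subseteq> set v"
                using \<beta>(2) keys_push[of J "\<zeta> - bdl \<beta>"] by blast
              then have "\<not> F \<subseteq> set u" using a(2) by (auto simp: J_def F'_def)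
              then show "u \<in> {u. \<rho> u < Suc r}" by (simp add: \<rho>_def)
            qed
            moreover have "keys (sg (Suc r) (lin R \<beta>)) \<subseteq> {u. \<rho> u < Suc r}"
              using kR[OF \<beta>(1)] by (simp add: keys_sg)
            ultimately have "keys (y - bdl b) \<subseteq> {u. \<rho> u < Suc r}"
              unfolding yb using keys_minus_subset by fast
            moreover have "keys (y - bdl b) \<subseteq> inj_words L k"
              using keys_minus_subset[of y "bdl b"] keys_bdl_inj_words[OF kb] y by blast
            ultimately show ?thesis using kb by blast
          qed
        qed
        then obtain b where b: "keys b \<subseteq> inj_words L (Suc k)"
            "keys (z - bdl b) \<subseteq> {u \<in> inj_words L k. \<rho> u < Suc r}" by blast
        have "\<exists>b'. keys b' \<subseteq> inj_words L (Suc k) \<and> keys (z - bdl b - bdl b') \<subseteq> {xs. \<not> F \<subseteq> set xs}"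
        proof (rule Suc.IH)
          show "keys (z - bdl b) \<subseteq> {u \<in> inj_words L k. \<rho> u \<le> r}" using b(2) by auto
          show "keys (bdl (z - bdl b)) \<subseteq> {xs. \<not> F \<subseteq> set xs}"
            using Suc.prems(2) by (simp add: additive.diff[OF additive_bdl] bdl_bdl)
        qed
        then obtain b' where b': "keys b' \<subseteq> inj_words L (Suc k)"
            "keys (z - bdl b - bdl b') \<subseteq> {xs. \<not> F \<subseteq> set xs}" by blast
        have "keys (b + b') \<subseteq> inj_words L (Suc k)" using keys_add[of b b'] b b' by blast
        then show ?thesis using b'(2)
          by (intro exI[of _ "b + b'"]) (simp add: additive.add[OF additive_bdl] diff_diff_eq)
      qed
    qed
    show ?thesis
    proof (rule claim[of z "Suc k"])
      show "keys z \<subseteq> {u \<in> inj_words L k. \<rho> u \<le> Suc k}"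
      proof
        fix u assume "u \<in> keys z"
        then have u: "u \<in> inj_words L k" using less.prems(3) by blast
        moreover have "length (pre u) \<le> length u" unfolding pre_def by (rule length_takeWhile_le)
        ultimately show "u \<in> {u \<in> inj_words L k. \<rho> u \<le> Suc k}"
          by (simp add: \<rho>_def inj_words_def)
      qed
    qed (rule less.prems(5))
  qed
qed

section \<open>Shellable families of simplices\<close>

text \<open>Filter words by the smallest rank of a facet containing them. The shelling condition
  makes that facet unique, so each layer splits into blocks indexed by facets. In the block of L,
  dropping to a lower level means omitting a letter from a fixed set \<open>F\<close>, so
  \<open>inj_words_exact\<close> applies. Ties between ranks do no harm.\<close>

lemma shellable_exact:
  fixes \<L> :: "'x set set" and rk :: "'x set \<Rightarrow> nat" and z :: "'x list \<Rightarrow>\<^sub>0 'c::ab_group_add"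
  assumes fin: "\<And>L. L \<in> \<L> \<Longrightarrow> finite L \<and> card L = N"
    and shell: "\<And>L L'. L \<in> \<L> \<Longrightarrow> L' \<in> \<L> \<Longrightarrow> L \<noteq> L' \<Longrightarrow> rk L' \<le> rk L \<Longrightarrow>
      \<exists>f\<in>L - L'. \<exists>L''\<in>\<L>. rk L'' < rk L \<and> L - {f} \<subseteq> L''"
    and z: "keys z \<subseteq> (\<Union>L\<in>\<L>. inj_words L k)" and k: "k < N" and dz: "bdl z = 0"
  shows "\<exists>b. keys b \<subseteq> (\<Union>L\<in>\<L>. inj_words L (Suc k)) \<and> bdl b = z"
proof -
  define X where "X j = (\<Union>L\<in>\<L>. inj_words L j)" for j
  define \<rho> where "\<rho> xs = (LEAST r. \<exists>L\<in>\<L>. rk L = r \<and> set xs \<subseteq> L)" for xs :: "'x list"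
  define lab where "lab xs = (SOME L. L \<in> \<L> \<and> rk L = \<rho> xs \<and> set xs \<subseteq> L)" for xs :: "'x list"
  have rho_le: "\<rho> xs \<le> rk L" if "L \<in> \<L>" "set xs \<subseteq> L" for xs L
    unfolding \<rho>_def by (rule Least_le) (use that in blast)
  have rho_ex: "\<exists>L. L \<in> \<L> \<and> rk L = \<rho> xs \<and> set xs \<subseteq> L" if "L \<in> \<L>" "set xs \<subseteq> L" for xs L
    using LeastI[of "\<lambda>r. \<exists>L\<in>\<L>. rk L = r \<and> set xs \<subseteq> L" "rk L"] that unfolding \<rho>_def by blast
  have lab: "lab xs \<in> \<L>" "rk (lab xs) = \<rho> xs" "set xs \<subseteq> lab xs" if "L \<in> \<L>" "set xs \<subseteq> L" for xs L
    using someI_ex[OF rho_ex[OF that]] unfolding lab_def by auto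
  \<comment> \<open>Two distinct facets of the same minimal rank would, by the shelling condition,
    put the word into a facet of smaller rank.\<close>
  have uniq: "L = lab xs" if L: "L \<in> \<L>" "rk L = \<rho> xs" "set xs \<subseteq> L" for xs L
  proof (rule ccontr)
    note lx = lab[OF L(1,3)]
    assume "L \<noteq> lab xs"
    then obtain f L'' where "f \<in> L - lab xs" "L'' \<in> \<L>" "rk L'' < rk L" "L - {f} \<subseteq> L''"
      using shell[OF L(1) lx(1)] lx(2) L(2) by auto
    then show False using rho_le[of L'' xs] L lx(3) by auto
  qed
  have face: "\<rho> (del i u) \<le> \<rho> u \<and> (\<rho> (del i u) = \<rho> u \<longrightarrow> lab (del i u) = lab u)"
    if "u \<in> X j" for u i j
  proof -
    obtain L where L: "L \<in> \<L>" "set u \<subseteq> L" using \<open>u \<in> X j\<close> by (auto simp: X_def inj_words_def)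
    note lx = lab[OF L]
    have s: "set (del i u) \<subseteq> lab u" using lx(3) set_del by fastforce
    then show ?thesis using rho_le[OF lx(1) s] uniq[OF lx(1) _ s] lx(2) by auto
  qed
  have claim: "\<exists>b. keys b \<subseteq> X (Suc k) \<and> bdl b = z"
    if "keys z \<subseteq> {u \<in> X k. \<rho> u < r}" "bdl z = 0" for r and z :: "'x list \<Rightarrow>\<^sub>0 'c"
    using that
  proof (induction r arbitrary: z)
    case 0
    then have "keys z = {}" by auto
    then have "z = 0" by simp
    then show ?case by (intro exI[of _ 0]) (simp add: additive.zero[OF additive_bdl])
  next
    case (Suc r)
    have "\<exists>b. keys b \<subseteq> X (Suc k) \<and> keys (z - bdl b) \<subseteq> {u \<in> X k. \<rho> u < r}"
    proof (rule block_step[OF additive_bdl, where lab = lab])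
      show "keys z \<subseteq> {u \<in> X k. \<rho> u \<le> r}" using Suc.prems(1) by auto
      show "keys (bdl z) \<subseteq> {u. \<rho> u < r}" by (simp add: Suc.prems(2))
      show "\<rho> v \<le> \<rho> u \<and> (\<rho> u = r \<and> \<rho> v = r \<longrightarrow> lab v = lab u)"
        if u: "u \<in> X k" and v: "v \<in> keys (bdl (single u c))" for u c v
      proof -
        obtain i where "v = del i u" using v keys_list_bd[of u c] by auto
        then show ?thesis using face[OF u, of i] by auto
      qed
    next
      fix L and y :: "'x list \<Rightarrow>\<^sub>0 'c" assume y: "keys y \<subseteq> {u \<in> X k. \<rho> u = r \<and> lab u = L}"
        and dy: "keys (bdl y) \<subseteq> {u. \<rho> u < r}"
      show "\<exists>b. keys b \<subseteq> X (Suc k) \<and> keys (y - bdl b) \<subseteq> {u \<in> X k. \<rho> u < r}"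
      proof (cases "keys y = {}")
        case True
        then show ?thesis
          by (intro exI[of _ 0]) (auto simp: additive.zero[OF additive_bdl])
      next
        case False
        then obtain u0 where u0: "u0 \<in> keys y" by blast
        then have u0': "u0 \<in> X k" "\<rho> u0 = r" "lab u0 = L" using y by auto
        then obtain L0 where "L0 \<in> \<L>" "set u0 \<subseteq> L0" by (auto simp: X_def inj_words_def)
        note lx = lab[OF this]
        have L: "L \<in> \<L>" "rk L = r" using lx u0' by auto
        \<comment> \<open>The restriction of the facet L: the vertices opposite to those
          codimension-one faces that already lie in an earlier facet.\<close>
        define F where "F = {f \<in> L. \<exists>L''\<in>\<L>. rk L'' < r \<and> L - {f} \<subseteq> L''}"
        have F: "\<rho> xs < r \<longleftrightarrow> \<not> F \<subseteq> set xs" if xs: "set xs \<subseteq> L" for xs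
        proof
          assume lt: "\<rho> xs < r"
          note lx' = lab[OF L(1) xs]
          have "L \<noteq> lab xs" using lt lx'(2) L(2) by auto
          then obtain f L'' where "f \<in> L - lab xs" "L'' \<in> \<L>" "rk L'' < rk L" "L - {f} \<subseteq> L''"
            using shell[OF L(1) lx'(1)] lx'(2) L(2) lt by auto
          then show "\<not> F \<subseteq> set xs" using lx'(3) L(2) by (auto simp: F_def)
        next
          assume "\<not> F \<subseteq> set xs"
          then obtain f L'' where "f \<notin> set xs" "L'' \<in> \<L>" "rk L'' < r" "L - {f} \<subseteq> L''"
            by (auto simp: F_def)
          moreover from this have "set xs \<subseteq> L''" using xs by auto
          ultimately show "\<rho> xs < r" using rho_le[of L'' xs] by auto
        qed
        have yL: "keys y \<subseteq> inj_words L k"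
        proof
          fix u assume "u \<in> keys y"
          then have u: "u \<in> X k" "lab u = L" using y by auto
          then obtain L0 where "L0 \<in> \<L>" "set u \<subseteq> L0" by (auto simp: X_def inj_words_def)
          then show "u \<in> inj_words L k" using lab(3) u by (auto simp: X_def inj_words_def)
        qed
        have sub: "set v \<subseteq> L" if "v \<in> keys (bdl y)" for v
          using keys_bdl_subset[of y "{v. set v \<subseteq> L}"] yL set_del that by (fastforce simp: inj_words_def)
        have "\<exists>b. keys b \<subseteq> inj_words L (Suc k) \<and> keys (y - bdl b) \<subseteq> {xs. \<not> F \<subseteq> set xs}"
        proof (rule inj_words_exact[OF _ _ yL])
          show "keys (bdl y) \<subseteq> {xs. \<not> F \<subseteq> set xs}" using dy F sub by auto
        qed (use fin[OF L(1)] k in \<open>auto simp: F_def\<close>)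
        then obtain b where b: "keys b \<subseteq> inj_words L (Suc k)" "keys (y - bdl b) \<subseteq> {xs. \<not> F \<subseteq> set xs}"
          by blast
        have xk: "keys (y - bdl b) \<subseteq> inj_words L k"
          using keys_minus_subset[of y "bdl b"] keys_bdl_inj_words[OF b(1)] yL by blast
        have "keys (y - bdl b) \<subseteq> {u \<in> X k. \<rho> u < r}"
        proof
          fix x assume x: "x \<in> keys (y - bdl b)"
          then have xL: "x \<in> inj_words L k" "\<not> F \<subseteq> set x" using xk b(2) by blast+
          then have "\<rho> x < r" using F[of x] by (simp add: inj_words_def)
          then show "x \<in> {u \<in> X k. \<rho> u < r}" using xL(1) L(1) by (auto simp: X_def)
        qed
        moreover have "keys b \<subseteq> X (Suc k)" using b(1) L(1) by (auto simp: X_def)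
        ultimately show ?thesis by blast
      qed
    qed
    then obtain b where b: "keys b \<subseteq> X (Suc k)" "keys (z - bdl b) \<subseteq> {u \<in> X k. \<rho> u < r}" by blast
    have "bdl (z - bdl b) = 0" using Suc.prems(2) by (simp add: additive.diff[OF additive_bdl] bdl_bdl)
    then obtain b' where b': "keys b' \<subseteq> X (Suc k)" "bdl b' = z - bdl b" using Suc.IH b(2) by blast
    have "keys (b + b') \<subseteq> X (Suc k)" using keys_add[of b b'] b(1) b'(1) by blast
    moreover have "bdl (b + b') = z" using b'(2) by (simp add: additive.add[OF additive_bdl])
    ultimately show ?case by blast
  qed
  have "keys z \<subseteq> {u \<in> X k. \<rho> u < Suc (Max (\<rho> ` keys z))}"
    using z by (auto simp: X_def less_Suc_eq_le)
  from claim[OF this dz] show ?thesis by (simp only: X_def)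
qed

section \<open>Bar chains with coefficients in permutation modules\<close>

text \<open>Groups are noncommutative but written additively. A bar tuple [g1, g2, ...] has the
  homogeneous form [u, u + g1, u + g1 + g2, ...]; \<open>diffs\<close> recovers the tuple and is
  invariant under left translation. Faces and homotopies are simpler in homogeneous form.\<close>

fun psums :: "'g::group_add \<Rightarrow> 'g list \<Rightarrow> 'g list" where
  "psums u [] = [u]"
| "psums u (g # gs) = u # psums (u + g) gs"

fun diffs :: "'g::group_add list \<Rightarrow> 'g list" where
  "diffs (u # v # us) = (- u + v) # diffs (v # us)"
| "diffs us = []"

lemma psums_not_Nil [simp]: "psums u gs \<noteq> []"
  by (cases gs) auto

lemma hd_psums [simp]: "hd (psums u gs) = u"
  by (cases gs) auto

lemma length_psums [simp]: "length (psums u gs) = Suc (length gs)"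
  by (induction gs arbitrary: u) auto

lemma length_diffs: "length (diffs us) = length us - 1"
  by (induction us rule: diffs.induct) auto

lemma diffs_psums [simp]: "diffs (psums u gs) = gs"
proof (induction gs arbitrary: u)
  case (Cons g gs)
  obtain vs where "psums (u + g) gs = (u + g) # vs" by (cases gs) auto
  then show ?case using Cons[of "u + g"] by (simp add: add.assoc[symmetric])
qed simp

lemma psums_diffs: "us \<noteq> [] \<Longrightarrow> psums (hd us) (diffs us) = us"
  by (induction us rule: diffs.induct) (auto simp: add.assoc[symmetric])

lemma map_plus_psums: "map ((+) h) (psums u gs) = psums (h + u) gs"
  by (induction gs arbitrary: u) (auto simp: add.assoc)

lemma diffs_map_plus: "diffs (map ((+) h) us) = diffs us"
proof -
  have "- (h + u) + (h + v) = - u + v" for u v :: 'a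
    by (simp add: minus_add add.assoc del: add_uminus_conv_diff)
  then show ?thesis by (induction us rule: diffs.induct) auto
qed

lemma psums_0_diffs: "us \<noteq> [] \<Longrightarrow> psums 0 (diffs us) = map ((+) (- hd us)) us"
  using map_plus_psums[of "- hd us" "hd us" "diffs us"] psums_diffs[of us] by simp

definition is_subgroup :: "'g::group_add set \<Rightarrow> bool" where
  "is_subgroup G \<longleftrightarrow> 0 \<in> G \<and> (\<forall>g\<in>G. \<forall>h\<in>G. g + h \<in> G) \<and> (\<forall>g\<in>G. - g \<in> G)"

lemma is_subgroupD:
  assumes "is_subgroup G"
  shows "0 \<in> G" "g \<in> G \<Longrightarrow> h \<in> G \<Longrightarrow> g + h \<in> G" "g \<in> G \<Longrightarrow> - g \<in> G" "g \<in> G \<Longrightarrow> h \<in> G \<Longrightarrow> g - h \<in> G"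
  using assms unfolding is_subgroup_def by (auto simp flip: add_uminus_conv_diff)

lemma set_psums: "is_subgroup G \<Longrightarrow> u \<in> G \<Longrightarrow> set gs \<subseteq> G \<Longrightarrow> set (psums u gs) \<subseteq> G"
  by (induction gs arbitrary: u) (auto simp: is_subgroupD)

lemma set_diffs: "is_subgroup G \<Longrightarrow> set us \<subseteq> G \<Longrightarrow> set (diffs us) \<subseteq> G"
  by (induction us rule: diffs.induct) (auto simp: is_subgroupD)

text \<open>The alternating sum of the lists that follow \<alpha> up to some entry, repeat that
  entry under \<beta> and continue with \<beta>. It vanishes on the empty list, which fits the
  augmented boundary.\<close>

primrec prism :: "('a \<Rightarrow> 'b) \<Rightarrow> ('a \<Rightarrow> 'b) \<Rightarrow> 'a list \<Rightarrow> 'c::ab_group_add \<Rightarrow> ('b list \<Rightarrow>\<^sub>0 'c)" where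
  "prism \<alpha> \<beta> [] c = 0"
| "prism \<alpha> \<beta> (u # us) c =
    single (\<alpha> u # \<beta> u # map \<beta> us) c - push ((#) (\<alpha> u)) (prism \<alpha> \<beta> us c)"

lemma additive_prism: "additive (prism \<alpha> \<beta> us)"
proof (induction us)
  case (Cons u us)
  then show ?case
    unfolding prism.simps
    by (intro additive_minus additive_single additive_comp[OF additive_push])
qed (simp add: additive_def)

lemma keys_prism: "keys (prism \<alpha> \<beta> us c) \<subseteq> {ws. length ws = Suc (length us) \<and> set ws \<subseteq> \<alpha> ` set us \<union> \<beta> ` set us}"
proof (induction us)
  case (Cons u us)
  have "keys (prism \<alpha> \<beta> (u # us) c) \<subseteq> {\<alpha> u # \<beta> u # map \<beta> us} \<union> (#) (\<alpha> u) ` keys (prism \<alpha> \<beta> us c)"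
    unfolding prism.simps
    using keys_minus_subset[of "single (\<alpha> u # \<beta> u # map \<beta> us) c"] keys_push[of "(#) (\<alpha> u)" "prism \<alpha> \<beta> us c"]
    by (fastforce split: if_splits)
  also have "\<dots> \<subseteq> {ws. length ws = Suc (length (u # us)) \<and> set ws \<subseteq> \<alpha> ` set (u # us) \<union> \<beta> ` set (u # us)}"
  proof -
    have "length ws = Suc (length us) \<and> set ws \<subseteq> \<alpha> ` set us \<union> \<beta> ` set us"
      if "ws \<in> keys (prism \<alpha> \<beta> us c)" for ws
      using Cons.IH that by blast
    then show ?thesis by fastforce
  qed
  finally show ?case .
qed simp

lemma prism_homotopy:
  fixes c :: "'c::ab_group_add"
  shows "bdl (prism \<alpha> \<beta> us c) + lin (prism \<alpha> \<beta>) (list_bd us c) = single (map \<beta> us) c - single (map \<alpha> us) c"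
proof (induction us arbitrary: c)
  case Nil
  show ?case by (simp add: additive.zero[OF additive_bdl] additive.zero[OF additive_lin[OF additive_prism]])
next
  case (Cons u us)
  let ?Pr = "lin (prism \<alpha> \<beta>) :: _ \<Rightarrow> (_ list \<Rightarrow>\<^sub>0 'c)"
  have Pr_cons: "?Pr (push ((#) u) t) = push (\<lambda>w. \<alpha> u # \<beta> u # map \<beta> w) t - push ((#) (\<alpha> u)) (?Pr t)" for t
  proof (rule additive_eqI[of "\<lambda>t. ?Pr (push ((#) u) t)"])
    show "additive (\<lambda>t. ?Pr (push ((#) u) t))"
      by (rule additive_comp[OF additive_lin[OF additive_prism] additive_push])
    show "additive (\<lambda>t. push (\<lambda>w. \<alpha> u # \<beta> u # map \<beta> w) t - push ((#) (\<alpha> u)) (?Pr t))"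
      by (intro additive_minus additive_push additive_comp[OF additive_push] additive_lin[OF additive_prism])
  qed (simp add: lin_single[OF additive_prism])
  have "push (\<lambda>w. \<alpha> u # \<beta> u # map \<beta> w) (list_bd us c) = push ((#) (\<alpha> u)) (push ((#) (\<beta> u)) (list_bd (map \<beta> us) c))"
    by (simp add: push_push flip: push_map_list_bd)
  moreover have "push ((#) (\<alpha> u)) (bdl (prism \<alpha> \<beta> us c)) =
      push ((#) (\<alpha> u)) (single (map \<beta> us) c - single (map \<alpha> us) c - ?Pr (list_bd us c))"
    using Cons.IH[of c] by (metis add_diff_cancel_right')
  ultimately show ?case
    by (simp add: additive.diff[OF additive_bdl] additive.diff[OF additive_lin[OF additive_prism]]
        bdl_push_Cons Pr_cons lin_single[OF additive_prism] push_diff)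
qed

lemma prism_precomp: "prism (\<lambda>u. \<alpha> (f u)) (\<lambda>u. \<beta> (f u)) us c = prism \<alpha> \<beta> (map f us) c"
  by (induction us) (auto simp: comp_def)

lemma prism_postcomp: "prism (\<lambda>u. f (\<alpha> u)) (\<lambda>u. f (\<beta> u)) us c = push (map f) (prism \<alpha> \<beta> us c)"
  by (induction us) (auto simp: comp_def push_diff push_push push_zero)

section \<open>The double complex of a group acting on words\<close>

locale gset =
  fixes act :: "'x \<Rightarrow> 'g::group_add \<Rightarrow> 'x"
  assumes act_0 [simp]: "act x 0 = x"
    and act_add: "act x (g + h) = act (act x g) h"
begin

abbreviation lact :: "'x list \<Rightarrow> 'g \<Rightarrow> 'x list" where
  "lact xs g \<equiv> map (\<lambda>x. act x g) xs"

lemma lact_add: "lact xs (g + h) = lact (lact xs g) h"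
  by (simp add: act_add)

lemma act_minus [simp]: "act (act x g) (- g) = x"
  by (simp flip: act_add)

text \<open>A pair (x, [g1, g2, ...]) is the chain x, x g1, x g1 g2, ... in the action groupoid. The
  entries u_i of \<open>us\<close> stand for the vertices x u_i; the first entry is absorbed into
  the point.\<close>

definition bar_simplex :: "'x list \<Rightarrow> 'g list \<Rightarrow> 'x list \<times> 'g list" where
  "bar_simplex xs us = (lact xs (hd us), diffs us)"

lemma bar_simplex_translate: "us \<noteq> [] \<Longrightarrow> bar_simplex (lact xs h) (map ((+) (- h)) us) = bar_simplex xs us"
  by (simp add: bar_simplex_def hd_map diffs_map_plus act_add)

text \<open>A face of a 0-simplex would have no first vertex, so degree 0 is sent to 0: the bar
  direction is not augmented, in contrast to the direction of words.\<close>

definition dv_gen :: "'x list \<times> 'g list \<Rightarrow> 'c::ab_group_add \<Rightarrow> ('x list \<times> 'g list \<Rightarrow>\<^sub>0 'c)" where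
  "dv_gen k c = (if snd k = [] then 0 else push (bar_simplex (fst k)) (list_bd (psums 0 (snd k)) c))"

lemma additive_dv_gen: "additive (dv_gen k)"
  unfolding dv_gen_def
  by (cases "snd k = []") (simp_all add: additive_0 additive_comp[OF additive_push] additive_list_bd)

definition dv :: "('x list \<times> 'g list \<Rightarrow>\<^sub>0 'c::ab_group_add) \<Rightarrow> ('x list \<times> 'g list \<Rightarrow>\<^sub>0 'c)" where
  "dv = lin dv_gen"

lemma additive_dv: "additive dv"
  unfolding dv_def by (rule additive_lin[OF additive_dv_gen])

lemma dv_single: "dv (single k c) = dv_gen k c"
  unfolding dv_def by (rule lin_single[OF additive_dv_gen])

text \<open>The vertical boundary deletes entries in any homogeneous coordinates, not only in those
  starting at 0. Two entries are required so that every face still has a first vertex.\<close>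

lemma dv_bar_simplex:
  assumes "length us \<ge> 2"
  shows "dv (single (bar_simplex xs us) c) = push (bar_simplex xs) (list_bd us c)"
proof -
  have ne: "us \<noteq> []" "diffs us \<noteq> []" using assms length_diffs[of us] by auto
  have "dv (single (bar_simplex xs us) c) = push (\<lambda>us'. bar_simplex (lact xs (hd us)) (map ((+) (- hd us)) us')) (list_bd us c)"
    using ne by (simp add: dv_single dv_gen_def bar_simplex_def[of xs us] psums_0_diffs push_push flip: push_map_list_bd)
  also have "\<dots> = push (bar_simplex xs) (list_bd us c)"
  proof (rule push_cong)
    fix us' assume "us' \<in> keys (list_bd us c)"
    then have "length us' = length us - 1" using keys_list_bd[of us c] by (auto simp: length_del)
    then have "us' \<noteq> []" using assms by auto
    then show "bar_simplex (lact xs (hd us)) (map ((+) (- hd us)) us') = bar_simplex xs us'" by (rule bar_simplex_translate)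
  qed
  finally show ?thesis .
qed

lemma dv_push_bar_simplex:
  assumes "\<And>us. us \<in> keys t \<Longrightarrow> length us \<ge> 2"
  shows "dv (push (bar_simplex xs) t) = push (bar_simplex xs) (bdl t)"
proof (rule additive_eqI[of "\<lambda>t. dv (push (bar_simplex xs) t)" "\<lambda>t. push (bar_simplex xs) (bdl t)"])
  show "additive (\<lambda>t. dv (push (bar_simplex xs) t))" by (rule additive_comp[OF additive_dv additive_push])
  show "additive (\<lambda>t. push (bar_simplex xs) (bdl t))" by (rule additive_comp[OF additive_push additive_bdl])
qed (simp add: dv_bar_simplex assms)

lemma dv_gen_eq:
  "gs \<noteq> [] \<Longrightarrow> dv_gen (xs, gs) c = push (bar_simplex xs) (list_bd (psums 0 gs) c)"
  by (simp add: dv_gen_def)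

lemma dv_dv:
  fixes z :: "'x list \<times> 'g list \<Rightarrow>\<^sub>0 'c::ab_group_add"
  shows "dv (dv z) = 0"
proof (rule additive_eqI[of "\<lambda>z. dv (dv z)" "\<lambda>z. 0"])
  show "additive (\<lambda>z. dv (dv z))" by (rule additive_comp[OF additive_dv additive_dv])
  show "additive (\<lambda>z. 0)" by (rule additive_0)
  fix k :: "'x list \<times> 'g list" and c :: 'c
  obtain xs gs where k: "k = (xs, gs)" by fastforce
  have key_len: "length us = length gs" if "us \<in> keys (list_bd (psums 0 gs) c)" for us
    using that keys_list_bd[of "psums 0 gs" c] by (auto simp: length_del)
  consider "gs = []" | "length gs = 1" | "length gs \<ge> 2" by (cases gs) (auto simp: Suc_le_eq)
  then show "dv (dv (single k c)) = 0"
  proof cases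
    case 1
    then show ?thesis by (simp add: dv_single k dv_gen_def additive.zero[OF additive_dv])
  next
    case 2
    then have ne: "gs \<noteq> []" by auto
    have "dv (push (bar_simplex xs) t) = 0" if "\<And>us. us \<in> keys t \<Longrightarrow> length us = 1" for t :: "'g list \<Rightarrow>\<^sub>0 'c"
    proof (rule additive_eqI[of "\<lambda>t. dv (push (bar_simplex xs) t)" "\<lambda>t. 0"])
      show "additive (\<lambda>t. dv (push (bar_simplex xs) t))" by (rule additive_comp[OF additive_dv additive_push])
      show "additive (\<lambda>z. 0)" by (rule additive_0)
      fix us and c :: 'c assume "us \<in> keys t"
      then have "length (diffs us) = 0" using that length_diffs[of us] by auto
      then show "dv (push (bar_simplex xs) (single us c)) = 0" by (simp add: dv_single dv_gen_def bar_simplex_def)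
    qed
    then show ?thesis using key_len 2 by (simp add: dv_single k dv_gen_eq[OF ne])
  next
    case 3
    then have ne: "gs \<noteq> []" by auto
    then show ?thesis using key_len 3
      by (simp add: dv_single k dv_gen_eq dv_push_bar_simplex bdl_list_bd push_zero)
  qed
qed

definition bh_gen :: "'x list \<times> 'g list \<Rightarrow> 'c::ab_group_add \<Rightarrow> ('x list \<times> 'g list \<Rightarrow>\<^sub>0 'c)" where
  "bh_gen k c = push (\<lambda>y. (y, snd k)) (list_bd (fst k) c)"

lemma additive_bh_gen: "additive (bh_gen k)"
  unfolding bh_gen_def by (intro additive_comp[OF additive_push] additive_list_bd)

definition bh :: "('x list \<times> 'g list \<Rightarrow>\<^sub>0 'c::ab_group_add) \<Rightarrow> ('x list \<times> 'g list \<Rightarrow>\<^sub>0 'c)" where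
  "bh = lin bh_gen"

lemma additive_bh: "additive bh"
  unfolding bh_def by (rule additive_lin[OF additive_bh_gen])

lemma bh_single: "bh (single (xs, gs) c) = push (\<lambda>y. (y, gs)) (list_bd xs c)"
  unfolding bh_def lin_single[OF additive_bh_gen] by (simp add: bh_gen_def)

lemma bh_push_pair: "bh (push (\<lambda>xs. (xs, gs)) t) = push (\<lambda>xs. (xs, gs)) (bdl t)"
proof (rule additive_eqI[of "\<lambda>t. bh (push (\<lambda>xs. (xs, gs)) t)" "\<lambda>t. push (\<lambda>xs. (xs, gs)) (bdl t)"])
  show "additive (\<lambda>t. bh (push (\<lambda>xs. (xs, gs)) t))" by (rule additive_comp[OF additive_bh additive_push])
  show "additive (\<lambda>t. push (\<lambda>xs. (xs, gs)) (bdl t))" by (rule additive_comp[OF additive_push additive_bdl])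
qed (simp add: bh_single)

lemma bh_bh:
  fixes z :: "'x list \<times> 'g list \<Rightarrow>\<^sub>0 'c::ab_group_add"
  shows "bh (bh z) = 0"
proof (rule additive_eqI[of "\<lambda>z. bh (bh z)" "\<lambda>z. 0"])
  show "additive (\<lambda>z. bh (bh z))" by (rule additive_comp[OF additive_bh additive_bh])
  show "additive (\<lambda>z. 0)" by (rule additive_0)
  fix k :: "'x list \<times> 'g list" and c :: 'c
  show "bh (bh (single k c)) = 0"
    by (cases k) (simp add: bh_single bh_push_pair bdl_list_bd push_zero)
qed

text \<open>In homogeneous coordinates both sides are the same double sum, since deleting a letter
  of the word commutes with the action. The differentials commute without a sign because no total
  complex is formed.\<close>

lemma bh_dv:
  fixes z :: "'x list \<times> 'g list \<Rightarrow>\<^sub>0 'c::ab_group_add"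
  shows "bh (dv z) = dv (bh z)"
proof (rule additive_eqI[of "\<lambda>z. bh (dv z)" "\<lambda>z. dv (bh z)"])
  show "additive (\<lambda>z. bh (dv z))" by (rule additive_comp[OF additive_bh additive_dv])
  show "additive (\<lambda>z. dv (bh z))" by (rule additive_comp[OF additive_dv additive_bh])
  fix k :: "'x list \<times> 'g list" and c :: 'c
  obtain xs gs where k: "k = (xs, gs)" by fastforce
  show "bh (dv (single k c)) = dv (bh (single k c))"
  proof (cases "gs = []")
    case True
    have "dv (push (\<lambda>y. (y, [])) t) = 0" for t :: "'x list \<Rightarrow>\<^sub>0 'c"
    proof (rule additive_eqI[of "\<lambda>t. dv (push (\<lambda>y. (y, [])) t)" "\<lambda>t. 0"])
      show "additive (\<lambda>t. dv (push (\<lambda>y. (y, [])) t))" by (rule additive_comp[OF additive_dv additive_push])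
      show "additive (\<lambda>z. 0)" by (rule additive_0)
    qed (simp add: dv_single dv_gen_def)
    then show ?thesis using True
      by (simp add: k bh_single dv_single) (simp add: dv_gen_def additive.zero[OF additive_bh])
  next
    case False
    let ?us = "psums 0 gs"
    have bhpi: "bh (single (bar_simplex xs us) c) = push (\<lambda>y. bar_simplex y us) (list_bd xs c)" for us and c :: 'c
      by (simp add: bar_simplex_def bh_single push_push flip: push_map_list_bd)
    define n where "n = length ?us"
    have lb: "list_bd ?us c = (\<Sum>j<n. single (del j ?us) (sg j c))" for c :: 'c
      by (simp only: n_def list_bd_sum)
    have "bh (dv (single k c)) =
        (\<Sum>j<n. \<Sum>i<length xs. single (bar_simplex (del i xs) (del j ?us)) (sg i (sg j c)))"
      by (simp add: k dv_single dv_gen_eq[OF False] lb push_sum additive.sum[OF additive_bh] bhpi)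
         (simp add: list_bd_sum push_sum)
    also have "\<dots> = (\<Sum>i<length xs. \<Sum>j<n. single (bar_simplex (del i xs) (del j ?us)) (sg i (sg j c)))"
      by (rule sum.swap)
    also have "\<dots> = (\<Sum>i<length xs. \<Sum>j<n. single (bar_simplex (del i xs) (del j ?us)) (sg j (sg i c)))"
    proof (rule sum.cong[OF HOL.refl], rule sum.cong[OF HOL.refl])
      fix i j
      have "sg i (sg j c) = sg j (sg i c)" by (simp add: sg_def)
      then show "single (bar_simplex (del i xs) (del j ?us)) (sg i (sg j c)) =
          single (bar_simplex (del i xs) (del j ?us)) (sg j (sg i c))" by (rule arg_cong)
    qed
    also have "\<dots> = dv (bh (single k c))"
      by (simp add: k bh_single list_bd_sum[of xs] push_sum additive.sum[OF additive_dv] dv_single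
          dv_gen_eq[OF False] lb)
    finally show ?thesis .
  qed
qed

subsection \<open>Functors between action groupoids\<close>

text \<open>A list \<open>us\<close> of group elements and a point \<open>xs\<close> are homogeneous coordinates of the bar simplex
  \<open>bar_simplex xs us\<close>. In these coordinates a functor to the orbit of \<open>b\<close> is given by maps \<open>\<alpha> xs\<close>
  on group elements, and two of them with the same cocycle \<open>\<kappa>\<close> are homotopic by the usual prism.\<close>

definition functor_map :: "'x list \<Rightarrow> ('x list \<Rightarrow> 'g \<Rightarrow> 'g) \<Rightarrow> 'x list \<times> 'g list \<Rightarrow> 'x list \<times> 'g list" where
  "functor_map b \<alpha> k = bar_simplex b (map (\<alpha> (fst k)) (psums 0 (snd k)))"

text \<open>This makes \<open>functor_map\<close> independent of coordinates: replacing (x, u) by (x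
  h, -h + u) translates the image by \<open>\<kappa> x h\<close>, which fixes \<open>b\<close> and
  so leaves the bar simplex over \<open>b\<close> unchanged.\<close>

definition equivariant :: "'x list set \<Rightarrow> 'g set \<Rightarrow> 'x list \<Rightarrow> ('x list \<Rightarrow> 'g \<Rightarrow> 'g) \<Rightarrow> ('x list \<Rightarrow> 'g \<Rightarrow> 'g) \<Rightarrow> bool" where
  "equivariant X G b \<kappa> \<alpha> \<longleftrightarrow> (\<forall>x\<in>X. \<forall>h\<in>G. lact b (\<kappa> x h) = b \<and>
     (\<forall>u\<in>G. \<alpha> (lact x h) (- h + u) = - \<kappa> x h + \<alpha> x u))"

text \<open>The entry of the double complex in bar degree q whose column consists of the words in
  \<open>X\<close>. For \<open>X = {[]}\<close> it is the ordinary bar complex of \<open>G\<close>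
  with constant coefficients.\<close>

definition CC :: "'x list set \<Rightarrow> 'g set \<Rightarrow> nat \<Rightarrow> ('x list \<times> 'g list \<Rightarrow>\<^sub>0 'c::ab_group_add) set" where
  "CC X G q = {z. keys z \<subseteq> X \<times> {gs. set gs \<subseteq> G \<and> length gs = q}}"

lemma CC_add: "y \<in> CC X G q \<Longrightarrow> z \<in> CC X G q \<Longrightarrow> y + z \<in> CC X G q"
  using keys_add[of y z] unfolding CC_def by blast

lemma CC_diff: "y \<in> CC X G q \<Longrightarrow> z \<in> CC X G q \<Longrightarrow> y - z \<in> CC X G q"
  using keys_minus_subset[of y z] unfolding CC_def by blast

lemma CC_0: "0 \<in> CC X G q"
  by (simp add: CC_def)

lemma CC_sum: "(\<And>i. i \<in> I \<Longrightarrow> f i \<in> CC X G q) \<Longrightarrow> sum f I \<in> CC X G q"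
  by (induction I rule: infinite_finite_induct) (auto intro: CC_add CC_0)

lemma CC_sg: "y \<in> CC X G q \<Longrightarrow> sg i y \<in> CC X G q"
  by (simp add: CC_def keys_sg)

lemma CC_mono: "y \<in> CC X H q \<Longrightarrow> H \<subseteq> G \<Longrightarrow> y \<in> CC X G q"
  unfolding CC_def by blast

lemma equivariant_bar_simplex:
  assumes "equivariant X G b \<kappa> \<alpha>" "x \<in> X" "set us \<subseteq> G" "us \<noteq> []"
  shows "functor_map b \<alpha> (bar_simplex x us) = bar_simplex b (map (\<alpha> x) us)"
proof -
  have h: "hd us \<in> G" using assms(3,4) by auto
  have b: "lact b (\<kappa> x (hd us)) = b" using assms(1,2) h unfolding equivariant_def by blast
  have "map (\<alpha> (lact x (hd us))) (map ((+) (- hd us)) us) = map ((+) (- \<kappa> x (hd us))) (map (\<alpha> x) us)"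
    using assms(1,2,3) h unfolding equivariant_def by auto
  then have "functor_map b \<alpha> (bar_simplex x us) = bar_simplex b (map ((+) (- \<kappa> x (hd us))) (map (\<alpha> x) us))"
    by (simp only: functor_map_def bar_simplex_def[of x] psums_0_diffs[OF assms(4)] fst_conv snd_conv)
  also have "\<dots> = bar_simplex b (map (\<alpha> x) us)"
    using bar_simplex_translate[where us = "map (\<alpha> x) us" and xs = b and h = "\<kappa> x (hd us)"] assms(4) b by simp
  finally show ?thesis .
qed

lemma functor_dv:
  fixes z :: "'x list \<times> 'g list \<Rightarrow>\<^sub>0 'c::ab_group_add"
  assumes e: "equivariant X G b \<kappa> \<alpha>" and G: "is_subgroup G" and z: "z \<in> CC X G q"
  shows "dv (push (functor_map b \<alpha>) z) = push (functor_map b \<alpha>) (dv z)"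
proof (rule additive_eqI[of "\<lambda>z. dv (push (functor_map b \<alpha>) z)" "\<lambda>z. push (functor_map b \<alpha>) (dv z)"])
  show "additive (\<lambda>z. dv (push (functor_map b \<alpha>) z))" by (rule additive_comp[OF additive_dv additive_push])
  show "additive (\<lambda>z. push (functor_map b \<alpha>) (dv z))" by (rule additive_comp[OF additive_push additive_dv])
  fix k and c :: 'c assume "k \<in> keys z"
  then obtain x gs where k: "k = (x, gs)" "x \<in> X" "set gs \<subseteq> G" using z by (auto simp: CC_def)
  show "dv (push (functor_map b \<alpha>) (single k c)) = push (functor_map b \<alpha>) (dv (single k c))"
  proof (cases "gs = []")
    case True
    then show ?thesis by (simp add: k dv_single dv_gen_def functor_map_def bar_simplex_def push_zero)
  next
    case False
    then have l: "length (map (\<alpha> x) (psums 0 gs)) \<ge> 2" by (cases gs) auto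
    have "dv (push (functor_map b \<alpha>) (single k c)) = push (\<lambda>us. bar_simplex b (map (\<alpha> x) us)) (list_bd (psums 0 gs) c)"
      using dv_bar_simplex[OF l] by (simp add: k functor_map_def push_push flip: push_map_list_bd)
    also have "\<dots> = push (\<lambda>us. functor_map b \<alpha> (bar_simplex x us)) (list_bd (psums 0 gs) c)"
    proof (rule push_cong)
      fix us assume "us \<in> keys (list_bd (psums 0 gs) c)"
      then obtain i where i: "us = del i (psums 0 gs)" "i < Suc (length gs)"
        using keys_list_bd[of "psums 0 gs" c] by auto
      have "set us \<subseteq> G"
        using i(1) set_del set_psums[OF G is_subgroupD(1)[OF G] k(3)] by fastforce
      moreover have "us \<noteq> []" using i length_del[of i "psums 0 gs"] False by auto
      ultimately show "bar_simplex b (map (\<alpha> x) us) = functor_map b \<alpha> (bar_simplex x us)"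
        using equivariant_bar_simplex[OF e k(2)] by simp
    qed
    also have "\<dots> = push (functor_map b \<alpha>) (dv (single k c))"
      by (simp add: k dv_single dv_gen_eq[OF False] push_push)
    finally show ?thesis .
  qed
qed

definition htpy_gen ::
  "'x list \<Rightarrow> ('x list \<Rightarrow> 'g \<Rightarrow> 'g) \<Rightarrow> ('x list \<Rightarrow> 'g \<Rightarrow> 'g) \<Rightarrow> 'x list \<times> 'g list \<Rightarrow> 'c::ab_group_add \<Rightarrow> ('x list \<times> 'g list \<Rightarrow>\<^sub>0 'c)" where
  "htpy_gen b \<alpha> \<beta> k c = push (bar_simplex b) (prism (\<alpha> (fst k)) (\<beta> (fst k)) (psums 0 (snd k)) c)"

lemma additive_htpy_gen: "additive (htpy_gen b \<alpha> \<beta> k)"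
  unfolding htpy_gen_def by (intro additive_comp[OF additive_push] additive_prism)

lemma htpy_gen_bar_simplex:
  assumes "equivariant X G b \<kappa> \<alpha>" "equivariant X G b \<kappa> \<beta>" "x \<in> X" "set us \<subseteq> G" "us \<noteq> []"
  shows "htpy_gen b \<alpha> \<beta> (bar_simplex x us) c = push (bar_simplex b) (prism (\<alpha> x) (\<beta> x) us c)"
proof -
  let ?h = "hd us" let ?k = "\<kappa> x ?h"
  have h: "?h \<in> G" using assms(4,5) by auto
  have b: "lact b ?k = b" using assms(1,3) h unfolding equivariant_def by blast
  have cong: "prism f g us c = prism f' g' us c"
    if "\<forall>u\<in>set us. f u = f' u" "\<forall>u\<in>set us. g u = g' u" for f g f' g' :: "'g \<Rightarrow> 'g" and us
    using that by (induction us) (auto cong: map_cong)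
  have "htpy_gen b \<alpha> \<beta> (bar_simplex x us) c =
      push (bar_simplex b) (prism (\<lambda>u. \<alpha> (lact x ?h) (- ?h + u)) (\<lambda>u. \<beta> (lact x ?h) (- ?h + u)) us c)"
    by (simp only: htpy_gen_def bar_simplex_def[of x] psums_0_diffs[OF assms(5)] fst_conv snd_conv prism_precomp)
  also have "\<dots> = push (bar_simplex b) (prism (\<lambda>u. - ?k + \<alpha> x u) (\<lambda>u. - ?k + \<beta> x u) us c)"
    by (rule arg_cong[OF cong]) (use assms(1,2,3,4) h in \<open>auto simp: equivariant_def\<close>)
  also have "\<dots> = push (\<lambda>us. bar_simplex b (map ((+) (- ?k)) us)) (prism (\<alpha> x) (\<beta> x) us c)"
    by (simp only: prism_postcomp push_push)
  also have "\<dots> = push (bar_simplex b) (prism (\<alpha> x) (\<beta> x) us c)"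
  proof (rule push_cong)
    fix ws assume "ws \<in> keys (prism (\<alpha> x) (\<beta> x) us c)"
    then have "ws \<noteq> []" using keys_prism[of "\<alpha> x" "\<beta> x" us c] by auto
    then show "bar_simplex b (map ((+) (- ?k)) ws) = bar_simplex b ws" using bar_simplex_translate[where us = ws and xs = b and h = ?k] b by simp
  qed
  finally show ?thesis .
qed

lemma functor_homotopy:
  fixes z :: "'x list \<times> 'g list \<Rightarrow>\<^sub>0 'c::ab_group_add"
  assumes e: "equivariant X G b \<kappa> \<alpha>" "equivariant X G b \<kappa> \<beta>" and G: "is_subgroup G" and z: "z \<in> CC X G q"
  shows "dv (lin (htpy_gen b \<alpha> \<beta>) z) + lin (htpy_gen b \<alpha> \<beta>) (dv z) =
    push (functor_map b \<beta>) z - push (functor_map b \<alpha>) z"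
proof -
  let ?H = "lin (htpy_gen b \<alpha> \<beta>) :: _ \<Rightarrow> ('x list \<times> 'g list \<Rightarrow>\<^sub>0 'c)"
  have addH: "additive ?H" by (rule additive_lin[OF additive_htpy_gen])
  show ?thesis
  proof (rule additive_eqI[of "\<lambda>z. dv (?H z) + ?H (dv z)"])
    show "additive (\<lambda>z. dv (?H z) + ?H (dv z))"
      by (intro additive_plus additive_comp[OF additive_dv addH] additive_comp[OF addH additive_dv])
    show "additive (\<lambda>z. push (functor_map b \<beta>) z - push (functor_map b \<alpha>) z)"
      by (intro additive_minus additive_push)
    fix k and c :: 'c assume "k \<in> keys z"
    then obtain x gs where k: "k = (x, gs)" "x \<in> X" "set gs \<subseteq> G" using z by (auto simp: CC_def)
    let ?us = "psums 0 gs" and ?p = "prism (\<alpha> x) (\<beta> x)"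
    have 1: "dv (?H (single k c)) = push (bar_simplex b) (bdl (?p ?us c))"
      unfolding lin_single[OF additive_htpy_gen] htpy_gen_def k
      by (simp, rule dv_push_bar_simplex) (use keys_prism[of "\<alpha> x" "\<beta> x" ?us c] in auto)
    have "?H (dv (single k c)) = push (bar_simplex b) (lin ?p (list_bd ?us c))"
    proof (cases "gs = []")
      case True
      then show ?thesis
        by (simp add: k dv_single dv_gen_def additive.zero[OF addH] push_zero
            lin_single[OF additive_prism])
    next
      case False
      have "?H (push (bar_simplex x) (list_bd ?us c)) = push (bar_simplex b) (lin ?p (list_bd ?us c))"
      proof (rule additive_eqI[of "\<lambda>t. ?H (push (bar_simplex x) t)" "\<lambda>t. push (bar_simplex b) (lin ?p t)"])
        show "additive (\<lambda>t. ?H (push (bar_simplex x) t))" by (rule additive_comp[OF addH additive_push])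
        show "additive (\<lambda>t. push (bar_simplex b) (lin ?p t))"
          by (rule additive_comp[OF additive_push additive_lin[OF additive_prism]])
        fix us and d :: 'c assume "us \<in> keys (list_bd ?us c)"
        then obtain i where i: "us = del i ?us" "i < Suc (length gs)"
          using keys_list_bd[of ?us c] by auto
        have "set us \<subseteq> G"
          using i(1) set_del set_psums[OF G is_subgroupD(1)[OF G] k(3)] by fastforce
        moreover have "us \<noteq> []" using i length_del[of i ?us] False by auto
        ultimately show "?H (push (bar_simplex x) (single us d)) = push (bar_simplex b) (lin ?p (single us d))"
          using htpy_gen_bar_simplex[OF e k(2)] by (simp add: lin_single[OF additive_htpy_gen] lin_single[OF additive_prism])
      qed
      then show ?thesis by (simp add: k dv_single dv_gen_eq[OF False])
    qed
    then have "dv (?H (single k c)) + ?H (dv (single k c)) =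
        push (bar_simplex b) (bdl (?p ?us c) + lin ?p (list_bd ?us c))"
      by (simp add: 1 push_add)
    also have "\<dots> = push (functor_map b \<beta>) (single k c) - push (functor_map b \<alpha>) (single k c)"
      by (simp add: prism_homotopy push_diff functor_map_def k)
    finally show "dv (?H (single k c)) + ?H (dv (single k c)) =
        push (functor_map b \<beta>) (single k c) - push (functor_map b \<alpha>) (single k c)" .
  qed
qed

lemma functor_CC:
  fixes z :: "'x list \<times> 'g list \<Rightarrow>\<^sub>0 'c::ab_group_add"
  assumes G: "is_subgroup G" and H: "is_subgroup H" and z: "z \<in> CC X G q"
    and "\<And>x u. x \<in> X \<Longrightarrow> u \<in> G \<Longrightarrow> \<alpha> x u \<in> H" "\<And>h. h \<in> H \<Longrightarrow> lact b h \<in> Y"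
  shows "push (functor_map b \<alpha>) z \<in> CC Y H q"
proof -
  have "functor_map b \<alpha> k \<in> Y \<times> {gs. set gs \<subseteq> H \<and> length gs = q}" if kz: "k \<in> keys z" for k
  proof -
    obtain x gs where k: "k = (x, gs)" "x \<in> X" "set gs \<subseteq> G" "length gs = q" using z kz by (auto simp: CC_def)
    have "set (psums 0 gs) \<subseteq> G" using set_psums[OF G is_subgroupD(1)[OF G] k(3)] .
    then have s: "set (map (\<alpha> x) (psums 0 gs)) \<subseteq> H" using assms(4) k(2) by auto
    moreover have "hd (map (\<alpha> x) (psums 0 gs)) \<in> H" using assms(4) k(2) is_subgroupD(1)[OF G] by (simp add: hd_map)
    ultimately show ?thesis using assms(5) set_diffs[OF H s] k(4)
      by (auto simp: functor_map_def k(1) bar_simplex_def length_diffs)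
  qed
  then show ?thesis using keys_push[of "functor_map b \<alpha>" z] unfolding CC_def by blast
qed

lemma htpy_CC:
  fixes z :: "'x list \<times> 'g list \<Rightarrow>\<^sub>0 'c::ab_group_add"
  assumes G: "is_subgroup G" and H: "is_subgroup H" and z: "z \<in> CC X G q"
    and "\<And>x u. x \<in> X \<Longrightarrow> u \<in> G \<Longrightarrow> \<alpha> x u \<in> H" "\<And>x u. x \<in> X \<Longrightarrow> u \<in> G \<Longrightarrow> \<beta> x u \<in> H"
    and "\<And>h. h \<in> H \<Longrightarrow> lact b h \<in> Y"
  shows "lin (htpy_gen b \<alpha> \<beta>) z \<in> CC Y H (Suc q)"
proof -
  have "keys (lin (htpy_gen b \<alpha> \<beta>) z) \<subseteq> Y \<times> {gs. set gs \<subseteq> H \<and> length gs = Suc q}"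
  proof (rule keys_additive_subset[OF additive_lin[OF additive_htpy_gen]])
    fix k c assume "k \<in> keys z"
    then obtain x gs where k: "k = (x, gs)" "x \<in> X" "set gs \<subseteq> G" "length gs = q" using z by (auto simp: CC_def)
    have sG: "set (psums 0 gs) \<subseteq> G" using set_psums[OF G is_subgroupD(1)[OF G] k(3)] .
    have "bar_simplex b ws \<in> Y \<times> {gs. set gs \<subseteq> H \<and> length gs = Suc q}"
      if "ws \<in> keys (prism (\<alpha> x) (\<beta> x) (psums 0 gs) c)" for ws
    proof -
      have "set ws \<subseteq> \<alpha> x ` set (psums 0 gs) \<union> \<beta> x ` set (psums 0 gs)" and l: "length ws = Suc (Suc q)"
        using that keys_prism[of "\<alpha> x" "\<beta> x" "psums 0 gs" c] k(4) by auto
      then have s: "set ws \<subseteq> H" using sG assms(4,5) k(2) by blast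
      moreover from this have "hd ws \<in> H" using l by (cases ws) auto
      ultimately show ?thesis using assms(6) set_diffs[OF H s] l by (auto simp: bar_simplex_def length_diffs)
    qed
    then show "keys (lin (htpy_gen b \<alpha> \<beta>) (single k c)) \<subseteq> Y \<times> {gs. set gs \<subseteq> H \<and> length gs = Suc q}"
      unfolding lin_single[OF additive_htpy_gen] htpy_gen_def k
      using keys_push[of "bar_simplex b"] by fastforce
  qed
  then show ?thesis by (simp add: CC_def)
qed

lemma dv_CC:
  fixes z :: "'x list \<times> 'g list \<Rightarrow>\<^sub>0 'c::ab_group_add"
  assumes G: "is_subgroup G" and X: "\<And>x g. x \<in> X \<Longrightarrow> g \<in> G \<Longrightarrow> lact x g \<in> X" and z: "z \<in> CC X G (Suc q)"
  shows "dv z \<in> CC X G q"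
proof -
  have "keys (dv z) \<subseteq> X \<times> {gs. set gs \<subseteq> G \<and> length gs = q}"
  proof (rule keys_additive_subset[OF additive_dv])
    fix k c assume "k \<in> keys z"
    then obtain x gs where k: "k = (x, gs)" "x \<in> X" "set gs \<subseteq> G" "length gs = Suc q" using z by (auto simp: CC_def)
    have ne: "gs \<noteq> []" using k(4) by auto
    have "bar_simplex x us \<in> X \<times> {gs. set gs \<subseteq> G \<and> length gs = q}" if us: "us \<in> keys (list_bd (psums 0 gs) c)" for us
    proof -
      obtain i where i: "us = del i (psums 0 gs)" "i < length (psums 0 gs)"
        using us keys_list_bd[of "psums 0 gs" c] by auto
      have s: "set us \<subseteq> G"
        using i(1) set_del set_psums[OF G is_subgroupD(1)[OF G] k(3)] by fastforce
      moreover have l: "length us = Suc q" using i length_del[OF i(2)] k(4) by simp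
      moreover have "hd us \<in> G" using s l by (cases us) auto
      ultimately show ?thesis using X[OF k(2)] set_diffs[OF G s] by (auto simp: bar_simplex_def length_diffs)
    qed
    then show "keys (dv (single k c)) \<subseteq> X \<times> {gs. set gs \<subseteq> G \<and> length gs = q}"
      unfolding dv_single k dv_gen_eq[OF ne] using keys_push[of "bar_simplex x"] by fastforce
  qed
  then show ?thesis by (simp add: CC_def)
qed

end

section \<open>Exact rows, translations and Shapiro's lemma\<close>

context gset
begin

text \<open>The horizontal boundary leaves the bar tuple alone, so the tuples serve as labels in
  \<open>block_step\<close>. With the constant level 0 there is nothing below the top layer, and
  congruence becomes equality.\<close>

lemma rows_exact:
  fixes z :: "'x list \<times> 'g list \<Rightarrow>\<^sub>0 'c::ab_group_add"
  assumes ex: "\<And>t :: 'x list \<Rightarrow>\<^sub>0 'c. keys t \<subseteq> X \<Longrightarrow> bdl t = 0 \<Longrightarrow> \<exists>b. keys b \<subseteq> X' \<and> bdl b = t"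
    and z: "z \<in> CC X G q" "bh z = 0"
  shows "\<exists>b \<in> CC X' G q. bh b = z"
proof -
  define S where "S = X \<times> {gs. set gs \<subseteq> G \<and> length gs = q}"
  define S' where "S' = X' \<times> {gs. set gs \<subseteq> G \<and> length gs = q}"
  have "\<exists>b. keys b \<subseteq> S' \<and> keys (z - bh b) \<subseteq> {u \<in> S. (0::nat) < 0}"
  proof (rule block_step[OF additive_bh, where lab = snd])
    show "keys z \<subseteq> {u \<in> S. (0::nat) \<le> 0}" using z(1) by (auto simp: CC_def S_def)
    show "keys (bh z) \<subseteq> {u. (0::nat) < 0}" by (simp add: z(2))
    show "(0::nat) \<le> 0 \<and> ((0::nat) = 0 \<and> (0::nat) = 0 \<longrightarrow> snd v = snd u)"
      if "v \<in> keys (bh (single u c))" for u v and c :: 'c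
    proof -
      obtain xs gs where u: "u = (xs, gs)" by fastforce
      show ?thesis using that keys_push[of "\<lambda>y. (y, gs)" "list_bd xs c"] by (auto simp: u bh_single)
    qed
  next
    fix gs and y :: "'x list \<times> 'g list \<Rightarrow>\<^sub>0 'c"
    assume y: "keys y \<subseteq> {u \<in> S. (0::nat) = 0 \<and> snd u = gs}" and dy: "keys (bh y) \<subseteq> {u. (0::nat) < 0}"
    let ?J = "\<lambda>xs. (xs, gs)"
    have inj: "inj ?J" by (auto simp: inj_def)
    define t where "t = push fst y"
    have "push ?J t = push (\<lambda>u. u) y"
      unfolding t_def push_push by (rule push_cong) (use y in auto)
    then have yt: "y = push ?J t" by simp
    have kt: "keys y = ?J ` keys t" unfolding yt by (rule keys_push_inj[OF inj])
    have "?J ` keys (bdl t) = keys (bh y)" by (simp add: yt bh_push_pair keys_push_inj[OF inj])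
    then have "bdl t = 0" using dy by simp
    moreover have tX: "keys t \<subseteq> X" using y kt by (auto simp: S_def)
    ultimately obtain b where b: "keys b \<subseteq> X'" "bdl b = t" using ex by blast
    show "\<exists>b. keys b \<subseteq> S' \<and> keys (y - bh b) \<subseteq> {u \<in> S. (0::nat) < 0}"
    proof (cases "keys y = {}")
      case True
      then show ?thesis by (intro exI[of _ 0]) (auto simp: additive.zero[OF additive_bh])
    next
      case False
      then obtain u where "u \<in> keys y" by blast
      then have "u \<in> S" "snd u = gs" using y by auto
      then have "set gs \<subseteq> G" "length gs = q" by (auto simp: S_def)
      then have "keys (push ?J b) \<subseteq> S'" using b(1) by (auto simp: keys_push_inj[OF inj] S'_def)
      moreover have "bh (push ?J b) = y" by (simp add: bh_push_pair b(2) yt)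
      ultimately show ?thesis by (intro exI[of _ "push ?J b"]) simp
    qed
  qed
  then obtain b where "keys b \<subseteq> S'" "z - bh b = 0" by auto
  then show ?thesis by (intro bexI[of _ b]) (auto simp: CC_def S'_def)
qed

lemma dv_degree_0: "z \<in> CC X G 0 \<Longrightarrow> dv z = 0"
proof (rule additive_eqI[of dv "\<lambda>z. 0"])
  show "additive (\<lambda>z. 0)" by (rule additive_0)
qed (auto simp: additive_dv CC_def dv_single dv_gen_def)

definition incl :: "'x list \<Rightarrow> ('x list \<times> 'g list \<Rightarrow>\<^sub>0 'c::ab_group_add) \<Rightarrow> ('x list \<times> 'g list \<Rightarrow>\<^sub>0 'c)" where
  "incl b = push (\<lambda>k. (b, snd k))"

text \<open>The bar complex of H is placed over the empty word, so that its chains have the same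
  type as those of the double complex.\<close>

definition bcyc :: "'g set \<Rightarrow> nat \<Rightarrow> ('x list \<times> 'g list \<Rightarrow>\<^sub>0 'c::ab_group_add) set" where
  "bcyc H q = {z \<in> CC {[]} H q. dv z = 0}"

definition bbd :: "'g set \<Rightarrow> nat \<Rightarrow> ('x list \<times> 'g list \<Rightarrow>\<^sub>0 'c::ab_group_add) set" where
  "bbd H q = dv ` CC {[]} H (Suc q)"

lemma additive_incl: "additive (incl b)"
  unfolding incl_def by (rule additive_push)

lemma incl_CC:
  assumes "z \<in> CC {[]} H q" "H \<subseteq> G" "b \<in> X"
  shows "incl b z \<in> CC X G q"
  using assms keys_push[of "\<lambda>k. (b, snd k)" z] unfolding incl_def CC_def by fastforce

lemma incl_functor:
  assumes "is_subgroup H" "\<And>h. h \<in> H \<Longrightarrow> lact b h = b" "z \<in> CC {[]} H q"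
  shows "equivariant {[]} H b (\<lambda>x h. h) (\<lambda>x u. u)" "push (functor_map b (\<lambda>x u. u)) z = incl b z"
proof -
  show "equivariant {[]} H b (\<lambda>x h. h) (\<lambda>x u. u)" using assms(2) by (simp add: equivariant_def)
  show "push (functor_map b (\<lambda>x u. u)) z = incl b z"
    unfolding incl_def by (rule push_cong) (simp add: functor_map_def bar_simplex_def)
qed

lemma incl_dv:
  assumes "is_subgroup H" "\<And>h. h \<in> H \<Longrightarrow> lact b h = b" "z \<in> CC {[]} H q"
  shows "dv (incl b z) = incl b (dv z)"
proof (cases q)
  case 0
  have "dv (push (\<lambda>k. (b, snd k)) z) = push (\<lambda>k. (b, snd k)) (dv z)"
  proof (rule additive_eqI[of "\<lambda>z. dv (push (\<lambda>k. (b, snd k)) z)" "\<lambda>z. push (\<lambda>k. (b, snd k)) (dv z)"])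
    show "additive (\<lambda>z. dv (push (\<lambda>k. (b, snd k)) z))" by (rule additive_comp[OF additive_dv additive_push])
    show "additive (\<lambda>z. push (\<lambda>k. (b, snd k)) (dv z))" by (rule additive_comp[OF additive_push additive_dv])
  qed (use assms(3) 0 in \<open>auto simp: CC_def dv_single dv_gen_def push_zero\<close>)
  then show ?thesis by (simp add: incl_def)
next
  case (Suc q')
  have "dv z \<in> CC {[]} H q'" using dv_CC[OF assms(1), of "{[]}"] assms(3) Suc by simp
  then show ?thesis
    using functor_dv[OF incl_functor(1)[OF assms] assms(1,3)] incl_functor(2)[OF assms]
      incl_functor(2)[OF assms(1,2)] by simp
qed

text \<open>For this reason all faces of a simplex induce the same map on homology.\<close>

lemma incl_translate:
  assumes G: "is_subgroup G" and H: "is_subgroup H" "H \<subseteq> G" and b: "\<And>h. h \<in> H \<Longrightarrow> lact b h = b"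
    and c: "c \<in> G" "\<And>h. h \<in> H \<Longrightarrow> h + c = c + h"
    and X: "\<And>g. g \<in> G \<Longrightarrow> lact b g \<in> X"
    and z: "z \<in> bcyc H q"
  shows "\<exists>w \<in> CC X G (Suc q). incl (lact b c) z = incl b z + dv w"
proof -
  have zC: "z \<in> CC {[]} H q" and dz: "dv z = 0" using z by (auto simp: bcyc_def)
  \<comment> \<open>The functors u and u + c on H have the same cocycle, hence are homotopic. As c
    commutes with H, right translation by c leaves the differences unchanged, so the second functor
    puts the same tuples over the point b c.\<close>
  let ?w = "lin (htpy_gen b (\<lambda>x u. u) (\<lambda>x u. u + c)) z"
  have e: "equivariant {[]} H b (\<lambda>x h. h) (\<lambda>x u. u + c)"
    using b by (simp add: equivariant_def add.assoc)
  have zG: "z \<in> CC {[]} G q" using CC_mono[OF zC H(2)] .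
  have w: "?w \<in> CC X G (Suc q)"
    by (rule htpy_CC[OF H(1) G zC]) (use H(2) c(1) G X in \<open>auto simp: is_subgroupD\<close>)
  have "diffs (map (\<lambda>u. u + c) us) = diffs us" if "set us \<subseteq> H" for us
    using that
  proof (induction us rule: diffs.induct)
    case (1 u v us)
    have "- (u + c) + (v + c) = - c + ((- u + v) + c)"
      by (simp add: minus_add add.assoc del: add_uminus_conv_diff)
    also have "\<dots> = - u + v" using c(2)[of "- u + v"] 1(2) H(1) by (simp add: is_subgroupD)
    finally show ?case using 1 by simp
  qed auto
  then have fb: "push (functor_map b (\<lambda>x u. u + c)) z = incl (lact b c) z"
    unfolding incl_def
    by (intro push_cong) (use zC set_psums[OF H(1) is_subgroupD(1)[OF H(1)]] in
      \<open>fastforce simp: functor_map_def bar_simplex_def hd_map CC_def\<close>)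
  have "lin (htpy_gen b (\<lambda>x u. u) (\<lambda>x u. u + c)) (dv z) = 0"
    by (simp add: dz additive.zero[OF additive_lin[OF additive_htpy_gen]])
  then have "dv ?w = incl (lact b c) z - incl b z"
    using functor_homotopy[OF incl_functor(1)[OF H(1) b zC] e H(1) zC] fb incl_functor(2)[OF H(1) b zC] by simp
  then show ?thesis using w by (intro bexI[of _ ?w]) auto
qed

lemma lact_minus: "lact (lact xs g) (- g) = xs"
  by (induction xs) auto

context
  fixes G H :: "'g set" and b :: "'x list" and X :: "'x list set"
  assumes G: "is_subgroup G" and H: "is_subgroup H" "H \<subseteq> G"
    and stab: "\<And>g. g \<in> G \<Longrightarrow> lact b g = b \<longleftrightarrow> g \<in> H"
    and X: "X = {lact b g |g. g \<in> G}"
begin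

text \<open>A section of the orbit map. The value 0 at \<open>b\<close> makes the cocycle below
  restrict to the identity of H, so that \<open>retr\<close> is a strict left inverse of
  \<open>incl b\<close>.\<close>

definition sec :: "'x list \<Rightarrow> 'g" where
  "sec x = (if x = b then 0 else (SOME g. g \<in> G \<and> lact b g = x))"

lemma sec: "x \<in> X \<Longrightarrow> sec x \<in> G" "x \<in> X \<Longrightarrow> lact b (sec x) = x"
proof -
  assume "x \<in> X"
  then have "\<exists>g. g \<in> G \<and> lact b g = x" using X by auto
  from someI_ex[OF this] show "sec x \<in> G" "lact b (sec x) = x"
    using is_subgroupD(1)[OF G] by (auto simp: sec_def)
qed

lemma orbit_closed: "x \<in> X \<Longrightarrow> g \<in> G \<Longrightarrow> lact x g \<in> X"
proof -
  assume "x \<in> X" "g \<in> G"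
  then have "lact x g = lact b (sec x + g)" "sec x + g \<in> G"
    using sec[of x] is_subgroupD(2)[OF G] lact_add[where xs = b and g = "sec x" and h = g] by auto
  then show ?thesis using X by blast
qed

lemma base_mem: "b \<in> X"
  using X is_subgroupD(1)[OF G] by (auto intro!: exI[of _ 0])

text \<open>The H-component of the arrow from x to x u after trivialising the orbit along the
  section. It serves both as a map on coordinates and as its own cocycle.\<close>

definition coc :: "'x list \<Rightarrow> 'g \<Rightarrow> 'g" where
  "coc x u = sec x + u + - sec (lact x u)"

lemma coc_mem: "x \<in> X \<Longrightarrow> u \<in> G \<Longrightarrow> coc x u \<in> H"
proof -
  assume x: "x \<in> X" "u \<in> G"
  let ?y = "lact x u"
  have y: "?y \<in> X" using orbit_closed[OF x] .
  have "lact b (coc x u) = lact (lact (lact b (sec x)) u) (- sec ?y)"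
    by (simp add: coc_def lact_add del: add_uminus_conv_diff)
  also have "\<dots> = lact ?y (- sec ?y)" using sec(2)[OF x(1)] by simp
  also have "\<dots> = lact (lact b (sec ?y)) (- sec ?y)" using sec(2)[OF y] by simp
  also have "\<dots> = b" by (rule lact_minus)
  finally have "lact b (coc x u) = b" .
  moreover have "coc x u \<in> G"
    unfolding coc_def using sec(1)[OF x(1)] sec(1)[OF y] x(2) is_subgroupD[OF G]
    by (simp del: add_uminus_conv_diff)
  ultimately show ?thesis using stab by blast
qed

lemma coc_equivariant:
  assumes "\<And>h. h \<in> H \<Longrightarrow> lact b' h = b'"
  shows "equivariant X G b' coc coc"
proof -
  have "coc (lact x h) (- h + u) = - coc x h + coc x u" for x h u
  proof -
    have e: "lact (lact x h) (- h + u) = lact x u"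
      unfolding lact_add[symmetric] by (simp add: add.assoc[symmetric])
    show ?thesis unfolding coc_def e by (simp add: minus_add add.assoc del: add_uminus_conv_diff)
  qed
  then show ?thesis using assms coc_mem by (simp add: equivariant_def)
qed

text \<open>Over \<open>b\<close>, the coordinates \<open>sec x + u\<close> describe the identity
  functor of the orbit. They share the cocycle \<open>coc\<close>, so the prism from
  \<open>coc\<close> to the identity is well defined.\<close>

lemma coc_homotopy_equivariant: "equivariant X G b coc (\<lambda>x u. sec x + u)"
  using coc_mem stab H(2)
  by (auto simp: equivariant_def coc_def minus_add add.assoc simp del: add_uminus_conv_diff)

definition retr :: "('x list \<times> 'g list \<Rightarrow>\<^sub>0 'c::ab_group_add) \<Rightarrow> ('x list \<times> 'g list \<Rightarrow>\<^sub>0 'c)" where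
  "retr = push (functor_map [] coc)"

lemma retr_CC: "z \<in> CC X G q \<Longrightarrow> retr z \<in> CC {[]} H q"
  unfolding retr_def by (rule functor_CC[OF G H(1)]) (auto simp: coc_mem)

lemma retr_dv: "z \<in> CC X G q \<Longrightarrow> dv (retr z) = retr (dv z)"
  unfolding retr_def by (rule functor_dv[OF coc_equivariant G]) auto

lemma retr_incl:
  assumes "z \<in> CC {[]} H q"
  shows "retr (incl b z) = z"
proof -
  have "functor_map [] coc (b, snd k) = k" if k: "k \<in> keys z" for k
  proof -
    obtain gs where gs: "k = ([], gs)" "set gs \<subseteq> H" using k assms by (auto simp: CC_def)
    have "map (coc b) (psums 0 gs) = psums 0 gs"
    proof (rule map_idI)
      fix u assume "u \<in> set (psums 0 gs)"
      then have "u \<in> H" using set_psums[OF H(1) is_subgroupD(1)[OF H(1)] gs(2)] by blast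
      then have "lact b u = b" using stab H(2) by blast
      then show "coc b u = u" by (simp add: coc_def sec_def)
    qed
    then show ?thesis by (simp add: functor_map_def gs(1) bar_simplex_def)
  qed
  then have "push (\<lambda>k. functor_map [] coc (b, snd k)) z = push (\<lambda>k. k) z" by (intro push_cong)
  then show ?thesis by (simp add: retr_def incl_def push_push)
qed

text \<open>The prism between \<open>coc\<close> and \<open>sec x + u\<close> is a homotopy from
  \<open>incl b\<close> after \<open>retr\<close> to the identity, so a cycle y is homologous to the
  image of \<open>retr y\<close>.\<close>

lemma shapiro_surj:
  assumes y: "y \<in> CC X G q" "dv y = 0"
  shows "\<exists>z \<in> bcyc H q. \<exists>w \<in> CC X G (Suc q). y = incl b z + dv w"
proof -
  let ?w = "lin (htpy_gen b coc (\<lambda>x u. sec x + u)) y"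
  have "functor_map b (\<lambda>x u. sec x + u) k = k" if k: "k \<in> keys y" for k
  proof -
    obtain x gs where "k = (x, gs)" "x \<in> X" using k y(1) by (auto simp: CC_def)
    then show ?thesis using sec(2)[of x] by (simp add: functor_map_def bar_simplex_def hd_map diffs_map_plus)
  qed
  then have "push (functor_map b (\<lambda>x u. sec x + u)) y = push (\<lambda>k. k) y" by (intro push_cong)
  then have 1: "push (functor_map b (\<lambda>x u. sec x + u)) y = y" by simp
  have "functor_map b coc k = (b, snd (functor_map [] coc k))" if k: "k \<in> keys y" for k
  proof -
    obtain x gs where xg: "k = (x, gs)" "x \<in> X" using k y(1) by (auto simp: CC_def)
    have "coc x 0 \<in> H" using coc_mem[OF xg(2) is_subgroupD(1)[OF G]] .
    then have "lact b (coc x 0) = b" using stab H(2) by blast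
    then show ?thesis by (simp add: functor_map_def bar_simplex_def hd_map xg(1))
  qed
  then have 2: "push (functor_map b coc) y = incl b (retr y)"
    unfolding incl_def retr_def push_push by (rule push_cong)
  have "lin (htpy_gen b coc (\<lambda>x u. sec x + u)) (dv y) = 0"
    by (simp add: y(2) additive.zero[OF additive_lin[OF additive_htpy_gen]])
  moreover have "equivariant X G b coc coc" using coc_equivariant stab H(2) by blast
  ultimately have "dv ?w = y - incl b (retr y)"
    using functor_homotopy[OF _ coc_homotopy_equivariant G y(1), of coc] 1 2 by simp
  then have "y = incl b (retr y) + dv ?w" by simp
  moreover have "?w \<in> CC X G (Suc q)"
  proof (rule htpy_CC[OF G G y(1)])
    show "coc x u \<in> G" if "x \<in> X" "u \<in> G" for x u using coc_mem[OF that] H(2) by blast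
    show "sec x + u \<in> G" if "x \<in> X" "u \<in> G" for x u using that sec(1) is_subgroupD(2)[OF G] by blast
    show "lact b h \<in> X" if "h \<in> G" for h using orbit_closed[OF base_mem that] .
  qed
  moreover have "retr y \<in> bcyc H q"
    using retr_CC[OF y(1)] retr_dv[OF y(1)] y(2)
    by (simp add: bcyc_def retr_def push_zero)
  ultimately show ?thesis by blast
qed

text \<open>Apply \<open>retr\<close> to the equation: it commutes with \<open>dv\<close> and undoes
  \<open>incl b\<close> exactly.\<close>

lemma shapiro_inj:
  assumes z: "z \<in> bcyc H q" and w: "w \<in> CC X G (Suc q)" "incl b z = dv w"
  shows "z \<in> bbd H q"
proof -
  have "z = retr (incl b z)" using retr_incl[of z q] z by (simp add: bcyc_def)
  also have "\<dots> = dv (retr w)" using w(2) retr_dv[OF w(1)] by simp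
  finally show ?thesis using retr_CC[OF w(1)] unfolding bbd_def by blast
qed

end

end

section \<open>Stability for an abstract tower of groups\<close>

definition base :: "(nat \<Rightarrow> 'x) \<Rightarrow> nat \<Rightarrow> nat \<Rightarrow> 'x list" where
  "base \<delta> n k = map (\<lambda>i. \<delta> (n - i)) [0..<k]"

text \<open>What the stability argument uses of the groups, with the index shifted by one:
  \<open>P (Suc n)\<close> is W_n and \<open>P 0\<close> is W_{-1}. The base word lists \<delta>_n,
  \<delta>_{n-1}, ... downwards, so that appending a letter lowers the index of the stabiliser by
  one. In \<open>face\<close>, the translating element commutes with the stabiliser of the longer
  word. The parameter \<open>coef\<close> fixes the coefficient type of \<open>exact\<close>, since
  a locale assumption cannot quantify over types.\<close>

locale tower = gset act for act :: "'x \<Rightarrow> 'g::group_add \<Rightarrow> 'x" +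
  fixes P :: "nat \<Rightarrow> 'g set" and \<delta> :: "nat \<Rightarrow> 'x" and M :: nat and coef :: "'c::ab_group_add itself"
  assumes subgroup: "is_subgroup (P j)"
    and P_Suc: "P j \<subseteq> P (Suc j)"
    and stabilizer: "n \<le> M \<Longrightarrow> k \<le> Suc n \<Longrightarrow> g \<in> P (Suc n) \<Longrightarrow>
      map (\<lambda>x. act x g) (base \<delta> n k) = base \<delta> n k \<longleftrightarrow> g \<in> P (Suc n - k)"
    and face: "n \<le> M \<Longrightarrow> k \<le> n \<Longrightarrow> i \<le> k \<Longrightarrow>
      \<exists>c \<in> P (Suc n). (\<forall>h \<in> P (n - k). h + c = c + h) \<and>
        del i (base \<delta> n (Suc k)) = map (\<lambda>x. act x c) (base \<delta> n k)"
    and exact: "n \<le> M \<Longrightarrow> k \<le> n \<Longrightarrow> keys t \<subseteq> {map (\<lambda>x. act x g) (base \<delta> n k) |g. g \<in> P (Suc n)} \<Longrightarrow>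
      bdl (t :: 'x list \<Rightarrow>\<^sub>0 'c) = 0 \<Longrightarrow>
      \<exists>b. keys b \<subseteq> {map (\<lambda>x. act x g) (base \<delta> n (Suc k)) |g. g \<in> P (Suc n)} \<and> bdl b = t"
begin

abbreviation "B \<equiv> base \<delta>"

definition D :: "nat \<Rightarrow> nat \<Rightarrow> 'x list set" where
  "D n k = {lact (B n k) g |g. g \<in> P (Suc n)}"

abbreviation K :: "nat \<Rightarrow> nat \<Rightarrow> nat \<Rightarrow> ('x list \<times> 'g list \<Rightarrow>\<^sub>0 'c) set" where
  "K n k q \<equiv> CC (D n k) (P (Suc n)) q"

lemma P_mono: "i \<le> j \<Longrightarrow> P i \<subseteq> P j"
  using lift_Suc_mono_le[of P i j] P_Suc by blast

lemma stab_B: "n \<le> M \<Longrightarrow> k \<le> Suc n \<Longrightarrow> h \<in> P (Suc n - k) \<Longrightarrow> lact (B n k) h = B n k"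
  using stabilizer[of n k h] P_mono[of "Suc n - k" "Suc n"] by auto

lemma B_in_D: "B n k \<in> D n k"
  unfolding D_def using is_subgroupD(1)[OF subgroup] by (auto intro!: exI[of _ 0])

lemma D_closed: "x \<in> D n k \<Longrightarrow> g \<in> P (Suc n) \<Longrightarrow> lact x g \<in> D n k"
proof -
  assume "x \<in> D n k" and g: "g \<in> P (Suc n)"
  then obtain h where h: "x = lact (B n k) h" "h \<in> P (Suc n)" by (auto simp: D_def)
  then have "lact x g = lact (B n k) (h + g)" by (simp only: lact_add)
  then show ?thesis using is_subgroupD(2)[OF subgroup h(2) g] unfolding D_def by blast
qed

lemma K_surj:
  assumes "n \<le> M" "k \<le> Suc n" "y \<in> K n k q" "dv y = 0"
  shows "\<exists>z \<in> bcyc (P (Suc n - k)) q. \<exists>w \<in> K n k (Suc q). y = incl (B n k) z + dv w"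
proof (rule shapiro_surj[OF subgroup subgroup _ _ D_def])
  show "P (Suc n - k) \<subseteq> P (Suc n)" by (rule P_mono) simp
qed (use assms stabilizer in auto)

lemma K_inj:
  fixes z :: "'x list \<times> 'g list \<Rightarrow>\<^sub>0 'c"
  assumes "n \<le> M" "k \<le> Suc n" "z \<in> bcyc (P (Suc n - k)) q" "w \<in> K n k (Suc q)" "incl (B n k) z = dv w"
  shows "z \<in> bbd (P (Suc n - k)) q"
proof (rule shapiro_inj[OF subgroup subgroup _ _ D_def])
  show "P (Suc n - k) \<subseteq> P (Suc n)" by (rule P_mono) simp
qed (use assms stabilizer in auto)

lemma rows: "n \<le> M \<Longrightarrow> k \<le> n \<Longrightarrow> y \<in> K n k q \<Longrightarrow> bh y = 0 \<Longrightarrow> \<exists>x \<in> K n (Suc k) q. bh x = y"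
proof (rule rows_exact[of "D n k" "D n (Suc k)"])
  show "\<exists>b. keys b \<subseteq> D n (Suc k) \<and> bdl b = t"
    if "n \<le> M" "k \<le> n" "keys t \<subseteq> D n k" "bdl t = 0" for t :: "'x list \<Rightarrow>\<^sub>0 'c"
    using exact[OF that(1,2) _ that(4)] that(3) unfolding D_def by blast
qed

lemma D_0: "D n 0 = {[]}"
  using is_subgroupD(1)[OF subgroup[of "Suc n"]] by (auto simp: D_def base_def)

lemma bh_K0: "y \<in> K n 0 q \<Longrightarrow> bh y = 0"
proof (rule additive_eqI[of bh "\<lambda>z. 0"])
  show "additive (\<lambda>z. 0)" by (rule additive_0)
qed (auto simp: additive_bh CC_def D_0 bh_single push_zero)

lemma bh_K: 
  assumes n: "n \<le> M" "k \<le> n" and y: "y \<in> K n (Suc k) q"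
  shows "bh y \<in> K n k q"
proof -
  have "keys (bh y) \<subseteq> D n k \<times> {gs. set gs \<subseteq> P (Suc n) \<and> length gs = q}"
  proof (rule keys_additive_subset[OF additive_bh])
    fix u and c :: 'c assume "u \<in> keys y"
    then obtain x gs where u: "u = (x, gs)" "x \<in> D n (Suc k)" "set gs \<subseteq> P (Suc n)" "length gs = q"
      using y by (auto simp: CC_def)
    have "del i x \<in> D n k" if i: "i < length x" for i
    proof -
      obtain g where g: "x = lact (B n (Suc k)) g" "g \<in> P (Suc n)" using u(2) by (auto simp: D_def)
      then have "i \<le> k" using i by (simp add: base_def)
      then obtain c where c: "c \<in> P (Suc n)" "del i (B n (Suc k)) = lact (B n k) c"
        using face[OF n] by blast
      then have "del i x = lact (lact (B n k) c) g" by (simp add: g(1) flip: map_del)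
      then show ?thesis using D_closed[OF D_closed[OF B_in_D c(1)] g(2)] by simp
    qed
    then have "keys (list_bd x c) \<subseteq> D n k" using keys_list_bd[of x c] by blast
    then show "keys (bh (single u c)) \<subseteq> D n k \<times> {gs. set gs \<subseteq> P (Suc n) \<and> length gs = q}"
      using keys_push[of "\<lambda>y. (y, gs)" "list_bd x c"] u(3,4) unfolding u(1) bh_single by auto
  qed
  then show ?thesis by (simp add: CC_def)
qed

lemma dv_K: "y \<in> K n k (Suc q) \<Longrightarrow> dv y \<in> K n k q"
  by (rule dv_CC[OF subgroup D_closed])

text \<open>All k + 1 faces of the base simplex give the same class by
  \<open>incl_translate\<close>, so their alternating sum leaves one copy for even k and nothing for
  odd k. In a spectral sequence this would be the first differential.\<close>

lemma bh_incl:
  fixes z :: "'x list \<times> 'g list \<Rightarrow>\<^sub>0 'c"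
  assumes n: "n \<le> M" "k \<le> n" and z: "z \<in> bcyc (P (n - k)) q"
  shows "\<exists>w \<in> K n k (Suc q). bh (incl (B n (Suc k)) z) = (if even k then incl (B n k) z else 0) + dv w"
proof -
  have zC: "z \<in> CC {[]} (P (n - k)) q" using z by (simp add: bcyc_def)
  have "\<exists>w \<in> K n k (Suc q). incl (del i (B n (Suc k))) z = incl (B n k) z + dv w" if i: "i \<le> k" for i
  proof -
    obtain c where c: "c \<in> P (Suc n)" "\<forall>h \<in> P (n - k). h + c = c + h" "del i (B n (Suc k)) = lact (B n k) c"
      using face[OF n i] by blast
    have "\<exists>w \<in> K n k (Suc q). incl (lact (B n k) c) z = incl (B n k) z + dv w"
    proof (rule incl_translate[OF subgroup subgroup])
      show "P (n - k) \<subseteq> P (Suc n)" by (rule P_mono) simp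
      show "lact (B n k) h = B n k" if "h \<in> P (n - k)" for h
        using stab_B[of n k h] n P_mono[of "n - k" "Suc n - k"] diff_le_mono[of n "Suc n" k] that by auto
      show "lact (B n k) g \<in> D n k" if "g \<in> P (Suc n)" for g using that by (auto simp: D_def)
    qed (use c z in auto)
    then show ?thesis by (simp add: c(3))
  qed
  then have "\<exists>w. \<forall>i. i \<le> k \<longrightarrow> w i \<in> K n k (Suc q) \<and> incl (del i (B n (Suc k))) z = incl (B n k) z + dv (w i)"
    by (intro choice allI) blast
  then obtain w where w: "\<And>i. i \<le> k \<Longrightarrow> w i \<in> K n k (Suc q)"
      "\<And>i. i \<le> k \<Longrightarrow> incl (del i (B n (Suc k))) z = incl (B n k) z + dv (w i)" by blast
  define ww where "ww = (\<Sum>i<Suc k. sg i (w i))"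
  have "bh (incl (B n (Suc k)) z) = (\<Sum>i<Suc k. sg i (incl (del i (B n (Suc k))) z))"
  proof (rule additive_eqI[of "\<lambda>z. bh (incl (B n (Suc k)) z)"])
    show "additive (\<lambda>z. bh (incl (B n (Suc k)) z))" by (rule additive_comp[OF additive_bh additive_incl])
    show "additive (\<lambda>z. \<Sum>i<Suc k. sg i (incl (del i (B n (Suc k))) z))"
      by standard (simp add: additive.add[OF additive_incl] additive.add[OF additive_sg] sum.distrib)
    show "bh (incl (B n (Suc k)) (single u c)) = (\<Sum>i<Suc k. sg i (incl (del i (B n (Suc k))) (single u c)))"
      for u and c :: 'c
    proof -
      have l: "length (B n (Suc k)) = Suc k" by (simp add: base_def)
      show ?thesis
        unfolding incl_def push_single bh_single list_bd_sum l push_sum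
        by (simp only: push_single snd_conv sg_additive[OF additive_single])
    qed
  qed
  also have "\<dots> = (\<Sum>i<Suc k. sg i (incl (B n k) z)) + (\<Sum>i<Suc k. sg i (dv (w i)))"
    unfolding sum.distrib[symmetric]
    by (rule sum.cong) (auto simp: w(2) additive.add[OF additive_sg] less_Suc_eq_le)
  also have "(\<Sum>i<Suc k. sg i (dv (w i))) = dv ww"
    by (simp only: ww_def additive.sum[OF additive_dv] sg_additive[OF additive_dv])
  also have "(\<Sum>i<Suc m. sg i v) = (if even m then v else 0)" for m and v :: "'x list \<times> 'g list \<Rightarrow>\<^sub>0 'c"
    by (induction m) (auto simp: sg_def)
  finally have "bh (incl (B n (Suc k)) z) = (if even k then incl (B n k) z else 0) + dv ww" .
  moreover have "ww \<in> K n k (Suc q)"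
    unfolding ww_def by (rule CC_sum, rule CC_sg, rule w(1)) simp
  ultimately show ?thesis by blast
qed

subsection \<open>The stability argument\<close>

text \<open>Index j concerns the map from W_{j-1} to W_j. Working with cycles and boundaries avoids
  forming homology groups.\<close>

definition stab_inj :: "nat \<Rightarrow> nat \<Rightarrow> bool" where
  "stab_inj j q \<longleftrightarrow> (\<forall>z :: 'x list \<times> 'g list \<Rightarrow>\<^sub>0 'c.
     z \<in> bcyc (P j) q \<longrightarrow> z \<in> bbd (P (Suc j)) q \<longrightarrow> z \<in> bbd (P j) q)"

definition stab_surj :: "nat \<Rightarrow> nat \<Rightarrow> bool" where
  "stab_surj j q \<longleftrightarrow> (\<forall>z :: 'x list \<times> 'g list \<Rightarrow>\<^sub>0 'c.
     z \<in> bcyc (P (Suc j)) q \<longrightarrow> (\<exists>z' \<in> bcyc (P j) q. z - z' \<in> bbd (P (Suc j)) q))"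

text \<open>The two faces of a 1-simplex over the empty word coincide, so there are no nonzero
  boundaries in degree 0.\<close>

lemma stab_inj_0: "stab_inj j 0"
  unfolding stab_inj_def bbd_def
proof (intro allI impI)
  fix z :: "'x list \<times> 'g list \<Rightarrow>\<^sub>0 'c"
  assume "z \<in> dv ` CC {[]} (P (Suc j)) (Suc 0)"
  then obtain w where w: "z = dv w" "w \<in> CC {[]} (P (Suc j)) (Suc 0)" by blast
  have "dv w = 0"
  proof (rule additive_eqI[of dv "\<lambda>z. 0"])
    show "additive (\<lambda>z. 0)" by (rule additive_0)
    fix u and c :: 'c assume "u \<in> keys w"
    then obtain g where "u = ([], [g])" using w(2) by (fastforce simp: CC_def length_Suc_conv)
    then show "dv (single u c) = 0" by (simp add: dv_single dv_gen_def push_diff push_zero bar_simplex_def)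
  qed (rule additive_dv)
  then show "z \<in> dv ` CC {[]} (P j) (Suc 0)" using w(1) CC_0 additive.zero[OF additive_dv]
    by (metis imageI)
qed

lemma bbd_0: "0 \<in> bbd H q"
  unfolding bbd_def by (rule image_eqI[of _ _ 0]) (simp_all add: CC_0 additive.zero[OF additive_dv])

lemma stab_surj_0: "stab_surj j 0"
  unfolding stab_surj_def
proof (intro allI impI)
  fix z :: "'x list \<times> 'g list \<Rightarrow>\<^sub>0 'c" assume z: "z \<in> bcyc (P (Suc j)) 0"
  then have "z \<in> bcyc (P j) 0" by (auto simp: bcyc_def CC_def)
  then show "\<exists>z' \<in> bcyc (P j) 0. z - z' \<in> bbd (P (Suc j)) 0" using bbd_0 by force
qed

lemma bcyc_mono: "z \<in> bcyc H q \<Longrightarrow> H \<subseteq> G \<Longrightarrow> z \<in> bcyc G q"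
  by (auto simp: bcyc_def intro: CC_mono)

lemma incl_K:
  assumes "z \<in> CC {[]} (P j) q" "j \<le> Suc n"
  shows "incl (B n k) z \<in> K n k q"
  by (rule incl_CC[OF assms(1) P_mono[OF assms(2)] B_in_D])

lemma incl_B_dv:
  fixes z :: "'x list \<times> 'g list \<Rightarrow>\<^sub>0 'c"
  assumes "n \<le> M" "k \<le> Suc n" "z \<in> CC {[]} (P (Suc n - k)) q"
  shows "dv (incl (B n k) z) = incl (B n k) (dv z)"
  by (rule incl_dv[OF subgroup _ assms(3)]) (use stab_B assms in auto)

text \<open>This replaces the spectral sequence of the double complex: with coefficients in the module of
  horizontal cycles, the connecting maps of the long exact sequences are controlled by the
  stabilisation maps of the smaller groups. The two parities of \<open>k\<close> use injectivity and
  surjectivity of these, respectively.\<close>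

lemma lift_cycle:
  assumes n: "n \<le> M"
    and inj: "\<And>j q. j < n \<Longrightarrow> 2 * q \<le> j \<Longrightarrow> stab_inj j q"
    and surj: "\<And>j q. j < n \<Longrightarrow> 2 * q \<le> j \<Longrightarrow> stab_surj j q"
    and k: "k \<le> n" "if odd k then k + 2 * q \<le> Suc n else k + 2 * q \<le> n"
    and y: "y \<in> K n k q" "dv y = 0" "bh y = 0"
  shows "\<exists>x \<in> K n (Suc k) q. dv x = 0 \<and> bh x = y"
  using k y
proof (induction q arbitrary: k y)
  case 0
  obtain x where "x \<in> K n (Suc k) 0" "bh x = y" using rows[OF n 0(1,3,5)] by blast
  then show ?case using dv_degree_0 by blast
next
  case (Suc q)
  \<comment> \<open>The zigzag: \<open>dv x0\<close> is a horizontal cycle one column further and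
    one degree lower, so by induction it is \<open>bh x1\<close> with \<open>dv x1 = 0\<close>. If
    it can be written as \<open>dv (bh t)\<close>, then \<open>x0 - bh t\<close> is the required
    lift. Such a t is built from the class of x1, which comes from a smaller group by Shapiro's
    lemma.\<close>
  obtain x0 where x0: "x0 \<in> K n (Suc k) (Suc q)" "bh x0 = y" using rows[OF n Suc.prems(1,3,5)] by blast
  define w where "w = dv x0"
  have w: "w \<in> K n (Suc k) q" "dv w = 0" "bh w = 0"
    using dv_K[OF x0(1)] Suc.prems(4) by (simp_all add: w_def dv_dv bh_dv x0(2))
  have k': "Suc k \<le> n" using Suc.prems(2) by (auto split: if_splits)
  obtain x1 where x1: "x1 \<in> K n (Suc (Suc k)) q" "dv x1 = 0" "bh x1 = w"
    using Suc.IH[OF k' _ w] Suc.prems(2) by (auto split: if_splits)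
  have s2: "Suc (Suc k) \<le> Suc n" using k' by simp
  obtain z b where z: "z \<in> bcyc (P (n - Suc k)) q" and b: "b \<in> K n (Suc (Suc k)) (Suc q)"
      and x1_eq: "x1 = incl (B n (Suc (Suc k))) z + dv b"
    using K_surj[OF n s2 x1(1,2)] by auto
  have "\<exists>t \<in> K n (Suc (Suc k)) (Suc q). dv (bh t) = w"
  proof (cases "odd k")
    case True
    \<comment> \<open>Here k + 1 is even, so \<open>bh\<close> acts on the class of z as the
      stabilisation map. The image of z is a boundary, hence z bounds in \<open>P (n - k)\<close>;
      injectivity for the previous pair of groups makes it bound in \<open>P (n - Suc k)\<close>,
      and x1 itself becomes vertically exact.\<close>
    obtain w1 where w1: "w1 \<in> K n (Suc k) (Suc q)"
        "bh (incl (B n (Suc (Suc k))) z) = incl (B n (Suc k)) z + dv w1"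
      using bh_incl[OF n k' z] True by auto
    have "w = incl (B n (Suc k)) z + dv w1 + dv (bh b)"
      using x1(3) w1(2) by (simp add: x1_eq additive.add[OF additive_bh] bh_dv)
    then have "incl (B n (Suc k)) z = dv (x0 - w1 - bh b)"
      by (simp add: additive.diff[OF additive_dv] w_def)
    moreover have "x0 - w1 - bh b \<in> K n (Suc k) (Suc q)"
      by (intro CC_diff x0(1) w1(1) bh_K[OF n k' b])
    moreover have zz: "z \<in> bcyc (P (n - k)) q"
      using bcyc_mono[OF z] P_mono[of "n - Suc k" "n - k"] by simp
    ultimately have "z \<in> bbd (P (n - k)) q"
      using K_inj[OF n, of "Suc k" z q "x0 - w1 - bh b"] k' by simp
    moreover have "stab_inj (n - Suc k) q" using inj[of "n - Suc k" q] Suc.prems(2) True k' by auto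
    ultimately have "z \<in> bbd (P (n - Suc k)) q"
      using z Suc_diff_Suc[of k n] k' by (simp add: stab_inj_def)
    then obtain z' where z': "z' \<in> CC {[]} (P (n - Suc k)) (Suc q)" "z = dv z'" by (auto simp: bbd_def)
    have "dv (incl (B n (Suc (Suc k))) z' + b) = x1"
      using incl_B_dv[OF n s2, of z' "Suc q"] z' by (simp add: x1_eq additive.add[OF additive_dv])
    moreover have "incl (B n (Suc (Suc k))) z' + b \<in> K n (Suc (Suc k)) (Suc q)"
      by (intro CC_add incl_K[OF z'(1)] b) simp
    ultimately show ?thesis using x1(3) bh_dv by metis
  next
    case False
    \<comment> \<open>Here k + 1 is odd, and \<open>bh\<close> kills the class of z only up to
      \<open>dv\<close> of a chain that need not be of the form \<open>bh t\<close>. By surjectivity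
      z may be replaced by z2 from the next smaller group; its image is \<open>bh\<close> of a chain
      in column k + 3 up to \<open>dv\<close>, and a second application of \<open>bh\<close> removes
      it.\<close>
    then have k2: "Suc (Suc k) \<le> n" "2 * q \<le> n - Suc (Suc k)" using Suc.prems(2) by auto
    have e: "Suc (n - Suc (Suc k)) = n - Suc k" using k2 by simp
    have "stab_surj (n - Suc (Suc k)) q" using surj k2 by simp
    then obtain z2 where z2: "z2 \<in> bcyc (P (n - Suc (Suc k))) q" "z - z2 \<in> bbd (P (n - Suc k)) q"
      using z unfolding stab_surj_def e by blast
    then obtain z3 where z3: "z3 \<in> CC {[]} (P (n - Suc k)) (Suc q)" "z - z2 = dv z3"
      by (auto simp: bbd_def)
    obtain w2 where w2: "w2 \<in> K n (Suc (Suc k)) (Suc q)"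
        "bh (incl (B n (Suc (Suc (Suc k)))) z2) = incl (B n (Suc (Suc k))) z2 + dv w2"
      using bh_incl[OF n k2(1) z2(1)] False by auto
    let ?t = "incl (B n (Suc (Suc k))) z3 + b - w2"
    have "incl (B n (Suc (Suc k))) z = incl (B n (Suc (Suc k))) z2 + dv (incl (B n (Suc (Suc k))) z3)"
    proof -
      have "dv (incl (B n (Suc (Suc k))) z3) = incl (B n (Suc (Suc k))) (dv z3)"
        by (rule incl_B_dv[OF n s2]) (use z3(1) in simp)
      then show ?thesis by (simp only: additive.add[OF additive_incl, symmetric] z3(2)[symmetric]) simp
    qed
    then have "x1 = bh (incl (B n (Suc (Suc (Suc k)))) z2) + dv ?t"
      by (simp add: x1_eq w2(2) additive.add[OF additive_dv] additive.diff[OF additive_dv])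
    then have "dv (bh ?t) = w"
      using x1(3) by (simp add: additive.add[OF additive_bh] bh_bh bh_dv)
    moreover have "?t \<in> K n (Suc (Suc k)) (Suc q)"
      by (intro CC_add CC_diff incl_K[OF z3(1)] b w2(1)) simp
    ultimately show ?thesis by blast
  qed
  then obtain t where t: "t \<in> K n (Suc (Suc k)) (Suc q)" "dv (bh t) = w" by blast
  have "x0 - bh t \<in> K n (Suc k) (Suc q)" by (intro CC_diff x0(1) bh_K[OF n k' t(1)])
  moreover have "dv (x0 - bh t) = 0" by (simp add: additive.diff[OF additive_dv] t(2) w_def)
  moreover have "bh (x0 - bh t) = y" by (simp add: additive.diff[OF additive_bh] bh_bh x0(2))
  ultimately show ?case by blast
qed

lemma incl_Nil: "z \<in> CC {[]} H q \<Longrightarrow> incl [] z = z"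
proof -
  assume z: "z \<in> CC {[]} H q"
  have "incl [] z = push (\<lambda>k. k) z"
    unfolding incl_def by (rule push_cong) (use z in \<open>auto simp: CC_def\<close>)
  then show ?thesis by simp
qed

lemma K_0: "K n 0 q = CC {[]} (P (Suc n)) q"
  by (simp add: D_0)

text \<open>For surjectivity, a cycle in column 0 is lifted to column 1, where it comes from
  W_{n-1}. For injectivity, one lifts from column 1 to column 2, where the map back to column 1 is
  zero on homology. For n = 0 only degree 0 occurs.\<close>

theorem homology_stability:
  assumes "n \<le> M" "2 * q \<le> n"
  shows "stab_inj n q \<and> stab_surj n q"
  using assms
proof (induction n arbitrary: q rule: less_induct)
  case (less n)
  show ?case
  proof (cases "n = 0")
    case True
    then show ?thesis using less.prems stab_inj_0 stab_surj_0 by simp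
  next
    case False
    note n = \<open>n \<le> M\<close>
    have lift: "\<exists>x \<in> K n (Suc k) q. dv x = 0 \<and> bh x = y"
      if "k \<le> n" "if odd k then k + 2 * q \<le> Suc n else k + 2 * q \<le> n"
        "y \<in> K n k q" "dv y = 0" "bh y = 0" for k q y
      by (rule lift_cycle[OF n _ _ that]) (use less.IH n in auto)
    have B0: "B n 0 = []" by (simp add: base_def)
    have "stab_surj n q"
      unfolding stab_surj_def
    proof (intro allI impI)
      fix z :: "'x list \<times> 'g list \<Rightarrow>\<^sub>0 'c" assume z: "z \<in> bcyc (P (Suc n)) q"
      then have zK: "z \<in> K n 0 q" "dv z = 0" by (auto simp: bcyc_def K_0)
      obtain x where x: "x \<in> K n (Suc 0) q" "dv x = 0" "bh x = z"
        using lift[of 0 q z] zK bh_K0 less.prems(2) by auto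
      obtain z' w where z': "z' \<in> bcyc (P n) q" and w: "w \<in> K n (Suc 0) (Suc q)"
          and x_eq: "x = incl (B n (Suc 0)) z' + dv w"
        using K_surj[OF n _ x(1,2)] by auto
      obtain w1 where w1: "w1 \<in> K n 0 (Suc q)" "bh (incl (B n (Suc 0)) z') = incl (B n 0) z' + dv w1"
        using bh_incl[OF n, of 0 z' q] z' by auto
      have "incl (B n 0) z' = z'" using z' incl_Nil by (auto simp: B0 bcyc_def)
      then have "z - z' = dv (w1 + bh w)"
        using x(3) w1(2) by (simp add: x_eq additive.add[OF additive_bh] additive.add[OF additive_dv] bh_dv
            algebra_simps)
      moreover have "w1 + bh w \<in> K n 0 (Suc q)" by (intro CC_add w1(1) bh_K[OF n _ w]) simp
      ultimately have "z - z' \<in> bbd (P (Suc n)) q" unfolding bbd_def K_0 by blast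
      then show "\<exists>z' \<in> bcyc (P n) q. z - z' \<in> bbd (P (Suc n)) q" using z' by blast
    qed
    moreover have "stab_inj n q"
      unfolding stab_inj_def
    proof (intro allI impI)
      fix z :: "'x list \<times> 'g list \<Rightarrow>\<^sub>0 'c"
      assume z: "z \<in> bcyc (P n) q" and "z \<in> bbd (P (Suc n)) q"
      then obtain u where u: "u \<in> K n 0 (Suc q)" "z = dv u" by (auto simp: bbd_def K_0)
      obtain w1 where w1: "w1 \<in> K n 0 (Suc q)" "bh (incl (B n (Suc 0)) z) = incl (B n 0) z + dv w1"
        using bh_incl[OF n, of 0 z q] z by auto
      have i0: "incl (B n 0) z = z" using z incl_Nil by (auto simp: B0 bcyc_def)
      have w1': "bh (incl (B n (Suc 0)) z) = dv u + dv w1"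
        by (simp only: w1(2) i0) (simp only: u(2)[symmetric])
      \<comment> \<open>Everything in column 0 is a horizontal cycle, so u + w1 lifts. Subtracting
        \<open>dv v\<close> from the image of z yields a chain that is a cycle in both directions,
        as lifting requires.\<close>
      obtain v where v: "v \<in> K n (Suc 0) (Suc q)" "bh v = u + w1"
        using rows[OF n _ CC_add[OF u(1) w1(1)]] bh_K0[OF CC_add[OF u(1) w1(1)]] by auto
      define y where "y = incl (B n (Suc 0)) z - dv v"
      have zC: "z \<in> CC {[]} (P n) q" "dv z = 0" using z by (auto simp: bcyc_def)
      have "y \<in> K n (Suc 0) q" unfolding y_def by (intro CC_diff incl_K[OF zC(1)] dv_K v(1)) simp
      moreover have "dv y = 0"
        using incl_B_dv[OF n, of "Suc 0" z q] zC
        by (simp add: y_def additive.diff[OF additive_dv] dv_dv additive.zero[OF additive_incl])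
      moreover have "bh y = 0"
        by (simp add: y_def additive.diff[OF additive_bh] w1' bh_dv v(2) additive.add[OF additive_dv])
      moreover have "Suc 0 \<le> n" "if odd (Suc 0) then Suc 0 + 2 * q \<le> Suc n else Suc 0 + 2 * q \<le> n"
        using False less.prems(2) by simp_all
      ultimately obtain x where x: "x \<in> K n (Suc (Suc 0)) q" "dv x = 0" "bh x = y"
        using lift by blast
      have s2: "Suc (Suc 0) \<le> Suc n" using False by simp
      obtain z2 b where z2: "z2 \<in> bcyc (P (n - Suc 0)) q" and b: "b \<in> K n (Suc (Suc 0)) (Suc q)"
          and x_eq: "x = incl (B n (Suc (Suc 0))) z2 + dv b"
        using K_surj[OF n s2 x(1,2)] by auto
      obtain w2 where w2: "w2 \<in> K n (Suc 0) (Suc q)" "bh (incl (B n (Suc (Suc 0))) z2) = dv w2"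
        using bh_incl[OF n _ z2] False by auto
      have "incl (B n (Suc 0)) z = dv (v + w2 + bh b)"
      proof -
        have "y = dv w2 + dv (bh b)"
          using x(3) by (simp add: x_eq additive.add[OF additive_bh] w2(2) bh_dv)
        then show ?thesis unfolding additive.add[OF additive_dv] y_def by (simp add: algebra_simps)
      qed
      moreover have "v + w2 + bh b \<in> K n (Suc 0) (Suc q)"
        by (intro CC_add v(1) w2(1) bh_K[OF n _ b]) (use False in simp)
      ultimately show "z \<in> bbd (P n) q" using K_inj[OF n, of "Suc 0" z q] z by simp
    qed
    ultimately show ?thesis by blast
  qed
qed

end

section \<open>Words modulo the Coxeter relations\<close>

lemma cox_rel_lists: "(u, v) \<in> cox_rel T m \<Longrightarrow> u \<in> lists T \<and> v \<in> lists T"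
proof (induction rule: cox_rel.induct)
  case (relator u v s t k)
  have "set (concat (replicate k [s, t])) \<subseteq> T" using relator by (induction k) auto
  then show ?case using relator by (auto simp: in_lists_conv_set)
qed auto

lemma cox_rel_mono: "(u, v) \<in> cox_rel T m \<Longrightarrow> T \<subseteq> S \<Longrightarrow> (u, v) \<in> cox_rel S m"
proof (induction rule: cox_rel.induct)
  case (relator u v s t k)
  then show ?case by (intro cox_rel.relator) auto
qed (auto intro: cox_rel.refl cox_rel.sym cox_rel.trans)

lemma cox_rel_cong:
  assumes "(u, v) \<in> cox_rel T m" "x \<in> lists T" "y \<in> lists T"
  shows "(x @ u @ y, x @ v @ y) \<in> cox_rel T m"
  using assms
proof (induction rule: cox_rel.induct)
  case (refl w)
  then show ?case by (intro cox_rel.refl) auto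
next
  case (relator u v s t k)
  then have "((x @ u) @ concat (replicate k [s, t]) @ (v @ y), (x @ u) @ (v @ y)) \<in> cox_rel T m"
    by (intro cox_rel.relator) auto
  then show ?case by simp
qed (auto intro: cox_rel.refl cox_rel.sym cox_rel.trans)

lemma cox_rel_append:
  assumes "(u, u') \<in> cox_rel T m" "(v, v') \<in> cox_rel T m"
  shows "(u @ v, u' @ v') \<in> cox_rel T m"
proof -
  note l = cox_rel_lists[OF assms(1)] cox_rel_lists[OF assms(2)]
  have "(u @ v, u' @ v) \<in> cox_rel T m" using cox_rel_cong[OF assms(1), of "[]" v] l by simp
  moreover have "(u' @ v, u' @ v') \<in> cox_rel T m" using cox_rel_cong[OF assms(2), of u' "[]"] l by simp
  ultimately show ?thesis by (rule cox_rel.trans)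
qed

text \<open>The length in the group presented by T itself. Until faithfulness is proved, this group
  is not known to embed in a larger one, so T stays explicit.\<close>

definition len :: "'v set \<Rightarrow> ('v \<Rightarrow> 'v \<Rightarrow> enat) \<Rightarrow> 'v list \<Rightarrow> nat" where
  "len T m w = (LEAST n. \<exists>u. (u, w) \<in> cox_rel T m \<and> length u = n)"

lemma len_le: "(u, w) \<in> cox_rel T m \<Longrightarrow> len T m w \<le> length u"
  unfolding len_def by (rule Least_le) blast

lemma len_le_length: "w \<in> lists T \<Longrightarrow> len T m w \<le> length w"
  by (rule len_le) (rule cox_rel.refl)

lemma reduced_exists:
  assumes "w \<in> lists T"
  obtains u where "(u, w) \<in> cox_rel T m" "length u = len T m w"
proof -
  have "\<exists>u. (u, w) \<in> cox_rel T m \<and> length u = length w" using cox_rel.refl[OF assms] by blast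
  from LeastI[of "\<lambda>n. \<exists>u. (u, w) \<in> cox_rel T m \<and> length u = n", OF this] show ?thesis
    using that unfolding len_def by blast
qed

lemma len_mono:
  assumes "(u, w) \<in> cox_rel T m"
  shows "len T m w \<le> len T m u"
proof -
  have "u \<in> lists T" using cox_rel_lists[OF assms] ..
  then obtain u' where u': "(u', u) \<in> cox_rel T m" "length u' = len T m u" by (rule reduced_exists)
  show ?thesis using len_le[OF cox_rel.trans[OF u'(1) assms]] u'(2) by simp
qed

lemma len_cong: "(u, w) \<in> cox_rel T m \<Longrightarrow> len T m u = len T m w"
  by (rule antisym) (rule len_mono[OF cox_rel.sym], assumption, rule len_mono)

lemma len_append:
  assumes "v \<in> lists T" "a \<in> lists T"
  shows "len T m (v @ a) \<le> len T m v + length a"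
proof -
  obtain v' where v': "(v', v) \<in> cox_rel T m" "length v' = len T m v" using assms(1) by (rule reduced_exists)
  have "(v' @ a, v @ a) \<in> cox_rel T m" by (rule cox_rel_append[OF v'(1) cox_rel.refl[OF assms(2)]])
  from len_le[OF this] v'(2) show ?thesis by simp
qed

subsection \<open>Alternating words\<close>

text \<open>The alternating word of length k that ends in x, grown on the left: in a left action the
  leftmost letter acts last, so each new letter applies one more reflection.\<close>

primrec alt :: "'v \<Rightarrow> 'v \<Rightarrow> nat \<Rightarrow> 'v list" where
  "alt x y 0 = []"
| "alt x y (Suc k) = (if even k then x else y) # alt x y k"

lemma length_alt [simp]: "length (alt x y k) = k"
  by (induction k) auto

lemma set_alt: "set (alt x y k) \<subseteq> {x, y}"
  by (induction k) auto

lemma alt_snoc: "alt x y (Suc k) = alt y x k @ [x]"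
proof (induction k)
  case (Suc k)
  have "alt x y (Suc (Suc k)) = (if even (Suc k) then x else y) # alt x y (Suc k)" by simp
  then show ?case unfolding Suc.IH by simp
qed simp

lemma alt_split: "\<exists>P. length P = i \<and> set P \<subseteq> {x, y} \<and> alt x y (i + j) = P @ alt x y j"
proof (induction i)
  case (Suc i)
  then obtain P where "length P = i" "set P \<subseteq> {x, y}" "alt x y (i + j) = P @ alt x y j" by blast
  then show ?case by (intro exI[of _ "(if even (i + j) then x else y) # P"]) auto
qed simp

lemma concat_replicate_alt: "concat (replicate k [y, x]) = alt x y (2 * k)"
  by (induction k) auto

lemma alt_cases:
  assumes "a \<in> lists {x, y}"
  shows "a = alt x y (length a) \<or> a = alt y x (length a) \<or> (\<exists>a1 z a2. a = a1 @ [z, z] @ a2)"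
  using assms
proof (induction a rule: list.induct)
  case (Cons b a)
  have bad: "\<exists>a1 z a2. b # a = a1 @ [z, z] @ a2" if "\<exists>a1 z a2. a = a1 @ [z, z] @ a2"
    using that by (metis append_Cons)
  have step: "b # a = alt p q (Suc (length a)) \<or> b # a = alt q p (Suc (length a)) \<or>
      (\<exists>a1 z a2. b # a = a1 @ [z, z] @ a2)"
    if a: "a = alt p q (length a)" and b: "b = p \<or> b = q" for p q
  proof (cases "length a")
    case 0
    then show ?thesis using b by auto
  next
    case (Suc k)
    then have ae: "a = (if even k then p else q) # alt p q k" using a by simp
    show ?thesis
    proof (cases "b = (if even k then p else q)")
      case True
      then have "b # a = [] @ [b, b] @ alt p q k" using ae by simp
      then show ?thesis by blast
    next
      case False
      then have "b = (if even (Suc k) then p else q)" using b by auto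
      then have "b # a = alt p q (Suc (Suc k))" using ae by simp
      then show ?thesis using Suc by simp
    qed
  qed
  have "b \<in> {x, y}" using Cons.prems unfolding Cons_in_lists_iff by blast
  then have b: "b = x \<or> b = y" "b = y \<or> b = x" by blast+
  have "a = alt x y (length a) \<or> a = alt y x (length a) \<or> (\<exists>a1 z a2. a = a1 @ [z, z] @ a2)"
    using Cons by auto
  then show ?case using bad step[of x y] step[of y x] b by (simp only: length_Cons) blast
qed simp

section \<open>The geometric representation\<close>

lemma sin_recurrence: "sin (a + 2 * t) = 2 * cos t * sin (a + t) - sin a" for t :: real
proof -
  have e: "(a + 2 * t + a) / 2 = a + t" "(a + 2 * t - a) / 2 = t" by simp_all
  show ?thesis using sin_plus_sin[of "a + 2 * t" a, unfolded e] by (simp add: algebra_simps)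
qed

locale coxeter =
  fixes S :: "'v set" and m :: "'v \<Rightarrow> 'v \<Rightarrow> enat"
  assumes finite_S: "finite S" and coxeter_matrix: "is_coxeter_matrix S m"
begin

lemma m_sym: "s \<in> S \<Longrightarrow> t \<in> S \<Longrightarrow> m s t = m t s"
  and m_diag: "s \<in> S \<Longrightarrow> m s s = 1"
  and m_ge2: "s \<in> S \<Longrightarrow> t \<in> S \<Longrightarrow> s \<noteq> t \<Longrightarrow> m s t \<ge> 2"
  using coxeter_matrix by (auto simp: is_coxeter_matrix_def)

text \<open>Twice the Tits form on simple roots, which removes the factor 2 from the formula for
  reflections.\<close>

definition kf :: "'v \<Rightarrow> 'v \<Rightarrow> real" where
  "kf s t = (if s = t then 2 else case m s t of enat k \<Rightarrow> - 2 * cos (pi / real k) | \<infinity> \<Rightarrow> - 2)"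

definition pr :: "'v \<Rightarrow> ('v \<Rightarrow> real) \<Rightarrow> real" where
  "pr s v = (\<Sum>t\<in>S. kf s t * v t)"

definition root :: "'v \<Rightarrow> 'v \<Rightarrow> real" where
  "root s = (\<lambda>x. if x = s then 1 else 0)"

definition rfl :: "'v \<Rightarrow> ('v \<Rightarrow> real) \<Rightarrow> 'v \<Rightarrow> real" where
  "rfl s v = (\<lambda>x. v x - pr s v * root s x)"

definition actw :: "'v list \<Rightarrow> ('v \<Rightarrow> real) \<Rightarrow> 'v \<Rightarrow> real" where
  "actw w v = foldr rfl w v"

lemma actw_simps [simp]: "actw [] v = v" "actw (s # w) v = rfl s (actw w v)"
  by (simp_all add: actw_def)

lemma actw_append: "actw (u @ w) v = actw u (actw w v)"
  by (simp add: actw_def)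

lemma kf_sym: "s \<in> S \<Longrightarrow> t \<in> S \<Longrightarrow> kf s t = kf t s"
  using m_sym by (auto simp: kf_def)

lemma kf_diag [simp]: "kf s s = 2"
  by (simp add: kf_def)

lemma m_enat_ge2: "s \<in> S \<Longrightarrow> t \<in> S \<Longrightarrow> s \<noteq> t \<Longrightarrow> m s t = enat k \<Longrightarrow> k \<ge> 2"
  using m_ge2[of s t] by (simp add: numeral_eq_enat)

lemma kf_le0:
  assumes "s \<in> S" "t \<in> S" "s \<noteq> t"
  shows "kf s t \<le> 0"
proof (cases "m s t")
  case (enat k)
  then have "k \<ge> 2" using m_enat_ge2 assms by blast
  then have "pi / real k \<le> pi / 2" by (intro divide_left_mono) auto
  then have "cos (pi / real k) \<ge> 0" by (intro cos_ge_zero) (auto intro: order_trans[of _ 0])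
  then show ?thesis using assms(3) enat by (simp add: kf_def)
qed (use assms in \<open>simp add: kf_def\<close>)

lemma pr_lin: "pr s (\<lambda>x. a * u x + b * v x) = a * pr s u + b * pr s v"
  by (simp add: pr_def sum.distrib sum_distrib_left algebra_simps)

lemma pr_root: "t \<in> S \<Longrightarrow> pr s (root t) = kf s t"
  unfolding pr_def root_def by (simp add: finite_S if_distrib cong: if_cong)

lemma rfl_lin: "rfl s (\<lambda>x. a * u x + b * v x) = (\<lambda>x. a * rfl s u x + b * rfl s v x)"
  by (rule ext) (simp add: rfl_def pr_lin algebra_simps)

lemma pr_rfl: "t \<in> S \<Longrightarrow> pr s (rfl t v) = pr s v - pr t v * kf s t"
  using pr_lin[of s 1 v "- pr t v" "root t"] pr_root[of t s] by (simp add: rfl_def)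

lemma rfl_rfl: "s \<in> S \<Longrightarrow> rfl s (rfl s v) = v"
  by (rule ext) (simp add: rfl_def[of s "rfl s v"] pr_rfl, simp add: rfl_def)

lemma actw_lin: "actw w (\<lambda>x. a * u x + b * v x) = (\<lambda>x. a * actw w u x + b * actw w v x)"
  by (induction w) (simp_all add: rfl_lin)

lemma actw_neg: "actw w (\<lambda>x. - u x) = (\<lambda>x. - actw w u x)"
  using actw_lin[of w "-1" u 0 u] by simp

lemma actw_zero: "actw w (\<lambda>x. 0) = (\<lambda>x. 0)"
  using actw_lin[of w 0 "\<lambda>x. 0" 0 "\<lambda>x. 0"] by simp

lemma rfl_root: "s \<in> S \<Longrightarrow> rfl s (root s) = (\<lambda>x. - root s x)"
  by (rule ext) (simp add: rfl_def pr_root)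

lemma rfl_combo:
  assumes "s \<in> S" "t \<in> S"
  shows "rfl s (\<lambda>x. a * root s x + b * root t x) = (\<lambda>x. (- a - kf s t * b) * root s x + b * root t x)"
  by (rule ext) (simp add: rfl_def pr_lin pr_root assms algebra_simps)

lemma rfl_combo':
  assumes "s \<in> S" "t \<in> S"
  shows "rfl t (\<lambda>x. a * root s x + b * root t x) = (\<lambda>x. a * root s x + (- b - kf s t * a) * root t x)"
  by (rule ext) (simp add: rfl_def pr_lin pr_root assms kf_sym[of t s] algebra_simps)

text \<open>Split v into a part fixed by s and t and a combination of their two roots. On the plane
  of the roots the powers of s t have Chebyshev coefficients sin (x \<theta>) / sin \<theta> with
  \<theta> = pi / k, and these return to their initial values after k steps.\<close>

lemma dihedral_order:
  assumes st: "s \<in> S" "t \<in> S" "s \<noteq> t" and m: "m s t = enat k"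
  shows "actw (concat (replicate k [s, t])) v = v"
proof -
  define \<theta> where "\<theta> = pi / real k"
  have k: "k \<ge> 2" using m_enat_ge2[OF st m] .
  have th: "0 < \<theta>" "\<theta> < pi" using k by (auto simp: \<theta>_def field_simps)
  have sn: "sin \<theta> > 0" using th by (rule sin_gt_zero)
  define c where "c = 2 * cos \<theta>"
  have kf: "kf s t = - c" using st m by (simp add: kf_def c_def \<theta>_def)
  have c2: "4 - c\<^sup>2 \<noteq> 0"
  proof -
    have "4 - c\<^sup>2 = 4 * (sin \<theta>)\<^sup>2" by (simp add: c_def power_mult_distrib sin_squared_eq algebra_simps)
    then show ?thesis using sn by simp
  qed
  \<comment> \<open>The coefficients p and q solve the 2 by 2 Gram system of the two roots, so that
    v' pairs to zero with both. Its determinant 4 - c^2 is 4 sin^2 \<theta>, which is nonzero as k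
    is finite.\<close>
  define p where "p = (2 * pr s v + c * pr t v) / (4 - c\<^sup>2)"
  define q where "q = (c * pr s v + 2 * pr t v) / (4 - c\<^sup>2)"
  have pq: "2 * p - c * q = pr s v" "2 * q - c * p = pr t v"
  proof -
    have "2 * p - c * q = pr s v * (4 - c\<^sup>2) / (4 - c\<^sup>2)" "2 * q - c * p = pr t v * (4 - c\<^sup>2) / (4 - c\<^sup>2)"
      unfolding p_def q_def times_divide_eq_right diff_divide_distrib[symmetric]
      by (simp_all add: algebra_simps power2_eq_square)
    then show "2 * p - c * q = pr s v" "2 * q - c * p = pr t v" using c2 by simp_all
  qed
  define v' where "v' = (\<lambda>x. v x - (p * root s x + q * root t x))"
  have v: "v = (\<lambda>x. 1 * v' x + 1 * (p * root s x + q * root t x))" by (simp add: v'_def)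
  have pv': "pr r v' = pr r v - (p * kf r s + q * kf r t)" for r
  proof -
    have e: "v' = (\<lambda>x. 1 * v x + (-1) * (p * root s x + q * root t x))"
      by (rule ext) (simp add: v'_def)
    show ?thesis unfolding e pr_lin using pr_root[OF st(1), of r] pr_root[OF st(2), of r] by simp
  qed
  have "pr s v' = 0" "pr t v' = 0" using pq st kf kf_sym[of t s] by (simp_all add: pv' algebra_simps)
  then have fix_s: "rfl s v' = v'" and fix_t: "rfl t v' = v'" by (simp_all add: rfl_def)
  define U where "U x = sin (x * \<theta>) / sin \<theta>" for x :: real
  have U_rec: "U (x + 2) = c * U (x + 1) - U x" for x
  proof -
    have "sin ((x + 2) * \<theta>) = c * sin ((x + 1) * \<theta>) - sin (x * \<theta>)"
      using sin_recurrence[of "x * \<theta>" \<theta>] by (simp add: c_def algebra_simps)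
    then show ?thesis by (simp add: U_def diff_divide_distrib)
  qed
  have step: "rfl s (rfl t (\<lambda>x. 1 * v' x + 1 * (a * root s x + b * root t x))) =
      (\<lambda>x. 1 * v' x + 1 * ((- a + c * (- b + c * a)) * root s x + (- b + c * a) * root t x))" for a b
  proof -
    have 1: "rfl t (\<lambda>x. 1 * v' x + 1 * (a * root s x + b * root t x)) =
        (\<lambda>x. 1 * v' x + 1 * (a * root s x + (- b - kf s t * a) * root t x))"
      unfolding rfl_lin[of t 1 v' 1 "\<lambda>x. a * root s x + b * root t x"] fix_t rfl_combo'[OF st(1,2)] ..
    have 2: "rfl s (\<lambda>x. 1 * v' x + 1 * (a * root s x + b' * root t x)) =
        (\<lambda>x. 1 * v' x + 1 * ((- a - kf s t * b') * root s x + b' * root t x))" for b'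
      unfolding rfl_lin[of s 1 v' 1 "\<lambda>x. a * root s x + b' * root t x"] fix_s rfl_combo[OF st(1,2)] ..
    show ?thesis unfolding 1 2 by (simp add: kf)
  qed
  have iter: "actw (concat (replicate j [s, t])) v =
     (\<lambda>x. 1 * v' x + 1 * ((p * U (2 * real j + 1) - q * U (2 * real j)) * root s x +
       (p * U (2 * real j) - q * U (2 * real j - 1)) * root t x))"
    for j :: nat
  proof (induction j)
    case 0
    have "U 1 = 1" "U (- 1) = - 1" "U 0 = 0" using sn by (simp_all add: U_def)
    then show ?case using v by simp
  next
    case (Suc j)
    define y where "y = 2 * real j"
    have r: "U (y + 2) = c * U (y + 1) - U y" "U (y + 1) = c * U y - U (y - 1)"
        "U (y + 3) = c * U (y + 2) - U (y + 1)"
    proof -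
      have i: "y - 1 + 2 = y + 1" "y - 1 + 1 = y" "y + 1 + 2 = y + 3" "y + 1 + 1 = y + 2" by simp_all
      show "U (y + 2) = c * U (y + 1) - U y" by (rule U_rec)
      show "U (y + 1) = c * U y - U (y - 1)" using U_rec[of "y - 1"] unfolding i .
      show "U (y + 3) = c * U (y + 2) - U (y + 1)" using U_rec[of "y + 1"] unfolding i .
    qed
    have b: "- (p * U y - q * U (y - 1)) + c * (p * U (y + 1) - q * U y) =
        p * U (y + 2) - q * U (y + 1)"
      using r(1,2) by algebra
    have a: "- (p * U (y + 1) - q * U y) + c * (p * U (y + 2) - q * U (y + 1)) =
        p * U (y + 3) - q * U (y + 2)"
      using r(1,3) by algebra
    have idx: "2 * real (Suc j) = y + 2" "y + 2 + 1 = y + 3" "y + 2 - 1 = y + 1"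
      by (simp_all add: y_def)
    have "actw (concat (replicate (Suc j) [s, t])) v = rfl s (rfl t (actw (concat (replicate j [s, t])) v))"
      by simp
    also have "\<dots> = (\<lambda>x. 1 * v' x + 1 * ((p * U (y + 3) - q * U (y + 2)) * root s x +
        (p * U (y + 2) - q * U (y + 1)) * root t x))"
      unfolding Suc y_def[symmetric] step b a ..
    finally show ?case unfolding idx .
  qed
  have kth: "real k * \<theta> = pi" using k by (simp add: \<theta>_def)
  have a1: "(2 * real k) * \<theta> = 2 * pi" unfolding mult.assoc kth ..
  have a2: "(2 * real k + 1) * \<theta> = \<theta> + 2 * pi" unfolding distrib_right mult.assoc kth by simp
  have a3: "(2 * real k - 1) * \<theta> = - \<theta> + 2 * pi" unfolding left_diff_distrib mult.assoc kth by simp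
  have "U (2 * real k) = 0" unfolding U_def a1 by simp
  moreover have "U (2 * real k + 1) = 1" unfolding U_def a2 sin_periodic using sn by simp
  moreover have "U (2 * real k - 1) = - 1" unfolding U_def a3 sin_periodic using sn by simp
  ultimately have "actw (concat (replicate k [s, t])) v = (\<lambda>x. 1 * v' x + 1 * (p * root s x + q * root t x))"
    unfolding iter by simp
  then show ?thesis using v by simp
qed

lemma actw_cox_rel: "(u, w) \<in> cox_rel T m \<Longrightarrow> T \<subseteq> S \<Longrightarrow> actw u = actw w"
proof (induction rule: cox_rel.induct)
  case (relator u v s t k)
  have st: "s \<in> S" "t \<in> S" using relator.hyps(3,4) relator.prems by blast+
  have "actw (concat (replicate k [s, t])) x = x" for x
  proof (cases "s = t")
    case True
    then have "k = 1" using m_diag[OF st(1)] relator.hyps(5) by (simp add: one_enat_def)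
    then show ?thesis using True rfl_rfl[OF st(1), of x] by simp
  next
    case False
    show ?thesis by (rule dihedral_order[OF st False relator.hyps(5)])
  qed
  then show ?case by (intro ext) (simp only: actw_append)
next
  case (trans u v w)
  then show ?case by simp
qed simp_all

section \<open>Positive and negative roots\<close>

definition pos :: "('v \<Rightarrow> real) \<Rightarrow> bool" where
  "pos v \<longleftrightarrow> (\<forall>x. v x \<ge> 0)"

definition neg :: "('v \<Rightarrow> real) \<Rightarrow> bool" where
  "neg v \<longleftrightarrow> (\<forall>x. v x \<le> 0)"

text \<open>The coefficients are neighbouring values of a solution of U (j + 2) = c U (j + 1) - U j,
  namely sin (j \<theta>) / sin \<theta>, or j itself for an infinite label. They stay nonnegative
  for j up to m s t, and k < m s t keeps the larger index k + 1 in this range.\<close>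

lemma dihedral_positive:
  assumes st: "s \<in> S" "t \<in> S" "s \<noteq> t" and k: "\<And>j. m s t = enat j \<Longrightarrow> k < j"
  shows "\<exists>a b. a \<ge> 0 \<and> b \<ge> 0 \<and> actw (alt t s k) (root s) = (\<lambda>x. a * root s x + b * root t x)"
proof -
  define c where "c = - kf s t"
  have "\<exists>U :: nat \<Rightarrow> real. U 0 = 0 \<and> U 1 = 1 \<and> (\<forall>j. U (Suc (Suc j)) = c * U (Suc j) - U j) \<and> (\<forall>j \<le> Suc k. U j \<ge> 0)"
  proof (cases "m s t")
    case (enat l)
    then have l: "l \<ge> 2" "k < l" using m_enat_ge2[OF st] k by auto
    define \<theta> where "\<theta> = pi / real l"
    have th: "0 < \<theta>" "\<theta> < pi" using l by (auto simp: \<theta>_def field_simps)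
    have sn: "sin \<theta> > 0" using th by (rule sin_gt_zero)
    have ceq: "c = 2 * cos \<theta>" using enat st by (simp add: c_def kf_def \<theta>_def)
    define U where "U j = sin (real j * \<theta>) / sin \<theta>" for j :: nat
    have "U (Suc (Suc j)) = c * U (Suc j) - U j" for j
    proof -
      have "sin (real (Suc (Suc j)) * \<theta>) = c * sin (real (Suc j) * \<theta>) - sin (real j * \<theta>)"
        using sin_recurrence[of "real j * \<theta>" \<theta>] by (simp add: ceq algebra_simps)
      then show ?thesis by (simp add: U_def diff_divide_distrib)
    qed
    moreover have "U j \<ge> 0" if "j \<le> Suc k" for j
    proof -
      have "real j \<le> real l" using that l by simp
      then have "real j * \<theta> \<le> pi" using l by (simp add: \<theta>_def field_simps)
      then show ?thesis using sn th by (simp add: U_def sin_ge_zero)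
    qed
    moreover have "U 0 = 0" "U 1 = 1" using sn by (simp_all add: U_def)
    ultimately show ?thesis by blast
  next
    case infinity
    then have "c = 2" using st by (simp add: c_def kf_def)
    then show ?thesis by (intro exI[of _ real]) auto
  qed
  then obtain U :: "nat \<Rightarrow> real" where U: "U 0 = 0" "U 1 = 1" "\<And>j. U (Suc (Suc j)) = c * U (Suc j) - U j"
      "\<And>j. j \<le> Suc k \<Longrightarrow> U j \<ge> 0" by blast
  have "actw (alt t s j) (root s) = (if even j then (\<lambda>x. U (Suc j) * root s x + U j * root t x)
      else (\<lambda>x. U j * root s x + U (Suc j) * root t x))" for j
  proof (induction j)
    case 0
    then show ?case using U(1,2) by simp
  next
    case (Suc j)
    have kf: "kf s t = - c" by (simp add: c_def)
    have e: "- U j - - c * U (Suc j) = U (Suc (Suc j))" by (simp add: U(3))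
    show ?case
    proof (cases "even j")
      case True
      then have "actw (alt t s (Suc j)) (root s) = rfl t (\<lambda>x. U (Suc j) * root s x + U j * root t x)"
        by (simp add: Suc.IH)
      then show ?thesis unfolding rfl_combo'[OF st(1,2)] kf e using True by simp
    next
      case False
      then have "actw (alt t s (Suc j)) (root s) = rfl s (\<lambda>x. U j * root s x + U (Suc j) * root t x)"
        by (simp add: Suc.IH)
      then show ?thesis unfolding rfl_combo[OF st(1,2)] kf e using False by simp
    qed
  qed
  from this[of k] U(4)[of k] U(4)[of "Suc k"] show ?thesis by (cases "even k") auto
qed

end

section \<open>The group of bijections of a type\<close>

text \<open>The chain constructions need a type of class \<open>group_add\<close>. All bijections of
  the representation space form one; the groups W_n become subsets of it, and their inclusions are
  literal.\<close>

typedef 'a bijn = "{f :: 'a \<Rightarrow> 'a. bij f}" morphisms ap Bijn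
  by (rule exI[of _ id]) simp

lemma bij_ap: "bij (ap f)"
  using ap by blast

lemma bijn_eqI: "(\<And>v. ap f v = ap g v) \<Longrightarrow> f = g"
  by (rule ap_inject[THEN iffD1]) (rule ext)

lemma ap_Bijn: "bij f \<Longrightarrow> ap (Bijn f) = f"
  by (rule Bijn_inverse) simp

instantiation bijn :: (type) group_add
begin

definition "0 = Bijn id"
definition "f + g = Bijn (ap f \<circ> ap g)"
definition "- f = Bijn (inv_into UNIV (ap f))"
definition "(f :: 'a bijn) - g = f + - g"

lemma ap_0: "ap 0 = id"
  by (simp add: zero_bijn_def ap_Bijn)

lemma ap_plus: "ap (f + g) = ap f \<circ> ap g"
  by (simp add: plus_bijn_def ap_Bijn bij_ap bij_comp)

lemma ap_uminus: "ap (- f) = inv_into UNIV (ap f)"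
  by (simp add: uminus_bijn_def ap_Bijn bij_ap bij_imp_bij_inv)

instance
proof
  fix a b c :: "'a bijn"
  show "a + b + c = a + (b + c)" "0 + a = a" "a + 0 = a"
    by (rule bijn_eqI, simp add: ap_plus ap_0)+
  show "- a + a = 0"
    by (rule bijn_eqI) (simp add: ap_plus ap_0 ap_uminus bij_is_inj[OF bij_ap])
  show "a + - b = a - b" by (simp only: minus_bijn_def)
qed

end

section \<open>Lengths against signs of roots, and faithfulness\<close>

context coxeter
begin

lemma rel_cancel:
  assumes "T \<subseteq> S" "s \<in> T" "u \<in> lists T" "v \<in> lists T"
  shows "(u @ [s, s] @ v, u @ v) \<in> cox_rel T m"
proof -
  have "m s s = enat 1" using m_diag assms(1,2) by (auto simp: one_enat_def)
  from cox_rel.relator[of u T v s s m 1, OF assms(3,4,2,2) this] show ?thesis by simp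
qed

lemma rel_rev:
  assumes "T \<subseteq> S" "w \<in> lists T"
  shows "(rev w @ w, []) \<in> cox_rel T m"
  using assms(2)
proof (induction w rule: list.induct)
  case (Cons a w)
  have "(rev w @ [a, a] @ w, rev w @ w) \<in> cox_rel T m"
    by (rule rel_cancel[OF assms(1)]) (use Cons.prems in auto)
  moreover have "(rev w @ w, []) \<in> cox_rel T m" using Cons by auto
  ultimately have "(rev w @ [a, a] @ w, []) \<in> cox_rel T m" by (rule cox_rel.trans)
  then show ?case by simp
qed (auto intro: cox_rel.refl)

text \<open>The last k + 1 letters are the tail of the relator of length 2 k, so they equal the
  inverse of its first k - 1 letters; this saves two letters.\<close>

lemma alt_shorten:
  assumes T: "T \<subseteq> S" and st: "s \<in> T" "t \<in> T" "s \<noteq> t" and m: "m s t = enat k" and j: "k < j"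
  shows "\<exists>a \<in> lists T. length a + 2 = j \<and> (alt s t j, a) \<in> cox_rel T m"
proof -
  have stS: "s \<in> S" "t \<in> S" using T st by auto
  have k: "k \<ge> 2" using m_enat_ge2[OF stS st(3) m] .
  obtain P where P: "length P = j - Suc k" "set P \<subseteq> {s, t}" "alt s t (j - Suc k + Suc k) = P @ alt s t (Suc k)"
    using alt_split[of "j - Suc k" s t "Suc k"] by blast
  obtain Q where Q: "length Q = k - 1" "set Q \<subseteq> {s, t}" "alt s t (k - 1 + Suc k) = Q @ alt s t (Suc k)"
    using alt_split[of "k - 1" s t "Suc k"] by blast
  have j': "j - Suc k + Suc k = j" and k': "k - 1 + Suc k = 2 * k" using j k by auto
  have lists: "P \<in> lists T" "Q \<in> lists T" "alt s t (Suc k) \<in> lists T"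
    using P(2) Q(2) set_alt[of s t "Suc k"] st by (auto simp: in_lists_conv_set)
  have m': "m t s = enat k" using m m_sym[OF stS] by simp
  have "([] @ concat (replicate k [t, s]) @ [], [] @ []) \<in> cox_rel T m"
    by (rule cox_rel.relator) (use st m' in auto)
  then have "(concat (replicate k [t, s]), []) \<in> cox_rel T m" by (simp only: append_Nil append_Nil2)
  moreover have "concat (replicate k [t, s]) = Q @ alt s t (Suc k)"
    unfolding concat_replicate_alt k'[symmetric] by (rule Q(3))
  ultimately have 0: "(Q @ alt s t (Suc k), []) \<in> cox_rel T m" by (simp only:)
  have rQ: "rev Q \<in> lists T" using lists(2) by (auto simp: in_lists_conv_set)
  have 1: "(rev Q @ Q @ alt s t (Suc k), rev Q) \<in> cox_rel T m"
    using cox_rel_append[OF cox_rel.refl[OF rQ] 0] by (simp only: append_Nil2)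
  have 2: "(rev Q @ Q @ alt s t (Suc k), alt s t (Suc k)) \<in> cox_rel T m"
    using cox_rel_append[OF rel_rev[OF T lists(2)] cox_rel.refl[OF lists(3)]]
    by (simp only: append_Nil append_assoc)
  have "(alt s t (Suc k), rev Q) \<in> cox_rel T m" by (rule cox_rel.trans[OF cox_rel.sym[OF 2] 1])
  from cox_rel_append[OF cox_rel.refl[OF lists(1)] this] have "(alt s t j, P @ rev Q) \<in> cox_rel T m"
    unfolding P(3)[unfolded j'] .
  moreover have "P @ rev Q \<in> lists T" using lists by auto
  moreover have "length (P @ rev Q) + 2 = j" using P(1) Q(1) j k by simp
  ultimately show ?thesis by blast
qed

text \<open>The fundamental theorem on the geometric representation, by induction on the length of \<open>w\<close>:
  split off the longest possible suffix in the dihedral group generated by \<open>s\<close> and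
  the last letter of a reduced word for \<open>w\<close>.\<close>

theorem root_pos:
  assumes T: "T \<subseteq> S" and "w \<in> lists T" "s \<in> T" "len T m w \<le> len T m (w @ [s])"
  shows "pos (actw w (root s))"
  using assms(2-4)
proof (induction "len T m w" arbitrary: w s rule: less_induct)
  case (less w s)
  let ?l = "len T m" and ?R = "cox_rel T m"
  have w: "w \<in> lists T" and s: "s \<in> T" by (rule less.prems)+
  have s1: "[s] \<in> lists T" using s by simp
  obtain u where u: "(u, w) \<in> ?R" "length u = ?l w" using w by (rule reduced_exists)
  have uT: "u \<in> lists T" using cox_rel_lists[OF u(1)] ..
  show ?case
  proof (cases u rule: rev_cases)
    case Nil
    then have "actw w = actw []" using actw_cox_rel[OF u(1) T] by simp
    then show ?thesis by (auto simp: pos_def root_def)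
  next
    case (snoc u1 t)
    have u1: "u1 \<in> lists T" and t: "t \<in> T" using uT snoc by auto
    have lu1: "?l w = Suc (length u1)" using u(2) snoc by simp
    have ws: "(w @ [s], x @ [s]) \<in> ?R" if "(x, w) \<in> ?R" for x
      by (rule cox_rel_append[OF cox_rel.sym[OF that] cox_rel.refl[OF s1]])
    have shorter: False if "(x, w @ [s]) \<in> ?R" "length x < ?l w" for x
      using len_le[OF that(1)] that(2) less.prems(3) by simp
    have ts: "t \<noteq> s"
    proof
      assume "t = s"
      then have "(u1 @ [s, s] @ [], w @ [s]) \<in> ?R" using cox_rel.sym[OF ws[OF u(1)]] snoc by simp
      then have "(u1, w @ [s]) \<in> ?R"
        using cox_rel.trans[OF cox_rel.sym[OF rel_cancel[OF T s u1, of "[]"]]] by simp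
      then show False using shorter[of u1] lu1 by simp
    qed
    \<comment> \<open>Factorisations w = v a with a over {s, t} and additive lengths, indexed by the
      length of v. The factorisation given by the reduced word u1 t ensures that the shortest
      possible v is shorter than w, so the induction hypothesis covers it.\<close>
    define Q where "Q n \<longleftrightarrow> (\<exists>v a. v \<in> lists T \<and> a \<in> lists {s, t} \<and> (v @ a, w) \<in> ?R \<and>
      ?l v + length a = ?l w \<and> n = ?l v)" for n
    have stT: "a \<in> lists T" if "a \<in> lists {s, t}" for a
      using that s t by (auto simp: in_lists_conv_set)
    have lw: "?l w \<le> ?l v + length a" if "v \<in> lists T" "a \<in> lists {s, t}" "(v @ a, w) \<in> ?R" for v a
      using len_append[OF that(1) stT[OF that(2)]] len_cong[OF that(3)] by metis
    have "Q (?l u1)"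
      unfolding Q_def
    proof (intro exI conjI)
      show "(u1 @ [t], w) \<in> ?R" using u(1) snoc by simp
      then have "?l w \<le> ?l u1 + 1" using lw[of u1 "[t]"] u1 by simp
      then show "?l u1 + length [t] = ?l w" using len_le_length[OF u1, of m] lu1 by simp
    qed (use u1 in auto)
    define n0 where "n0 = (LEAST n. Q n)"
    have Q0: "Q n0" unfolding n0_def using \<open>Q (?l u1)\<close> by (rule LeastI)
    have n0: "n0 \<le> n" if "Q n" for n unfolding n0_def using that by (rule Least_le)
    from Q0 obtain v a where v: "v \<in> lists T" and a: "a \<in> lists {s, t}" and va: "(v @ a, w) \<in> ?R"
        and lva: "?l v + length a = ?l w" and lv: "n0 = ?l v"
      unfolding Q_def by blast
    have vw: "?l v < ?l w" using n0[OF \<open>Q (?l u1)\<close>] lv len_le_length[OF u1, of m] lu1 by simp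
    \<comment> \<open>A letter s or t that shortens v could be moved into a, against the minimality
      of v. So v sends both roots to positive vectors.\<close>
    have asc: "?l v \<le> ?l (v @ [x])" if x: "x = s \<or> x = t" for x
    proof (rule ccontr)
      assume c: "\<not> ?l v \<le> ?l (v @ [x])"
      have xT: "x \<in> T" "v @ [x] \<in> lists T" using x s t v by auto
      have xa: "x # a \<in> lists {s, t}" using x a by auto
      have "(v @ [x, x] @ a, v @ a) \<in> ?R" by (rule rel_cancel[OF T xT(1) v stT[OF a]])
      from cox_rel.trans[OF this va] have r: "((v @ [x]) @ (x # a), w) \<in> ?R" by simp
      have "?l w \<le> ?l (v @ [x]) + length (x # a)" by (rule lw[OF xT(2) xa r])
      then have "?l (v @ [x]) + length (x # a) = ?l w" using c lva by simp
      then have "Q (?l (v @ [x]))" unfolding Q_def using xT xa r by blast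
      from n0[OF this] show False using lv c by simp
    qed
    have pos_s: "pos (actw v (root s))" and pos_t: "pos (actw v (root t))"
      using less.hyps[OF vw v s] less.hyps[OF vw v t] asc by auto
    have no_rep: False if "a = a1 @ [z, z] @ a2" for a1 z a2
    proof -
      have z: "z \<in> T" "a1 \<in> lists T" "a2 \<in> lists T" "a1 @ a2 \<in> lists {s, t}"
        using that a stT by (auto simp: in_lists_conv_set s t)
      have "((v @ a1) @ [z, z] @ a2, (v @ a1) @ a2) \<in> ?R"
        by (rule rel_cancel[OF T z(1)]) (use v z in auto)
      from cox_rel.trans[OF cox_rel.sym[OF this]] have "(v @ (a1 @ a2), w) \<in> ?R" using va that by simp
      from lw[OF v z(4) this] show False using lva that by simp
    qed
    \<comment> \<open>Being reduced, a alternates. It cannot end in s, since w s is not shorter than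
      w; so a nonempty a ends in t, as \<open>alt t s\<close> does.\<close>
    have a_alt: "a = alt t s (length a)"
    proof (rule ccontr)
      assume na: "a \<noteq> alt t s (length a)"
      have "a \<in> lists {t, s}" using a by (simp add: insert_commute)
      then have "a = alt s t (length a)" using alt_cases[of a t s] na no_rep by blast
      moreover from this na obtain j where j: "length a = Suc j" by (cases "length a") auto
      ultimately have ae: "a = alt t s j @ [s]" using alt_snoc by metis
      have alT: "alt t s j \<in> lists T" using set_alt[of t s j] s t by (auto simp: in_lists_conv_set)
      have "((v @ alt t s j) @ [s, s] @ [], (v @ alt t s j) @ []) \<in> ?R"
        by (rule rel_cancel[OF T s]) (use v alT in auto)
      from cox_rel.trans[OF cox_rel.sym[OF this]] have r: "(v @ alt t s j, w @ [s]) \<in> ?R"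
        using cox_rel.sym[OF ws[OF va]] ae by simp
      have "?l (w @ [s]) \<le> ?l v + j" using len_append[OF v alT, of m] len_cong[OF r] by simp
      then show False using less.prems(3) lva j by simp
    qed
    \<comment> \<open>Otherwise a s is an alternating word longer than m s t and can be shortened by
      two letters, which would make w s shorter than w.\<close>
    have bound: "length a < k" if mk: "m s t = enat k" for k
    proof (rule ccontr)
      assume "\<not> length a < k"
      then have "k < Suc (length a)" by simp
      from alt_shorten[OF T s t ts[symmetric] mk this] obtain a' where
        a': "a' \<in> lists T" "length a' + 2 = Suc (length a)" "(alt s t (Suc (length a)), a') \<in> ?R" by blast
      have "a @ [s] = alt s t (Suc (length a))" unfolding alt_snoc by (simp only: a_alt[symmetric])
      then have "(v @ (a @ [s]), v @ a') \<in> ?R"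
        using cox_rel_append[OF cox_rel.refl[OF v] a'(3)] by simp
      then have r: "(w @ [s], v @ a') \<in> ?R" using cox_rel.trans[OF ws[OF va]] by simp
      have "?l (w @ [s]) \<le> ?l v + length a'" using len_append[OF v a'(1), of m] len_cong[OF r] by simp
      then show False using less.prems(3) lva a'(2) by simp
    qed
    have "s \<in> S" "t \<in> S" using T s t by auto
    from dihedral_positive[OF this ts[symmetric] bound] obtain p q where
      pq: "p \<ge> 0" "q \<ge> 0" "actw (alt t s (length a)) (root s) = (\<lambda>x. p * root s x + q * root t x)" by blast
    have "actw w (root s) = actw v (actw a (root s))"
      using actw_cox_rel[OF va T] by (simp flip: actw_append)
    also have "\<dots> = (\<lambda>x. p * actw v (root s) x + q * actw v (root t) x)"
      using pq(3) by (simp add: actw_lin a_alt[symmetric])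
    finally show ?thesis using pq(1,2) pos_s pos_t by (simp add: pos_def)
  qed
qed

lemma actw_snoc_root: "s \<in> S \<Longrightarrow> actw (w @ [s]) (root s) = (\<lambda>x. - actw w (root s) x)"
  by (simp add: actw_append rfl_root actw_neg)

text \<open>Exchange the roles of w and w s: the last reflection changes the sign of its own
  root.\<close>

lemma root_neg:
  assumes T: "T \<subseteq> S" and w: "w \<in> lists T" and s: "s \<in> T" and l: "len T m (w @ [s]) \<le> len T m w"
  shows "neg (actw w (root s))"
proof -
  have "(w @ [s, s] @ [], w @ []) \<in> cox_rel T m" by (rule rel_cancel[OF T s w]) simp
  from len_cong[OF this] have "len T m ((w @ [s]) @ [s]) = len T m w" by simp
  then have "pos (actw (w @ [s]) (root s))" using l by (intro root_pos[OF T]) (use w s in auto)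
  then show ?thesis using T s by (auto simp: actw_snoc_root pos_def neg_def)
qed

lemma root_dichotomy:
  assumes "T \<subseteq> S" "w \<in> lists T" "s \<in> T"
  shows "pos (actw w (root s)) \<or> neg (actw w (root s))"
  by (cases "len T m w \<le> len T m (w @ [s])") (simp_all add: root_pos[OF assms] root_neg[OF assms])

lemma actw_rev: "w \<in> lists S \<Longrightarrow> actw (rev w) (actw w v) = v"
  using fun_cong[OF actw_cox_rel[OF rel_rev[OF order_refl, of w] order_refl], of v]
  by (simp add: actw_append)

lemma actw_rev': "w \<in> lists S \<Longrightarrow> actw w (actw (rev w) v) = v"
  using actw_rev[of "rev w" v] by (auto simp: in_lists_conv_set)

lemma reduced_snoc_neg:
  assumes T: "T \<subseteq> S" and u: "u @ [t] \<in> lists T" and r: "length (u @ [t]) = len T m (u @ [t])"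
  shows "neg (actw (u @ [t]) (root t))"
proof -
  have uT: "u \<in> lists T" "t \<in> T" using u by auto
  have "len T m u \<le> len T m (u @ [t])" using len_le_length[OF uT(1), of m] r by simp
  then have "pos (actw u (root t))" by (rule root_pos[OF T uT])
  then show ?thesis using T uT by (auto simp: actw_snoc_root pos_def neg_def)
qed

text \<open>A nonempty reduced word sends the root of its last letter to a negative vector, which
  the identity does not do.\<close>

lemma faithful:
  assumes T: "T \<subseteq> S" and w: "w \<in> lists T" "actw w = actw []"
  shows "(w, []) \<in> cox_rel T m"
proof -
  obtain u where u: "(u, w) \<in> cox_rel T m" "length u = len T m w" using w(1) by (rule reduced_exists)
  show ?thesis
  proof (cases u rule: rev_cases)
    case Nil
    then show ?thesis using cox_rel.sym[OF u(1)] by simp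
  next
    case (snoc u1 t)
    have "u \<in> lists T" "length u = len T m u" using cox_rel_lists[OF u(1)] len_cong[OF u(1)] u(2) by auto
    then have "neg (actw u (root t))" using reduced_snoc_neg[OF T, of u1 t] snoc by simp
    moreover have "actw u (root t) = root t" using actw_cox_rel[OF u(1) T] w(2) by simp
    ultimately have "root t t \<le> 0" by (simp add: neg_def)
    then show ?thesis by (simp add: root_def)
  qed
qed

text \<open>T may be smaller than S: equality in the representation of S already yields relations
  over T. Hence W_T embeds in W_S.\<close>

lemma faithful_rel:
  assumes T: "T \<subseteq> S" and u: "u \<in> lists T" and w: "w \<in> lists T" and e: "actw u = actw w"
  shows "(u, w) \<in> cox_rel T m"
proof -
  have rT: "rev w \<in> lists T" using w by (auto simp: in_lists_conv_set)
  have wS: "w \<in> lists S" using w T by (auto simp: in_lists_conv_set)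
  have "actw (rev w @ u) = actw []" by (rule ext) (simp add: actw_append e actw_rev[OF wS])
  then have "(rev w @ u, []) \<in> cox_rel T m" by (intro faithful[OF T]) (use rT u in auto)
  from cox_rel_append[OF cox_rel.refl[OF w] this] have 1: "(w @ rev w @ u, w) \<in> cox_rel T m" by simp
  from cox_rel_append[OF rel_rev[OF T rT] cox_rel.refl[OF u]] have "(w @ rev w @ u, u) \<in> cox_rel T m" by simp
  from cox_rel.trans[OF cox_rel.sym[OF this] 1] show ?thesis .
qed

subsection \<open>The invariant form and the exchange condition\<close>

definition bf :: "('v \<Rightarrow> real) \<Rightarrow> ('v \<Rightarrow> real) \<Rightarrow> real" where
  "bf u v = (\<Sum>s\<in>S. u s * pr s v)"

lemma bf_sym: "bf u v = bf v u"
proof -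
  have "bf u v = (\<Sum>s\<in>S. \<Sum>t\<in>S. u s * (kf s t * v t))" by (simp add: bf_def pr_def sum_distrib_left)
  also have "\<dots> = (\<Sum>t\<in>S. \<Sum>s\<in>S. u s * (kf s t * v t))" by (rule sum.swap)
  also have "\<dots> = (\<Sum>t\<in>S. \<Sum>s\<in>S. v t * (kf t s * u s))"
    by (intro sum.cong) (auto simp: kf_sym)
  also have "\<dots> = bf v u" by (simp add: bf_def pr_def sum_distrib_left)
  finally show ?thesis .
qed

lemma bf_root: "s \<in> S \<Longrightarrow> bf (root s) v = pr s v"
  unfolding bf_def root_def by (simp add: finite_S if_distrib[of "\<lambda>a. a * _"] cong: if_cong)

lemma bf_lin: "bf u (\<lambda>x. a * v x + b * v' x) = a * bf u v + b * bf u v'"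
  by (simp add: bf_def pr_lin sum.distrib sum_distrib_left algebra_simps)

lemma bf_rfl:
  assumes "t \<in> S"
  shows "bf (rfl t u) (rfl t v) = bf u v"
proof -
  have r: "rfl t v = (\<lambda>x. 1 * v x + (- pr t v) * root t x)" for v by (simp add: rfl_def)
  have 1: "bf x (rfl t v) = bf x v - pr t v * pr t x" for x v
    unfolding r bf_lin using bf_sym[of x "root t"] bf_root[OF assms, of x] by simp
  have 2: "bf (rfl t u) v = bf u v - pr t u * pr t v"
    using 1[of v u] unfolding bf_sym[of v] by simp
  have "bf (rfl t u) (rfl t v) = bf (rfl t u) v - pr t v * pr t (rfl t u)" by (rule 1)
  then show ?thesis using assms by (simp add: 2 pr_rfl)
qed

lemma bf_actw: "w \<in> lists S \<Longrightarrow> bf (actw w u) (actw w v) = bf u v"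
  by (induction w rule: list.induct) (auto simp: bf_rfl)

lemma rfl_bf: "s \<in> S \<Longrightarrow> rfl s v = (\<lambda>x. v x - bf (root s) v * root s x)"
  by (simp add: rfl_def bf_root)

lemma actw_conj:
  assumes w: "w \<in> lists S" and st: "s \<in> S" "t \<in> S" and e: "actw w (root t) = root s"
  shows "actw w (rfl t v) = rfl s (actw w v)"
proof -
  have r: "rfl t v = (\<lambda>x. 1 * v x + (- bf (root t) v) * root t x)" by (simp add: rfl_bf st)
  have "bf (root t) v = bf (root s) (actw w v)" using bf_actw[OF w, of "root t" v] e by simp
  then show ?thesis unfolding r actw_lin e by (simp add: rfl_bf st)
qed

text \<open>The reflection in s changes only the coordinate s, so a positive root that it makes
  negative is a multiple of \<open>root s\<close>. The invariant form leaves 1 as the only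
  nonnegative factor.\<close>

lemma pos_neg_root:
  assumes w: "w \<in> lists S" and st: "s \<in> S" "t \<in> S"
    and p: "pos (actw w (root t))" and n: "neg (rfl s (actw w (root t)))"
  shows "actw w (root t) = root s"
proof -
  define b where "b = actw w (root t)"
  define c where "c = b s"
  have "b x = c * root s x" for x
  proof (cases "x = s")
    case False
    then have "rfl s b x = b x" by (simp add: rfl_def root_def)
    then have "b x = 0" using p n unfolding pos_def neg_def b_def[symmetric] by (metis order_antisym)
    then show ?thesis using False by (simp add: root_def)
  qed (simp add: c_def root_def)
  then have b: "b = (\<lambda>x. c * root s x + 0 * root s x)" by auto
  have "bf b b = bf (root t) (root t)" unfolding b_def by (rule bf_actw[OF w])
  then have "bf b b = 2" using st by (simp add: bf_root pr_root)
  moreover have "bf b b = c * (c * 2)"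
  proof -
    have 1: "bf u b = c * bf u (root s)" for u
      using bf_lin[of u c "root s" 0 "root s", folded b] by simp
    have "bf b b = c * bf b (root s)" by (rule 1)
    also have "bf b (root s) = c * bf (root s) (root s)"
      unfolding bf_sym[of b "root s"] by (rule 1)
    finally show ?thesis using st by (simp add: bf_root pr_root)
  qed
  ultimately have "c * c = 1" by simp
  moreover have "c \<ge> 0" using p by (simp add: c_def b_def pos_def)
  ultimately have "c = 1" using square_eq_1_iff[of c] by auto
  then show ?thesis using b by (simp add: b_def)
qed

lemma actw_root_nonzero: "w \<in> lists S \<Longrightarrow> actw w (root t) \<noteq> (\<lambda>x. 0)"
proof
  assume w: "w \<in> lists S" and "actw w (root t) = (\<lambda>x. 0)"
  then have "root t = (\<lambda>x. 0)" using actw_rev[OF w, of "root t"] actw_zero by simp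
  then have "root t t = 0" by simp
  then show False by (simp add: root_def)
qed

lemma not_pos_neg: "w \<in> lists S \<Longrightarrow> pos (actw w (root t)) \<Longrightarrow> neg (actw w (root t)) \<Longrightarrow> False"
proof -
  assume w: "w \<in> lists S" "pos (actw w (root t))" "neg (actw w (root t))"
  then have "actw w (root t) x = 0" for x unfolding pos_def neg_def by (metis order_antisym)
  then show False using actw_root_nonzero[OF w(1), of t] by auto
qed

text \<open>Along the prefixes p of w the vector \<open>actw (rev p) (root t)\<close> starts
  positive and ends negative. At the letter s where the sign changes it equals
  \<open>root s\<close>, so t p = p s as operators, and the two copies of s cancel.\<close>

lemma exchange:
  assumes w: "w \<in> lists S" and t: "t \<in> S" and n: "neg (actw (rev w) (root t))"
  shows "\<exists>u1 s u2. w = u1 @ s # u2 \<and> actw (t # w) = actw (u1 @ u2)"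
proof -
  have "\<exists>u1 s u2. p @ q = u1 @ s # u2 \<and> actw (t # p @ q) = actw (u1 @ u2)"
    if "p @ q \<in> lists S" "pos (actw (rev p) (root t))" "neg (actw (rev (p @ q)) (root t))" for p q
    using that
  proof (induction q arbitrary: p rule: list.induct)
    case Nil
    then show ?case using not_pos_neg[of "rev p" t] by (auto simp: in_lists_conv_set)
  next
    case (Cons s q)
    have l: "p \<in> lists S" "rev p \<in> lists S" "s \<in> S" "rev (p @ [s]) \<in> lists S"
      using Cons.prems(1) by (auto simp: in_lists_conv_set)
    show ?case
    proof (cases "pos (actw (rev (p @ [s])) (root t))")
      case True
      then show ?thesis using Cons.IH[of "p @ [s]"] Cons.prems by simp
    next
      case False
      then have "neg (actw (rev (p @ [s])) (root t))" using root_dichotomy[OF order_refl l(4) t] by blast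
      then have "actw (rev p) (root t) = root s"
        using pos_neg_root[OF l(2,3) t Cons.prems(2)] by simp
      then have conj: "actw (rev p) (rfl t v) = rfl s (actw (rev p) v)" for v
        by (rule actw_conj[OF l(2,3) t])
      have "rfl t (actw p (rfl s z)) = actw p z" for z
      proof -
        have "actw (rev p) (rfl t (actw p (rfl s z))) = z"
          by (simp add: conj actw_rev[OF l(1)] rfl_rfl l(3))
        then show ?thesis using actw_rev'[OF l(1)] by metis
      qed
      then have "actw (t # p @ s # q) = actw (p @ q)" by (intro ext) (simp add: actw_append)
      then show ?thesis by blast
    qed
  qed
  from this[of "[]" w] show ?thesis using w n by (simp add: pos_def root_def)
qed

subsection \<open>Standard parabolic subgroups\<close>

definition gw :: "'v list \<Rightarrow> ('v \<Rightarrow> real) bijn" where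
  "gw w = Bijn (actw w)"

definition parab :: "'v set \<Rightarrow> ('v \<Rightarrow> real) bijn set" where
  "parab T = gw ` lists T"

lemma ap_gw: "w \<in> lists S \<Longrightarrow> ap (gw w) = actw w"
proof -
  assume w: "w \<in> lists S"
  have "bij (actw w)"
  proof (rule o_bij)
    show "actw (rev w) \<circ> actw w = id" by (rule ext) (simp add: actw_rev[OF w])
    show "actw w \<circ> actw (rev w) = id" by (rule ext) (simp add: actw_rev'[OF w])
  qed
  then show ?thesis by (simp add: gw_def ap_Bijn)
qed

lemma gw_append: "u \<in> lists S \<Longrightarrow> w \<in> lists S \<Longrightarrow> gw (u @ w) = gw u + gw w"
  by (rule bijn_eqI) (simp add: ap_plus ap_gw actw_append)

lemma gw_Nil [simp]: "gw [] = 0"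
  by (rule bijn_eqI) (simp add: ap_0 ap_gw)

lemma gw_rev:
  assumes "w \<in> lists S"
  shows "gw (rev w) = - gw w"
proof -
  have "rev w \<in> lists S" using assms by (auto simp: in_lists_conv_set)
  then have "gw (rev w) + gw w = 0"
    by (intro bijn_eqI) (simp add: ap_0 ap_plus ap_gw assms actw_rev)
  then show ?thesis by (rule eq_neg_iff_add_eq_0[THEN iffD2])
qed

lemma gw_single_self: "s \<in> S \<Longrightarrow> gw [s] + gw [s] = 0"
  using gw_rev[of "[s]"] eq_neg_iff_add_eq_0[of "gw [s]" "gw [s]"] by simp

lemma gw_eq_iff: "u \<in> lists S \<Longrightarrow> w \<in> lists S \<Longrightarrow> gw u = gw w \<longleftrightarrow> actw u = actw w"
  by (simp add: ap_gw flip: ap_inject)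

lemma parab_subgroup:
  assumes T: "T \<subseteq> S"
  shows "is_subgroup (parab T)"
proof -
  have l: "w \<in> lists S" if "w \<in> lists T" for w using that T by (auto simp: in_lists_conv_set)
  show ?thesis
    unfolding is_subgroup_def parab_def
  proof (intro conjI ballI)
    show "0 \<in> gw ` lists T" by (rule image_eqI[of _ _ "[]"]) simp_all
    fix g assume "g \<in> gw ` lists T"
    then obtain u where u: "g = gw u" "u \<in> lists T" by blast
    have "rev u \<in> lists T" using u(2) by (auto simp: in_lists_conv_set)
    then show "- g \<in> gw ` lists T" using u(1) gw_rev[OF l[OF u(2)]] by (metis imageI)
    fix h assume "h \<in> gw ` lists T"
    then obtain v where v: "h = gw v" "v \<in> lists T" by blast
    have "u @ v \<in> lists T" using u(2) v(2) by auto
    then show "g + h \<in> gw ` lists T" using gw_append[OF l[OF u(2)] l[OF v(2)]] u(1) v(1) by (metis imageI)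
  qed
qed

lemma parab_mono: "T \<subseteq> T' \<Longrightarrow> parab T \<subseteq> parab T'"
  unfolding parab_def by (rule image_mono) (rule lists_mono)

lemma gen_in_parab: "s \<in> T \<Longrightarrow> gw [s] \<in> parab T"
  unfolding parab_def by (rule imageI) simp

lemma parab_word:
  assumes "T \<subseteq> S" "g \<in> parab T"
  obtains w where "w \<in> lists T" "w \<in> lists S" "g = gw w" "- g = gw (rev w)" "ap g = actw w" "ap (- g) = actw (rev w)"
proof -
  obtain w where w: "w \<in> lists T" "g = gw w" using assms(2) by (auto simp: parab_def)
  have wS: "w \<in> lists S" using w(1) assms(1) by (auto simp: in_lists_conv_set)
  have rS: "rev w \<in> lists S" using wS by (auto simp: in_lists_conv_set)
  have m: "- g = gw (rev w)" using w(2) gw_rev[OF wS] by simp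
  show ?thesis by (rule that[OF w(1) wS w(2) m]) (simp_all add: m ap_gw[OF rS], simp add: w(2) ap_gw[OF wS])
qed

lemma parab_lin:
  assumes "g \<in> parab S"
  shows "ap g (\<lambda>x. a * u x + b * v x) = (\<lambda>x. a * ap g u x + b * ap g v x)"
proof -
  obtain w where "ap g = actw w" by (rule parab_word[OF order_refl assms])
  then show ?thesis by (simp add: actw_lin)
qed

lemma parab_sum:
  assumes "g \<in> parab S" "finite A"
  shows "ap g (\<lambda>x. \<Sum>t\<in>A. c t * u t x) = (\<lambda>x. \<Sum>t\<in>A. c t * ap g (u t) x)"
  using assms(2)
proof induction
  case empty
  obtain w where "ap g = actw w" by (rule parab_word[OF order_refl assms(1)])
  then show ?case by (simp add: actw_zero)
next
  case (insert t A)
  then show ?case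
    using parab_lin[OF assms(1), of "c t" "u t" 1 "\<lambda>x. \<Sum>t\<in>A. c t * u t x"] by simp
qed

lemma parab_dichotomy: "T \<subseteq> S \<Longrightarrow> g \<in> parab T \<Longrightarrow> t \<in> T \<Longrightarrow> pos (ap g (root t)) \<or> neg (ap g (root t))"
proof -
  assume T: "T \<subseteq> S" and g: "g \<in> parab T" and t: "t \<in> T"
  obtain w where w: "w \<in> lists T" "ap g = actw w" by (rule parab_word[OF T g])
  show ?thesis unfolding w(2) by (rule root_dichotomy[OF T w(1) t])
qed

lemma parab_not_pos_neg: "g \<in> parab S \<Longrightarrow> pos (ap g (root t)) \<Longrightarrow> neg (ap g (root t)) \<Longrightarrow> False"
proof -
  assume g: "g \<in> parab S" and pn: "pos (ap g (root t))" "neg (ap g (root t))"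
  obtain w where w: "w \<in> lists S" "ap g = actw w" by (rule parab_word[OF order_refl g])
  show False using not_pos_neg[OF w(1)] pn unfolding w(2) by blast
qed

lemma actw_outside: "w \<in> lists T \<Longrightarrow> x \<notin> T \<Longrightarrow> actw w v x = v x"
  by (induction w rule: list.induct) (auto simp: rfl_def root_def)

lemma parab_outside: "T \<subseteq> S \<Longrightarrow> g \<in> parab T \<Longrightarrow> x \<notin> T \<Longrightarrow> ap g v x = v x"
proof -
  assume T: "T \<subseteq> S" and g: "g \<in> parab T" and x: "x \<notin> T"
  obtain w where w: "w \<in> lists T" "ap g = actw w" by (rule parab_word[OF T g])
  show ?thesis unfolding w(2) by (rule actw_outside[OF w(1) x])
qed

lemma descent_exists:
  assumes T: "T \<subseteq> S" and g: "g \<in> parab T" "g \<noteq> 0"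
  shows "\<exists>t\<in>T. neg (ap g (root t))"
proof -
  obtain w where w: "w \<in> lists T" "w \<in> lists S" "g = gw w" by (rule parab_word[OF T g(1)])
  obtain u where u: "(u, w) \<in> cox_rel T m" "length u = len T m w" using w(1) by (rule reduced_exists)
  have uT: "u \<in> lists T" using cox_rel_lists[OF u(1)] ..
  then have uS: "u \<in> lists S" using T by (auto simp: in_lists_conv_set)
  have gu: "g = gw u" using gw_eq_iff[OF uS w(2)] actw_cox_rel[OF u(1) T] w(3) by simp
  then have "u \<noteq> []" using g(2) by auto
  then obtain u1 t where snoc: "u = u1 @ [t]" by (metis rev_exhaust)
  have "length u = len T m u" using len_cong[OF u(1)] u(2) by simp
  then have "neg (actw u (root t))" using reduced_snoc_neg[OF T, of u1 t] uT snoc by simp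
  moreover have "t \<in> T" using uT snoc by auto
  ultimately show ?thesis using gu ap_gw[OF uS] by auto
qed

lemma exchange_parab:
  assumes T: "T \<subseteq> S" and w: "w \<in> lists T" and t: "t \<in> T" and n: "neg (ap (- gw w) (root t))"
  shows "\<exists>u1 s u2. w = u1 @ s # u2 \<and> gw [t] + gw w = gw (u1 @ u2)"
proof -
  have wS: "w \<in> lists S" and tS: "t \<in> S" using T w t by (auto simp: in_lists_conv_set)
  have rS: "rev w \<in> lists S" using wS by (auto simp: in_lists_conv_set)
  have "neg (actw (rev w) (root t))" using n by (simp add: ap_gw[OF rS] flip: gw_rev[OF wS])
  from exchange[OF wS tS this] obtain u1 s u2 where
    u: "w = u1 @ s # u2" "actw (t # w) = actw (u1 @ u2)" by blast
  have l: "t # w \<in> lists S" "u1 @ u2 \<in> lists S" "[t] \<in> lists S" using wS tS u(1) by auto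
  have "gw [t] + gw w = gw (t # w)" using gw_append[OF l(3) wS] by simp
  also have "\<dots> = gw (u1 @ u2)" using gw_eq_iff[OF l(1,2)] u(2) by simp
  finally show ?thesis using u(1) by blast
qed

definition glen :: "'v set \<Rightarrow> ('v \<Rightarrow> real) bijn \<Rightarrow> nat" where
  "glen T g = (LEAST n. \<exists>w. w \<in> lists T \<and> gw w = g \<and> length w = n)"

lemma glen_le: "w \<in> lists T \<Longrightarrow> glen T (gw w) \<le> length w"
  unfolding glen_def by (rule Least_le) blast

lemma glen_word:
  assumes "g \<in> parab T"
  obtains w where "w \<in> lists T" "gw w = g" "length w = glen T g"
proof -
  have "\<exists>w. w \<in> lists T \<and> gw w = g \<and> length w = glen T g"
    unfolding glen_def by (rule LeastI_ex) (use assms in \<open>auto simp: parab_def\<close>)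
  then show ?thesis using that by blast
qed

lemma glen_descent:
  assumes T: "T \<subseteq> S" and g: "g \<in> parab T" and t: "t \<in> T" and n: "neg (ap (- g) (root t))"
  shows "glen T (gw [t] + g) < glen T g"
proof -
  obtain w where w: "w \<in> lists T" "gw w = g" "length w = glen T g" using g by (rule glen_word)
  obtain u1 s u2 where u: "w = u1 @ s # u2" "gw [t] + gw w = gw (u1 @ u2)"
    using exchange_parab[OF T w(1) t] n w(2) by blast
  have "glen T (gw (u1 @ u2)) \<le> length (u1 @ u2)" by (rule glen_le) (use w(1) u(1) in auto)
  then show ?thesis using u w(2,3) by simp
qed

text \<open>If u were not 0, its inverse would send some root of T to a nonpositive combination of
  roots of T. As -g keeps those roots positive, -(u + g) would make the same root negative. So a
  coset of W_T has at most one element without left descents in T.\<close>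

lemma minimal_unique:
  assumes T: "T \<subseteq> S" and g: "g \<in> parab S" and u: "u \<in> parab T"
    and pg: "\<And>t. t \<in> T \<Longrightarrow> pos (ap (- g) (root t))"
    and pu: "\<And>t. t \<in> T \<Longrightarrow> pos (ap (- (u + g)) (root t))"
  shows "u = 0"
proof (rule ccontr)
  assume "u \<noteq> 0"
  then have mu: "- u \<in> parab T" "- u \<noteq> 0" using u is_subgroupD(3)[OF parab_subgroup[OF T]] by auto
  then obtain t where t: "t \<in> T" "neg (ap (- u) (root t))" using descent_exists[OF T] by blast
  define c where "c = ap (- u) (root t)"
  have fT: "finite T" using T finite_S finite_subset by blast
  have c0: "c x = 0" if "x \<notin> T" for x
    using parab_outside[OF T mu(1) that, of "root t"] that t(1) by (auto simp: c_def root_def)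
  have csum: "c = (\<lambda>x. \<Sum>s\<in>T. c s * root s x)"
  proof
    fix x
    have "(\<Sum>s\<in>T. c s * root s x) = (\<Sum>s\<in>T. if s = x then c x else 0)"
      by (rule sum.cong) (auto simp: root_def)
    also have "\<dots> = c x" using c0[of x] fT by simp
    finally show "c x = (\<Sum>s\<in>T. c s * root s x)" by simp
  qed
  have mg: "- g \<in> parab S" using g is_subgroupD(3)[OF parab_subgroup] by blast
  have "ap (- (u + g)) (root t) = ap (- g) c" by (simp add: minus_add ap_plus c_def del: add_uminus_conv_diff)
  also have "\<dots> = (\<lambda>x. \<Sum>s\<in>T. c s * ap (- g) (root s) x)"
    by (subst csum) (rule parab_sum[OF mg fT])
  finally have e: "ap (- (u + g)) (root t) = (\<lambda>x. \<Sum>s\<in>T. c s * ap (- g) (root s) x)" .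
  have "neg (ap (- (u + g)) (root t))"
    unfolding e neg_def
    by (intro allI sum_nonpos mult_nonpos_nonneg) (use t(2) pg in \<open>auto simp: c_def neg_def pos_def\<close>)
  moreover have "- (u + g) \<in> parab S"
    using u g parab_mono[OF T] by (intro is_subgroupD(3,2)[OF parab_subgroup[OF order_refl]]) auto
  ultimately show False using parab_not_pos_neg pu[OF t(1)] by blast
qed

text \<open>The functional takes the values c t >= 0 on the simple roots of T. At a left descent t
  of h its value on -h (root t) is at most 0, yet by invariance this value is c t. Hence c t = 0,
  the reflection t fixes the functional, and it can be split off; the length decreases.\<close>

lemma dominant_stabilizer:
  assumes T: "T \<subseteq> S" and c: "\<And>t. t \<in> T \<Longrightarrow> c t \<ge> 0" and g: "g \<in> parab T"
    and fix_g: "\<And>v. (\<Sum>t\<in>T. c t * ap g v t) = (\<Sum>t\<in>T. c t * v t)"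
  shows "g \<in> parab {t \<in> T. c t = 0}"
proof -
  have fT: "finite T" using T finite_S finite_subset by blast
  have G: "is_subgroup (parab T)" "is_subgroup (parab {t \<in> T. c t = 0})"
    using T by (auto intro!: parab_subgroup)
  have "- h \<in> parab {t \<in> T. c t = 0}"
    if "h \<in> parab T" "\<And>v. (\<Sum>t\<in>T. c t * ap (- h) v t) = (\<Sum>t\<in>T. c t * v t)" for h
    using that
  proof (induction "glen T h" arbitrary: h rule: less_induct)
    case (less h)
    show ?case
    proof (cases "h = 0")
      case True
      then show ?thesis using is_subgroupD(1)[OF G(2)] by simp
    next
      case False
      have "- h \<in> parab T" "- h \<noteq> 0" using False is_subgroupD(3)[OF G(1) less.prems(1)] by auto
      then obtain t where t: "t \<in> T" "neg (ap (- h) (root t))" using descent_exists[OF T] by blast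
      have sr: "(\<Sum>s\<in>T. c s * root t s) = c t"
      proof -
        have "(\<Sum>s\<in>T. c s * root t s) = (\<Sum>s\<in>T. if s = t then c t else 0)"
          by (rule sum.cong) (auto simp: root_def)
        then show ?thesis using t(1) fT by simp
      qed
      have "(\<Sum>s\<in>T. c s * ap (- h) (root t) s) \<le> 0"
        by (intro sum_nonpos mult_nonneg_nonpos) (use t(2) c in \<open>auto simp: neg_def\<close>)
      then have ct: "c t = 0" using less.prems(2)[of "root t"] sr c[OF t(1)] by simp
      define h' where "h' = gw [t] + h"
      have tS: "t \<in> S" using T t(1) by blast
      have gt: "- gw [t] = gw [t]" using gw_rev[of "[t]"] tS by simp
      have h': "- h' = - h + gw [t]" by (simp add: h'_def minus_add gt del: add_uminus_conv_diff)
      have "(\<Sum>s\<in>T. c s * ap (- h') v s) = (\<Sum>s\<in>T. c s * v s)" for v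
      proof -
        have "ap (- h') v = ap (- h) (rfl t v)" using ap_gw[of "[t]"] tS by (simp add: h' ap_plus)
        then have "(\<Sum>s\<in>T. c s * ap (- h') v s) = (\<Sum>s\<in>T. c s * rfl t v s)"
          using less.prems(2)[of "rfl t v"] by simp
        also have "\<dots> = (\<Sum>s\<in>T. c s * v s)"
          by (rule sum.cong) (auto simp: rfl_def root_def ct)
        finally show ?thesis .
      qed
      moreover have "h' \<in> parab T" unfolding h'_def
        using is_subgroupD(2)[OF G(1) gen_in_parab[OF t(1)] less.prems(1)] .
      moreover have "glen T h' < glen T h" unfolding h'_def by (rule glen_descent[OF T less.prems(1) t])
      ultimately have "- h' \<in> parab {t \<in> T. c t = 0}" using less.hyps by blast
      moreover have "gw [t] \<in> parab {t \<in> T. c t = 0}" using t(1) ct by (intro gen_in_parab) simp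
      ultimately have "- h' + gw [t] \<in> parab {t \<in> T. c t = 0}" by (rule is_subgroupD(2)[OF G(2)])
      moreover have "- h' + gw [t] = - h" using gw_single_self[OF tS] by (simp add: h' add.assoc)
      ultimately show ?thesis by simp
    qed
  qed
  from this[of "- g"] show ?thesis using fix_g is_subgroupD(3)[OF G(1) g] by simp
qed

end

section \<open>The family of Coxeter groups\<close>

context coxeter
begin

lemma gens_commute:
  assumes st: "s \<in> S" "t \<in> S" "kf s t = 0"
  shows "gw [s] + gw [t] = gw [t] + gw [s]"
proof (rule bijn_eqI)
  have l: "[s] \<in> lists S" "[t] \<in> lists S" using st by auto
  have k: "kf t s = 0" using kf_sym[of t s] st by simp
  fix v
  show "ap (gw [s] + gw [t]) v = ap (gw [t] + gw [s]) v"
    unfolding ap_plus ap_gw[OF l(1)] ap_gw[OF l(2)] o_apply actw_simps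
    by (rule ext) (simp add: rfl_def[of s "rfl t v"] rfl_def[of t "rfl s v"] pr_rfl st k,
      simp add: rfl_def)
qed

lemma parab_induct [consumes 2, case_names zero gen]:
  assumes T: "T \<subseteq> S" and g: "g \<in> parab T"
    and 0: "Q 0" and step: "\<And>s g. s \<in> T \<Longrightarrow> g \<in> parab T \<Longrightarrow> Q g \<Longrightarrow> Q (gw [s] + g)"
  shows "Q g"
proof -
  have "Q (gw w)" if "w \<in> lists T" for w
    using that
  proof (induction w rule: list.induct)
    case Nil
    then show ?case using 0 by simp
  next
    case (Cons s w)
    then have s: "s \<in> T" "w \<in> lists T" by auto
    then have "[s] \<in> lists S" "w \<in> lists S" using T by (auto simp: in_lists_conv_set)
    from gw_append[OF this] have "gw (s # w) = gw [s] + gw w" by simp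
    moreover have "gw w \<in> parab T" using s(2) by (auto simp: parab_def)
    ultimately show ?case using step[OF s(1)] Cons.IH[OF s(2)] by simp
  qed
  then show ?thesis using g by (auto simp: parab_def)
qed

lemma parab_centralise:
  assumes T: "T \<subseteq> S" and c: "\<And>t. t \<in> T \<Longrightarrow> gw [t] + c = c + gw [t]" and g: "g \<in> parab T"
  shows "g + c = c + g"
  using T g
proof (induction rule: parab_induct)
  case (gen s g)
  have "gw [s] + g + c = gw [s] + c + g" using gen.IH by (simp add: add.assoc)
  then show ?case using c[OF gen.hyps(1)] by (simp add: add.assoc)
qed simp

text \<open>Precomposition turns the left action on vectors into a right action on functionals, as
  \<open>gset\<close> requires.\<close>

definition pull :: "(('v \<Rightarrow> real) \<Rightarrow> real) \<Rightarrow> ('v \<Rightarrow> real) bijn \<Rightarrow> (('v \<Rightarrow> real) \<Rightarrow> real)" where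
  "pull f g = (\<lambda>v. f (ap g v))"

lemma pull_0 [simp]: "pull f 0 = f"
  by (simp add: pull_def ap_0)

lemma pull_add: "pull f (g + h) = pull (pull f g) h"
  by (simp add: pull_def ap_plus)

lemma pull_fixed:
  assumes T: "T \<subseteq> S" and f: "\<And>s. s \<in> T \<Longrightarrow> pull f (gw [s]) = f" and g: "g \<in> parab T"
  shows "pull f g = f"
  using T g by (induction rule: parab_induct) (simp_all add: pull_add f)

lemma pull_gen: "s \<in> S \<Longrightarrow> pull f (gw [s]) = (\<lambda>v. f (rfl s v))"
  using ap_gw[of "[s]"] by (simp add: pull_def)

end

locale gamma_family =
  fixes S0 :: "'a set" and M0 :: "'a \<Rightarrow> 'a \<Rightarrow> enat" and m1 :: "'a \<Rightarrow> enat" and M :: nat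
  assumes finite_S0: "finite S0" and matrix_M0: "is_coxeter_matrix S0 M0"
    and m1_ge2: "\<And>a. a \<in> S0 \<Longrightarrow> m1 a \<ge> 2"
begin

abbreviation "V \<equiv> gamma_vertices S0"
abbreviation "mm \<equiv> gamma_matrix M0 m1"

lemma V_mono: "i \<le> j \<Longrightarrow> V i \<subseteq> V j"
  by (auto simp: gamma_vertices_def)

lemma V_iff [simp]: "Inl a \<in> V n \<longleftrightarrow> a \<in> S0" "Inr i \<in> V n \<longleftrightarrow> 1 \<le> i \<and> i \<le> n"
  by (auto simp: gamma_vertices_def)

lemma gamma_coxeter: "coxeter (V n) mm"
proof
  show "finite (V n)" using finite_S0 by (simp add: gamma_vertices_def)
  have three: "(2::enat) \<le> 3" by (simp add: numeral_eq_enat)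
  show "is_coxeter_matrix (V n) mm"
    unfolding is_coxeter_matrix_def
  proof (intro conjI ballI impI)
    have M: "\<And>a b. a \<in> S0 \<Longrightarrow> b \<in> S0 \<Longrightarrow> M0 a b = M0 b a" "\<And>a. a \<in> S0 \<Longrightarrow> M0 a a = 1"
        "\<And>a b. a \<in> S0 \<Longrightarrow> b \<in> S0 \<Longrightarrow> a \<noteq> b \<Longrightarrow> 2 \<le> M0 a b"
      using matrix_M0 by (auto simp: is_coxeter_matrix_def)
    fix s t assume s: "s \<in> V n" and t: "t \<in> V n"
    show "mm s t = mm t s" using s t M(1) by (cases s; cases t) (auto simp: gamma_matrix_def)
    show "mm s s = 1" using s M(2) by (cases s) (auto simp: gamma_matrix_def)
    assume "s \<noteq> t"
    then show "2 \<le> mm s t"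
      using s t M(3) m1_ge2 three by (cases s; cases t) (auto simp: gamma_matrix_def)
  qed
qed

end

text \<open>The ambient representation is the one of \<open>\<Gamma>\<close> with index \<open>M + 1\<close>, so that for the groups
  with index at most \<open>M\<close> the simple reflections all have their generic formula.\<close>

sublocale gamma_family \<subseteq> coxeter "gamma_vertices S0 (Suc M)" "gamma_matrix M0 m1"
  by (rule gamma_coxeter)

section \<open>The index-shifted parabolic subgroups and the functionals \<delta>\<close>

context gamma_family
begin

lemma kf_Inr: "kf (Inr i) (Inr j) = (if i = j then 2 else if i = Suc j \<or> j = Suc i then - 1 else 0)"
  by (simp add: kf_def gamma_matrix_def numeral_eq_enat cos_60)

lemma kf_Inr_Inl: "i \<noteq> 1 \<Longrightarrow> kf (Inr i) (Inl a) = 0"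
  by (simp add: kf_def gamma_matrix_def numeral_eq_enat)

text \<open>Equal to 2 cos (pi / m1 a), or to 2 for an infinite label; it vanishes exactly at the
  vertices not joined to s_1.\<close>

definition c1 :: "'a \<Rightarrow> real" where
  "c1 a = - kf (Inr 1) (Inl a)"

lemma c1_nonneg: "a \<in> S0 \<Longrightarrow> c1 a \<ge> 0"
  using kf_le0[of "Inr 1" "Inl a"] by (simp add: c1_def)

lemma c1_zero_iff:
  assumes "a \<in> S0"
  shows "c1 a = 0 \<longleftrightarrow> m1 a = 2"
proof (cases "m1 a")
  case (enat k)
  have k: "k \<ge> 2" using m1_ge2[OF assms] enat by (simp add: numeral_eq_enat)
  have "cos (pi / real k) = 0 \<longleftrightarrow> k = 2"
  proof
    assume c: "cos (pi / real k) = 0"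
    show "k = 2"
    proof (rule ccontr)
      assume "k \<noteq> 2"
      then have "pi / real k < pi / 2" using k by (intro divide_strict_left_mono) auto
      moreover have "0 \<le> pi / real k" by simp
      then have "- (pi / 2) < pi / real k" using pi_gt_zero by linarith
      ultimately have "cos (pi / real k) > 0" by (intro cos_gt_zero_pi)
      then show False using c by simp
    qed
  qed simp
  then show ?thesis using enat by (simp add: c1_def kf_def gamma_matrix_def numeral_eq_enat)
next
  case infinity
  then show ?thesis by (simp add: c1_def kf_def gamma_matrix_def)
qed

text \<open>The shift by one lets the stabiliser of a word with all n + 1 letters be indexed by 0,
  with the vertices of \<Gamma>_{-1} as generators. Beyond the ambient diagram the sets stay
  constant, because the subgroup axioms of the tower speak of every index.\<close>

definition Sg :: "nat \<Rightarrow> ('a + nat) set" where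
  "Sg j = (case j of 0 \<Rightarrow> Inl ` {a \<in> S0. m1 a = 2} | Suc i \<Rightarrow> V (min i (Suc M)))"

definition P :: "nat \<Rightarrow> ('a + nat \<Rightarrow> real) bijn set" where
  "P j = parab (Sg j)"

lemma Sg_subset: "Sg j \<subseteq> V (Suc M)"
  by (cases j) (auto simp: Sg_def gamma_vertices_def)

lemma Sg_Suc: "n \<le> Suc M \<Longrightarrow> Sg (Suc n) = V n"
  by (simp add: Sg_def)

lemma P_Suc_eq: "n \<le> Suc M \<Longrightarrow> P (Suc n) = parab (V n)"
  by (simp add: P_def Sg_Suc)

lemma P_subgroup: "is_subgroup (P j)"
  unfolding P_def by (rule parab_subgroup[OF Sg_subset])

lemma P_mono_Suc: "P j \<subseteq> P (Suc j)"
  unfolding P_def by (rule parab_mono) (cases j, auto simp: Sg_def gamma_vertices_def)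

text \<open>Found by writing the pairing with s_i as \<delta>_i - \<delta>_{i-1}, see
  \<open>pr_Inr\<close>. For i = 0 the coordinate at s_i is replaced by the pairing of s_1 with
  \<Gamma>_0, up to sign, so that the same formula holds for i = 1. On simple roots \<delta>_i is
  negative only at s_{i+1}.\<close>

definition \<delta> :: "nat \<Rightarrow> ('a + nat \<Rightarrow> real) \<Rightarrow> real" where
  "\<delta> i v = (if i = 0 then (\<Sum>a\<in>S0. c1 a * v (Inl a)) else v (Inr i)) - v (Inr (Suc i))"

lemma delta_rfl: "\<delta> i (rfl s v) = \<delta> i v - pr s v * \<delta> i (root s)"
  by (simp add: \<delta>_def rfl_def algebra_simps sum_subtractf sum_distrib_left)

lemma delta_root_Inr: "1 \<le> j \<Longrightarrow> \<delta> i (root (Inr j)) = (if j = Suc i then - 1 else if j = i then 1 else 0)"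
  by (auto simp: \<delta>_def root_def)

lemma delta_root_Inl: "a \<in> S0 \<Longrightarrow> \<delta> i (root (Inl a)) = (if i = 0 then c1 a else 0)"
  using finite_S0 by (simp add: \<delta>_def root_def if_distrib[of "\<lambda>x. _ * x"] cong: if_cong)

lemma delta_fixed: "s \<in> V (Suc M) \<Longrightarrow> \<delta> i (root s) = 0 \<Longrightarrow> pull (\<delta> i) (gw [s]) = \<delta> i"
  by (simp add: pull_gen delta_rfl)

lemma sum_V: "(\<Sum>t\<in>V n. f t) = (\<Sum>a\<in>S0. f (Inl a)) + (\<Sum>j\<in>{1..n}. f (Inr j))"
proof -
  have "(\<Sum>t\<in>V n. f t) = sum f (Inl ` S0) + sum f (Inr ` {1..n})"
    unfolding gamma_vertices_def by (rule sum.union_disjoint) (use finite_S0 in auto)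
  then show ?thesis by (simp add: sum.reindex)
qed

lemma pr_Inr:
  assumes i: "1 \<le> i" "i \<le> M"
  shows "pr (Inr i) v = \<delta> i v - \<delta> (i - 1) v"
proof -
  have "(\<Sum>j\<in>{1..Suc M}. kf (Inr i) (Inr j) * v (Inr j)) =
      (\<Sum>j\<in>{1..Suc M}. (if j = i then 2 * v (Inr i) else 0) - (if j = Suc i then v (Inr (Suc i)) else 0)
        - (if j = i - 1 then v (Inr (i - 1)) else 0))"
    by (rule sum.cong) (use i in \<open>auto simp: kf_Inr\<close>)
  also have "\<dots> = 2 * v (Inr i) - v (Inr (Suc i)) - (if i = 1 then 0 else v (Inr (i - 1)))"
    using i by (auto simp: sum_subtractf)
  finally have 1: "(\<Sum>j\<in>{1..Suc M}. kf (Inr i) (Inr j) * v (Inr j)) =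
      2 * v (Inr i) - v (Inr (Suc i)) - (if i = 1 then 0 else v (Inr (i - 1)))" .
  have 2: "(\<Sum>a\<in>S0. kf (Inr i) (Inl a) * v (Inl a)) = (if i = 1 then - (\<Sum>a\<in>S0. c1 a * v (Inl a)) else 0)"
    by (simp add: kf_Inr_Inl c1_def sum_negf)
  show ?thesis unfolding pr_def sum_V 1 2 using i by (auto simp: \<delta>_def)
qed

lemma delta_down:
  assumes "1 \<le> i" "i \<le> M"
  shows "pull (\<delta> i) (gw [Inr i]) = \<delta> (i - 1)"
  using assms by (simp add: pull_gen delta_rfl pr_Inr delta_root_Inr)

lemma delta_up:
  assumes "1 \<le> i" "i \<le> M"
  shows "pull (\<delta> (i - 1)) (gw [Inr i]) = \<delta> i"
proof -
  have "pull (pull (\<delta> i) (gw [Inr i])) (gw [Inr i]) = \<delta> i"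
    unfolding pull_add[symmetric] using assms by (simp add: gw_single_self)
  then show ?thesis unfolding delta_down[OF assms] .
qed

lemma delta_gen_fixed:
  assumes "1 \<le> j" "j \<le> Suc M" "j \<noteq> i" "j \<noteq> Suc i"
  shows "pull (\<delta> i) (gw [Inr j]) = \<delta> i"
  by (rule delta_fixed) (use assms in \<open>auto simp: delta_root_Inr\<close>)

lemma delta_inj: "\<delta> i = \<delta> j \<Longrightarrow> i = j"
proof (rule ccontr)
  assume e: "\<delta> i = \<delta> j" and "i \<noteq> j"
  then show False
    using delta_root_Inr[of "Suc i" i] delta_root_Inr[of "Suc i" j] by (auto split: if_splits)
qed

end

sublocale gamma_family \<subseteq> gset pull
  by unfold_locales (simp_all add: pull_add)

section \<open>Stabilisers and faces of the base words\<close>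

context gamma_family
begin

lemma pull_inj: "pull f g = pull f' g \<Longrightarrow> f = f'"
proof -
  assume e: "pull f g = pull f' g"
  have "f = pull (pull f g) (- g)" by (rule act_minus[symmetric])
  also have "\<dots> = f'" unfolding e by (rule act_minus)
  finally show ?thesis .
qed

abbreviation "B \<equiv> base \<delta>"

lemma Sg_fixes:
  assumes "n \<le> M" "k \<le> Suc n" "i < k" "s \<in> Sg (Suc n - k)"
  shows "pull (\<delta> (n - i)) (gw [s]) = \<delta> (n - i)"
proof (rule delta_fixed)
  show "s \<in> V (Suc M)" using assms(4) Sg_subset by blast
  show "\<delta> (n - i) (root s) = 0"
  proof (cases "k = Suc n")
    case True
    then obtain a where "s = Inl a" "a \<in> S0" "m1 a = 2" using assms(4) by (auto simp: Sg_def)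
    then show ?thesis using c1_zero_iff[of a] by (simp add: delta_root_Inl)
  next
    case False
    then have k: "k \<le> n" "Suc n - k = Suc (n - k)" using assms(2) by auto
    then have sV: "s \<in> V (n - k)" using assms(1,4) Sg_Suc[of "n - k"] by simp
    show ?thesis
    proof (cases s)
      case (Inl a)
      then show ?thesis using sV assms(3) k by (simp add: delta_root_Inl)
    next
      case (Inr l)
      then have "1 \<le> l" "l \<le> n - k" using sV by auto
      then have "1 \<le> l" "l < n - i" using assms(3) k by linarith+
      then show ?thesis by (simp add: Inr delta_root_Inr)
    qed
  qed
qed

lemma B_fixed: "n \<le> M \<Longrightarrow> k \<le> Suc n \<Longrightarrow> g \<in> P (Suc n - k) \<Longrightarrow> lact (B n k) g = B n k"
proof -
  assume n: "n \<le> M" and k: "k \<le> Suc n" and g: "g \<in> P (Suc n - k)"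
  have "pull (\<delta> (n - i)) g = \<delta> (n - i)" if "i < k" for i
    by (rule pull_fixed[OF Sg_subset Sg_fixes[OF n k that]]) (use g in \<open>simp_all add: P_def\<close>)
  then show ?thesis by (simp add: base_def)
qed

text \<open>The only root of V (i + 1) on which \<delta>_i is negative is that of s_{i+1}, and W_i
  does not touch this coordinate. Without it \<delta>_i is a dominant functional whose zeros among
  the vertices of \<Gamma>_i form \<open>Sg i\<close>.\<close>

lemma stabilizer_step:
  assumes i: "i \<le> M" and g: "g \<in> P (Suc i)" and f: "pull (\<delta> i) g = \<delta> i"
  shows "g \<in> P i"
proof -
  have gV: "g \<in> parab (V i)" using g i by (simp add: P_Suc_eq)
  have VS: "V i \<subseteq> V (Suc M)" using i by (intro V_mono) simp
  define c where "c t = (case t of Inl a \<Rightarrow> (if i = 0 then c1 a else 0) | Inr j \<Rightarrow> (if j = i then 1 else 0))"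
    for t :: "'a + nat"
  have c0: "c t \<ge> 0" if "t \<in> V i" for t using that c1_nonneg by (cases t) (auto simp: c_def)
  have out: "ap g v (Inr (Suc i)) = v (Inr (Suc i))" for v
    by (rule parab_outside[OF VS gV]) simp
  have cs: "(\<Sum>t\<in>V i. c t * v t) = \<delta> i v + v (Inr (Suc i))" for v
    unfolding sum_V by (simp add: c_def \<delta>_def if_distrib[of "\<lambda>x. x * _"] cong: if_cong)
  have "\<delta> i (ap g v) = \<delta> i v" for v using fun_cong[OF f, of v] by (simp add: pull_def)
  then have "(\<Sum>t\<in>V i. c t * ap g v t) = (\<Sum>t\<in>V i. c t * v t)" for v
    unfolding cs out by simp
  from dominant_stabilizer[OF VS c0 gV this] have "g \<in> parab {t \<in> V i. c t = 0}" by blast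
  moreover have "{t \<in> V i. c t = 0} \<subseteq> Sg i"
  proof
    fix t assume t: "t \<in> {t \<in> V i. c t = 0}"
    show "t \<in> Sg i"
      using t c1_zero_iff i by (cases t; cases i) (auto simp: c_def Sg_def split: if_splits)
  qed
  ultimately show ?thesis unfolding P_def using parab_mono by blast
qed

lemma B_Suc: "B n (Suc k) = B n k @ [\<delta> (n - k)]"
  by (simp add: base_def)

lemma B_stabilizer:
  assumes n: "n \<le> M"
  shows "k \<le> Suc n \<Longrightarrow> g \<in> P (Suc n) \<Longrightarrow> lact (B n k) g = B n k \<Longrightarrow> g \<in> P (Suc n - k)"
proof (induction k)
  case (Suc k)
  then have "g \<in> P (Suc n - k)" "pull (\<delta> (n - k)) g = \<delta> (n - k)" by (simp_all add: B_Suc)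
  moreover have "Suc n - k = Suc (n - k)" using Suc.prems(1) by simp
  ultimately show ?case using stabilizer_step[of "n - k" g] n by simp
qed simp

text \<open>Descending induction on i: the last face is the base word itself, and neighbouring faces
  differ only in \<delta>_{n-i-1} against \<delta>_{n-i}, which s_{n-i} exchanges. As i < k, this
  reflection is joined to no generator of \<open>P (n - k)\<close>; for k = n this is why
  \<Gamma>_{-1} omits the neighbours of s_1.\<close>

lemma B_face:
  assumes n: "n \<le> M" and k: "k \<le> n"
  shows "i \<le> k \<Longrightarrow> \<exists>c \<in> P (Suc n). (\<forall>h \<in> P (n - k). h + c = c + h) \<and> del i (B n (Suc k)) = lact (B n k) c"
proof (induction "k - i" arbitrary: i)
  case 0
  then have "del i (B n (Suc k)) = B n k" by (simp add: del_def base_def take_map drop_map)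
  then show ?case using is_subgroupD(1)[OF P_subgroup[of "Suc n"]] by (intro bexI[of _ 0]) auto
next
  case (Suc d)
  then have ik: "i < k" "d = k - Suc i" "Suc i \<le> k" by auto
  obtain c where c: "c \<in> P (Suc n)" "\<forall>h \<in> P (n - k). h + c = c + h"
      "del (Suc i) (B n (Suc k)) = lact (B n k) c"
    using Suc.hyps(1)[OF ik(2,3)] by blast
  define s where "s = (Inr (n - i) :: 'a + nat)"
  have ni: "1 \<le> n - i" "n - i \<le> M" using ik k n by auto
  have sV: "s \<in> V n" "s \<in> V (Suc M)" using ni n by (auto simp: s_def)
  have "gw [s] \<in> P (Suc n)" using sV n by (simp add: P_Suc_eq gen_in_parab)
  then have "c + gw [s] \<in> P (Suc n)" using c(1) is_subgroupD(2)[OF P_subgroup] by blast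
  moreover have "h + (c + gw [s]) = (c + gw [s]) + h" if h: "h \<in> P (n - k)" for h
  proof -
    have "gw [t] + gw [s] = gw [s] + gw [t]" if t: "t \<in> Sg (n - k)" for t
    proof (rule gens_commute)
      show "t \<in> V (Suc M)" using t Sg_subset by blast
      have "kf s t = 0"
      proof (cases "n - k")
        case 0
        then obtain a where a: "t = Inl a" "a \<in> S0" "m1 a = 2" using t by (auto simp: Sg_def)
        show ?thesis
          using c1_zero_iff[OF a(2)] a kf_Inr_Inl[of "n - i" a] by (cases "n - i = 1") (auto simp: s_def c1_def)
      next
        case (Suc l)
        then have "t \<in> V l" using t n Sg_Suc[of l] by simp
        then show ?thesis using Suc ik
          by (cases t) (auto simp: s_def kf_Inr kf_Inr_Inl)
      qed
      then show "kf t s = 0" using kf_sym[of t s] \<open>t \<in> V (Suc M)\<close> sV by simp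
    qed (rule sV)
    then have "h + gw [s] = gw [s] + h" using parab_centralise[OF Sg_subset] h unfolding P_def by blast
    then show ?thesis using c(2) h by (metis add.assoc)
  qed
  moreover have "del i (B n (Suc k)) = lact (B n k) (c + gw [s])"
  proof -
    have u: "del i [0..<Suc k] = [0..<i] @ [Suc i] @ [Suc (Suc i)..<Suc k]"
        "del (Suc i) [0..<Suc k] = [0..<i] @ [i] @ [Suc (Suc i)..<Suc k]"
    proof -
      have "[0..<Suc k] = [0..<i] @ [i..<Suc k]"
        using upt_add_eq_append[of 0 i "Suc k - i"] ik by (simp del: upt_Suc)
      also have "[i..<Suc k] = i # Suc i # [Suc (Suc i)..<Suc k]"
        using ik by (simp add: upt_conv_Cons del: upt_Suc)
      finally have e: "[0..<Suc k] = [0..<i] @ i # Suc i # [Suc (Suc i)..<Suc k]" .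
      show "del i [0..<Suc k] = [0..<i] @ [Suc i] @ [Suc (Suc i)..<Suc k]"
        "del (Suc i) [0..<Suc k] = [0..<i] @ [i] @ [Suc (Suc i)..<Suc k]"
        unfolding e by (simp_all add: del_append del_Cons del: upt_Suc)
    qed
    have "lact (B n k) (c + gw [s]) = lact (del (Suc i) (B n (Suc k))) (gw [s])"
      unfolding c(3) lact_add ..
    also have "\<dots> = map (\<lambda>l. pull (\<delta> (n - l)) (gw [s])) (del (Suc i) [0..<Suc k])"
      by (simp add: base_def map_del[symmetric] comp_def del: upt_Suc)
    also have "\<dots> = map (\<lambda>l. \<delta> (n - l)) (del i [0..<Suc k])"
    proof -
      have "pull (\<delta> (n - l)) (gw [s]) = \<delta> (n - l)" if "l < i \<or> Suc (Suc i) \<le> l \<and> l \<le> k" for l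
        unfolding s_def by (rule delta_gen_fixed) (use that ni n k in auto)
      moreover have "pull (\<delta> (n - i)) (gw [s]) = \<delta> (n - Suc i)"
        using delta_down[OF ni] by (simp add: s_def)
      ultimately show ?thesis unfolding u by (auto simp del: upt_Suc)
    qed
    also have "\<dots> = del i (B n (Suc k))" by (simp add: base_def map_del del: upt_Suc)
    finally show ?thesis ..
  qed
  ultimately show ?case by blast
qed

subsection \<open>Chambers and shellability\<close>

definition chamber :: "nat \<Rightarrow> ('a + nat \<Rightarrow> real) bijn \<Rightarrow> (('a + nat \<Rightarrow> real) \<Rightarrow> real) set" where
  "chamber n g = (\<lambda>i. pull (\<delta> i) g) ` {..n}"

text \<open>The tail s_1, ..., s_n generates the symmetric group that permutes \<delta>_0, ...,
  \<delta>_n.\<close>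

definition J :: "nat \<Rightarrow> ('a + nat) set" where
  "J n = Inr ` {1..n}"

lemma J_mono: "i \<le> j \<Longrightarrow> J i \<subseteq> J j"
  by (auto simp: J_def)

lemma J_sub: "J n \<subseteq> V n"
  by (auto simp: J_def)

lemma J_sub': "n \<le> Suc M \<Longrightarrow> J n \<subseteq> V (Suc M)"
  by (auto simp: J_def)

lemma card_chamber: "finite (chamber n g) \<and> card (chamber n g) = Suc n"
proof -
  have "inj_on (\<lambda>i. pull (\<delta> i) g) {..n}" by (auto intro!: inj_onI dest!: pull_inj delta_inj)
  then show ?thesis by (simp add: chamber_def card_image)
qed

lemma chamber_J:
  assumes n: "n \<le> M" and v: "v \<in> parab (J n)"
  shows "chamber n v = chamber n 0"
proof -
  have JS: "J n \<subseteq> V (Suc M)" using n by (intro J_sub') simp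
  have sub: "chamber n v \<subseteq> chamber n 0" if "v \<in> parab (J n)" for v
    using JS that
  proof (induction rule: parab_induct)
    case (gen s g)
    then obtain j where j: "s = Inr j" "1 \<le> j" "j \<le> n" by (auto simp: J_def)
    have "\<exists>i'\<le>n. pull (\<delta> i) (gw [s]) = \<delta> i'" if "i \<le> n" for i
    proof -
      consider "j = i" | "j = Suc i" | "j \<noteq> i" "j \<noteq> Suc i" by blast
      then show ?thesis
      proof cases
        case 1
        then show ?thesis using delta_down[of i] j n that by (intro exI[of _ "i - 1"]) simp
      next
        case 2
        then show ?thesis using delta_up[of j] j n by (intro exI[of _ j]) simp
      next
        case 3
        then show ?thesis using delta_gen_fixed[of j i] j n that by (intro exI[of _ i]) simp
      qed
    qed
    then have "chamber n (gw [s] + g) \<subseteq> chamber n g" by (fastforce simp: chamber_def pull_add)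
    then show ?case using gen.IH by blast
  qed simp
  have "card (chamber n v) = card (chamber n 0)" using card_chamber by simp
  then show ?thesis using card_subset_eq[OF _ sub[OF v]] card_chamber by blast
qed

lemma chamber_add: "chamber n (g + h) = (\<lambda>f. pull f h) ` chamber n g"
  by (auto simp: chamber_def pull_add image_image)

lemma chamber_J_add: "n \<le> M \<Longrightarrow> v \<in> parab (J n) \<Longrightarrow> chamber n (v + g) = chamber n g"
  using chamber_J[of n v] chamber_add[of n v g] chamber_add[of n 0 g] by simp

lemma move_delta:
  assumes "j \<le> i" "i \<le> M"
  shows "\<exists>u \<in> parab (J i). pull (\<delta> i) u = \<delta> j"
  using assms
proof (induction i)
  case 0
  then show ?case using is_subgroupD(1)[OF parab_subgroup[OF J_sub'[of 0]]] by (intro bexI[of _ 0]) auto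
next
  case (Suc i)
  have G: "is_subgroup (parab (J (Suc i)))" using Suc.prems by (intro parab_subgroup J_sub') simp
  show ?case
  proof (cases "j = Suc i")
    case True
    then show ?thesis using is_subgroupD(1)[OF G] by (intro bexI[of _ 0]) auto
  next
    case False
    then obtain u where u: "u \<in> parab (J i)" "pull (\<delta> i) u = \<delta> j" using Suc by auto
    have "u \<in> parab (J (Suc i))" using u(1) parab_mono[OF J_mono[of i "Suc i"]] by auto
    moreover have "gw [Inr (Suc i)] \<in> parab (J (Suc i))" by (intro gen_in_parab) (auto simp: J_def)
    moreover have "pull (\<delta> (Suc i)) (gw [Inr (Suc i)] + u) = \<delta> j"
      using delta_down[of "Suc i"] Suc.prems u(2) by (simp add: pull_add)
    ultimately show ?thesis using is_subgroupD(2)[OF G] by blast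
  qed
qed

text \<open>Built letter by letter. After k letters the next one is \<delta>_j v with j <= n - k,
  the larger indices being used up. An element of the symmetric group on the indices up to n - k
  moves \<delta>_{n-k} to \<delta>_j and fixes the letters already placed.\<close>

lemma words_transitive:
  assumes n: "n \<le> M"
  shows "xs \<in> inj_words (chamber n 0) k \<Longrightarrow> \<exists>v \<in> parab (J n). lact (B n k) v = xs"
proof (induction k arbitrary: xs)
  case 0
  have "0 \<in> parab (J n)" using is_subgroupD(1)[OF parab_subgroup[OF J_sub']] n by simp
  then show ?case using 0 by (intro bexI[of _ 0]) (auto simp: inj_words_def base_def)
next
  case (Suc k)
  have G: "is_subgroup (parab (J n))" using n by (intro parab_subgroup J_sub') simp
  obtain ys y where xs: "xs = ys @ [y]"
    using Suc.prems by (cases xs rule: rev_cases) (auto simp: inj_words_def)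
  have ys: "ys \<in> inj_words (chamber n 0) k" and y: "y \<in> chamber n 0" "y \<notin> set ys"
    using Suc.prems xs by (auto simp: inj_words_def)
  have kn: "Suc k \<le> Suc n"
  proof -
    have "card (set xs) \<le> card (chamber n 0)"
      by (rule card_mono) (use card_chamber Suc.prems in \<open>auto simp: inj_words_def\<close>)
    then show ?thesis using Suc.prems card_chamber[of n 0] by (simp add: inj_words_def distinct_card)
  qed
  obtain v where v: "v \<in> parab (J n)" "lact (B n k) v = ys" using Suc.IH[OF ys] by blast
  have "y \<in> chamber n v" using y(1) chamber_J[OF n v(1)] by simp
  then obtain j where j: "j \<le> n" "y = pull (\<delta> j) v" by (auto simp: chamber_def)
  have jk: "j \<le> n - k"
  proof (rule ccontr)
    assume "\<not> j \<le> n - k"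
    then have "n - j < k" "n - (n - j) = j" using j(1) by auto
    then have "\<delta> j \<in> set (B n k)" unfolding base_def by force
    then have "y \<in> set ys" using v(2) j(2) by force
    then show False using y(2) by blast
  qed
  then obtain u where u: "u \<in> parab (J (n - k))" "pull (\<delta> (n - k)) u = \<delta> j"
    using move_delta[OF jk] n by (meson diff_le_self order_trans)
  have "Suc n - k = Suc (n - k)" using kn by simp
  then have "u \<in> P (Suc n - k)"
    using u(1) parab_mono[OF J_sub] n by (auto simp: P_Suc_eq)
  then have fixB: "lact (B n k) u = B n k" using B_fixed[OF n] kn by simp
  have "lact (B n (Suc k)) (u + v) = lact (lact (B n k) u) v @ [pull (pull (\<delta> (n - k)) u) v]"
    by (simp add: B_Suc pull_add)
  also have "\<dots> = xs" using fixB u(2) v(2) j(2) xs by simp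
  finally have "lact (B n (Suc k)) (u + v) = xs" .
  moreover have "u \<in> parab (J n)" using u(1) parab_mono[OF J_mono[of "n - k" n]] by auto
  then have "u + v \<in> parab (J n)" using v(1) is_subgroupD(2)[OF G] by blast
  ultimately show ?case by blast
qed

lemma words_transitive_chamber:
  assumes n: "n \<le> M" and xs: "xs \<in> inj_words (chamber n g) k"
  shows "\<exists>v \<in> parab (J n). lact (B n k) (v + g) = xs"
proof -
  have inj: "inj (\<lambda>f. pull f (- g))" by (rule injI) (rule pull_inj)
  have "(\<lambda>f. pull f (- g)) ` chamber n g = chamber n 0"
    using chamber_add[of n g "- g"] by simp
  then have "lact xs (- g) \<in> inj_words (chamber n 0) k"
    using xs by (auto simp: inj_words_def distinct_map intro: inj_on_subset[OF inj])
  then obtain v where v: "v \<in> parab (J n)" "lact (B n k) v = lact xs (- g)"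
    using words_transitive[OF n] by blast
  have "lact (B n k) (v + g) = lact (lact xs (- g)) g" unfolding lact_add v(2) ..
  also have "\<dots> = xs" using lact_minus[where xs = xs and g = "- g"] by simp
  finally show ?thesis using v(1) by blast
qed

lemma base_word: "k \<le> Suc n \<Longrightarrow> lact (B n k) g \<in> inj_words (chamber n g) k"
proof -
  assume k: "k \<le> Suc n"
  have "distinct (lact (B n k) g)"
    unfolding base_def map_map distinct_map
    using k by (auto intro!: inj_onI dest!: pull_inj delta_inj)
  then show ?thesis by (auto simp: inj_words_def base_def chamber_def)
qed

text \<open>Brings the orbit, that is the cosets of W_{n-k}, into the form required by
  \<open>shellable_exact\<close>.\<close>

lemma orbit_eq:
  assumes n: "n \<le> M" and k: "k \<le> Suc n"
  shows "{lact (B n k) g |g. g \<in> P (Suc n)} = (\<Union>L \<in> chamber n ` P (Suc n). inj_words L k)"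
proof -
  have "\<exists>g' \<in> P (Suc n). xs = lact (B n k) g'"
    if g: "g \<in> P (Suc n)" and xs: "xs \<in> inj_words (chamber n g) k" for g xs
  proof -
    obtain v where v: "v \<in> parab (J n)" "lact (B n k) (v + g) = xs"
      using words_transitive_chamber[OF n xs] by blast
    have "v \<in> P (Suc n)" using v(1) parab_mono[OF J_sub] n by (auto simp: P_Suc_eq)
    then show ?thesis using v(2) g is_subgroupD(2)[OF P_subgroup] by blast
  qed
  then show ?thesis using base_word[OF k] by fastforce
qed

definition rkc :: "nat \<Rightarrow> ('a + nat \<Rightarrow> real) bijn \<Rightarrow> nat" where
  "rkc n g = (LEAST r. \<exists>v \<in> parab (J n). glen (V n) (v + g) = r)"

text \<open>The minimum runs over all elements with the given chamber and not over one coset of the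
  symmetric group: W_{-1} fixes every \<delta>_i, so one chamber may belong to several
  cosets.\<close>

definition rk :: "nat \<Rightarrow> (('a + nat \<Rightarrow> real) \<Rightarrow> real) set \<Rightarrow> nat" where
  "rk n L = (LEAST r. \<exists>w \<in> parab (V n). chamber n w = L \<and> glen (V n) w = r)"

context
  fixes n :: nat
  assumes n: "n \<le> M"
begin

lemma VS: "V n \<subseteq> V (Suc M)"
  using n by (intro V_mono) simp

lemma JG: "is_subgroup (parab (J n))"
  using n by (intro parab_subgroup J_sub') simp

lemma VG: "is_subgroup (parab (V n))"
  by (rule parab_subgroup[OF VS])

lemma J_V: "v \<in> parab (J n) \<Longrightarrow> v \<in> parab (V n)"
  using parab_mono[OF J_sub] by blast

lemma rkc_le: "v \<in> parab (J n) \<Longrightarrow> rkc n g \<le> glen (V n) (v + g)"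
  unfolding rkc_def by (rule Least_le) blast

lemma rkc_attained: "\<exists>v \<in> parab (J n). glen (V n) (v + g) = rkc n g"
  unfolding rkc_def by (rule LeastI_ex) (use is_subgroupD(1)[OF JG] in blast)

lemma rkc_J: "v \<in> parab (J n) \<Longrightarrow> rkc n (v + g) \<le> rkc n g"
proof -
  assume v: "v \<in> parab (J n)"
  obtain v' where v': "v' \<in> parab (J n)" "glen (V n) (v' + g) = rkc n g" using rkc_attained by blast
  have "v' - v \<in> parab (J n)" using is_subgroupD(4)[OF JG v'(1) v] .
  from rkc_le[OF this, of "v + g"] show ?thesis using v'(2) by (simp add: add.assoc[symmetric])
qed

lemma rk_le: "g \<in> parab (V n) \<Longrightarrow> rk n (chamber n g) \<le> rkc n g"
proof -
  assume g: "g \<in> parab (V n)"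
  obtain v where v: "v \<in> parab (J n)" "glen (V n) (v + g) = rkc n g" using rkc_attained by blast
  have "v + g \<in> parab (V n)" using J_V[OF v(1)] g is_subgroupD(2)[OF VG] by blast
  moreover have "chamber n (v + g) = chamber n g" by (rule chamber_J_add[OF n v(1)])
  ultimately show ?thesis unfolding rk_def using v(2) by (intro Least_le) blast
qed

lemma rk_attained:
  assumes "g \<in> parab (V n)"
  shows "\<exists>w \<in> parab (V n). chamber n w = chamber n g \<and> glen (V n) w = rk n (chamber n g)"
  unfolding rk_def by (rule LeastI_ex) (use assms in blast)

text \<open>Passing to a shorter element by a left descent deletes a letter from a word for
  \<open>g = v w\<close> with \<open>v\<close> in the symmetric group and \<open>w\<close> of minimal length in its
  coset: either the coset remains the same or its minimal length drops.\<close>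

lemma descent_coset:
  assumes g: "g \<in> parab (V n)" and t: "t \<in> V n" and d: "neg (ap (- g) (root t))"
  shows "(\<exists>v \<in> parab (J n). gw [t] + g = v + g) \<or> rkc n (gw [t] + g) < rkc n g"
proof -
  obtain v0 where v0: "v0 \<in> parab (J n)" "glen (V n) (v0 + g) = rkc n g" using rkc_attained by blast
  have "v0 + g \<in> parab (V n)" using J_V[OF v0(1)] g is_subgroupD(2)[OF VG] by blast
  then obtain ws where ws: "ws \<in> lists (V n)" "gw ws = v0 + g" "length ws = glen (V n) (v0 + g)"
    by (rule glen_word)
  obtain vs where vs: "vs \<in> lists (J n)" "- v0 = gw vs"
    using is_subgroupD(3)[OF JG v0(1)] by (auto simp: parab_def)
  have lS: "u \<in> lists (V (Suc M))" if "u \<in> lists (V n)" for u using that VS by (auto simp: in_lists_conv_set)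
  have vsV: "vs \<in> lists (V n)" using vs(1) J_sub by (auto simp: in_lists_conv_set)
  have g_eq: "g = gw (vs @ ws)"
    using gw_append[OF lS[OF vsV] lS[OF ws(1)]] ws(2) by (simp flip: vs(2) add: add.assoc[symmetric])
  have "vs @ ws \<in> lists (V n)" using vsV ws(1) by auto
  from exchange_parab[OF VS this t] d g_eq obtain u1 s u2 where
    u: "vs @ ws = u1 @ s # u2" "gw [t] + g = gw (u1 @ u2)" by auto
  from u(1) consider us where "vs = u1 @ s # us" "u2 = us @ ws" | us where "u1 = vs @ us" "ws = us @ s # u2"
    by (auto simp: append_eq_append_conv2 append_eq_Cons_conv Cons_eq_append_conv)
  then show ?thesis
  proof cases
    case 1
    have uJ: "u1 @ us \<in> lists (J n)" using vs(1) 1(1) by auto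
    then have uV: "u1 @ us \<in> lists (V n)" using J_sub by (auto simp: in_lists_conv_set)
    have "gw [t] + g = gw (u1 @ us) + gw ws"
      using u(2) gw_append[OF lS[OF uV] lS[OF ws(1)]] 1(2) by simp
    also have "\<dots> = (gw (u1 @ us) + v0) + g" by (simp add: ws(2) add.assoc)
    finally have "gw [t] + g = (gw (u1 @ us) + v0) + g" .
    moreover have "gw (u1 @ us) \<in> parab (J n)" using uJ by (auto simp: parab_def)
    then have "gw (u1 @ us) + v0 \<in> parab (J n)" using is_subgroupD(2)[OF JG _ v0(1)] by blast
    ultimately show ?thesis by blast
  next
    case 2
    have uV: "us @ u2 \<in> lists (V n)" using ws(1) 2(2) by auto
    have "gw [t] + g = gw vs + gw (us @ u2)"
      using u(2) gw_append[OF lS[OF vsV] lS[OF uV]] 2(1) by simp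
    then have "v0 + (gw [t] + g) = gw (us @ u2)" by (simp flip: vs(2))
    then have "rkc n (gw [t] + g) \<le> glen (V n) (gw (us @ u2))" using rkc_le[OF v0(1), of "gw [t] + g"] by simp
    also have "\<dots> \<le> length (us @ u2)" by (rule glen_le[OF uV])
    also have "\<dots> < length ws" by (simp add: 2(2))
    finally show ?thesis using ws(3) v0(2) by simp
  qed
qed

text \<open>Follow left descents in T from g to the element of its coset that has none. Since
  \<open>rkc\<close> never increases on the way, either the final chamber is the initial one, or
  some first step leaves it, and that step lowers \<open>rkc\<close>. The witnesses
  \<open>u'\<close> and \<open>t\<close> record this step for the shelling.\<close>

lemma descend:
  assumes T: "T \<subseteq> V n" and g: "g \<in> parab (V n)"
  shows "\<exists>u \<in> parab T. (\<forall>t\<in>T. pos (ap (- (u + g)) (root t))) \<and>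
    (chamber n (u + g) = chamber n g \<or> rkc n (u + g) < rkc n g \<and>
      (\<exists>u' \<in> parab T. \<exists>t \<in> T. chamber n (u' + g) = chamber n g \<and>
        chamber n (gw [t] + (u' + g)) \<noteq> chamber n g \<and> rkc n (gw [t] + (u' + g)) < rkc n g)) \<and>
    rkc n (u + g) \<le> rkc n g"
  using g
proof (induction "glen (V n) g" arbitrary: g rule: less_induct)
  case (less g)
  have TG: "is_subgroup (parab T)" using T VS by (intro parab_subgroup) blast
  note T0 = is_subgroupD(1)[OF TG]
  show ?case
  proof (cases "\<forall>t\<in>T. pos (ap (- g) (root t))")
    case True
    then show ?thesis using T0 by (intro bexI[of _ 0]) auto
  next
    case False
    then obtain t where t: "t \<in> T" "\<not> pos (ap (- g) (root t))" by blast
    have tV: "t \<in> V n" using t(1) T by blast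
    have d: "neg (ap (- g) (root t))"
      using parab_dichotomy[OF VS is_subgroupD(3)[OF VG less.prems] tV] t(2) by blast
    define g1 where "g1 = gw [t] + g"
    have gt: "gw [t] \<in> parab T" "gw [t] \<in> parab (V n)" using t(1) tV by (auto intro: gen_in_parab)
    have g1V: "g1 \<in> parab (V n)" unfolding g1_def using gt(2) less.prems is_subgroupD(2)[OF VG] by blast
    have lt: "glen (V n) g1 < glen (V n) g" unfolding g1_def by (rule glen_descent[OF VS less.prems tV d])
    obtain u where u: "u \<in> parab T" "\<forall>t\<in>T. pos (ap (- (u + g1)) (root t))" "rkc n (u + g1) \<le> rkc n g1"
      and alt: "chamber n (u + g1) = chamber n g1 \<or> rkc n (u + g1) < rkc n g1 \<and>
        (\<exists>u' \<in> parab T. \<exists>t \<in> T. chamber n (u' + g1) = chamber n g1 \<and>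
        chamber n (gw [t] + (u' + g1)) \<noteq> chamber n g1 \<and> rkc n (gw [t] + (u' + g1)) < rkc n g1)"
      using less.hyps[OF lt g1V] by blast
    have ug: "(u + gw [t]) + g = u + g1" "\<And>u'. (u' + gw [t]) + g = u' + g1" by (simp_all add: g1_def add.assoc)
    have ut: "u' + gw [t] \<in> parab T" if "u' \<in> parab T" for u' using that gt(1) is_subgroupD(2)[OF TG] by blast
    have dc: "chamber n g1 = chamber n g \<and> rkc n g1 \<le> rkc n g \<or> rkc n g1 < rkc n g"
      using descent_coset[OF less.prems tV d] chamber_J_add[OF n] rkc_J unfolding g1_def by metis
    then have le: "rkc n g1 \<le> rkc n g" by auto
    have res: "chamber n (u + g1) = chamber n g \<or> rkc n (u + g1) < rkc n g \<and>
      (\<exists>u' \<in> parab T. \<exists>t \<in> T. chamber n (u' + g) = chamber n g \<and>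
        chamber n (gw [t] + (u' + g)) \<noteq> chamber n g \<and> rkc n (gw [t] + (u' + g)) < rkc n g)"
    proof (cases "chamber n g1 = chamber n g")
      case True
      show ?thesis
      proof (cases "chamber n (u + g1) = chamber n g1")
        case False
        then obtain u' t' where u': "u' \<in> parab T" "t' \<in> T" "chamber n (u' + g1) = chamber n g1"
            "chamber n (gw [t'] + (u' + g1)) \<noteq> chamber n g1" "rkc n (gw [t'] + (u' + g1)) < rkc n g1"
            "rkc n (u + g1) < rkc n g1"
          using alt by blast
        show ?thesis
          using u'(2-) True le ut[OF u'(1)]
          by (intro disjI2 conjI bexI[of _ "u' + gw [t]"] bexI[of _ t']) (auto simp: ug)
      qed (simp add: True)
    next
      case False
      then have "rkc n g1 < rkc n g" using dc by blast
      then show ?thesis using False t(1) T0 u(3)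
        by (intro disjI2 conjI bexI[of _ 0] bexI[of _ t]) (auto simp: g1_def)
    qed
    show ?thesis
      using u(1,2,3) res le by (intro bexI[OF _ ut[OF u(1)]]) (auto simp: ug)
  qed
qed

text \<open>Choose representatives g and g' in which the k common vertices of L and L' are the
  images of the first k letters. They differ by an element of W_{n-k}, so their descents end at the
  same element. The descent from g must leave L, and the step at which it does so provides f and
  L''.\<close>

lemma shelling:
  assumes L: "L \<in> chamber n ` P (Suc n)" "L' \<in> chamber n ` P (Suc n)" and ne: "L \<noteq> L'" and r: "rk n L' \<le> rk n L"
  shows "\<exists>f\<in>L - L'. \<exists>L''\<in>chamber n ` P (Suc n). rk n L'' < rk n L \<and> L - {f} \<subseteq> L''"
proof -
  have PV: "P (Suc n) = parab (V n)" using n by (simp add: P_Suc_eq)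
  obtain w where w: "w \<in> parab (V n)" "chamber n w = L" "glen (V n) w = rk n L"
    using L(1) rk_attained PV by blast
  obtain w' where w': "w' \<in> parab (V n)" "chamber n w' = L'" "glen (V n) w' = rk n L'"
    using L(2) rk_attained PV by blast
  have fin: "finite L" "finite L'" "card L = Suc n" "card L' = Suc n"
    using card_chamber[of n w] card_chamber[of n w'] w(2) w'(2) by auto
  obtain xs where xs: "set xs = L \<inter> L'" "distinct xs" using finite_distinct_list[of "L \<inter> L'"] fin(1) by auto
  define k where "k = length xs"
  have "card (L \<inter> L') < Suc n"
  proof (rule ccontr)
    assume "\<not> ?thesis"
    then have "L \<inter> L' = L" "L \<inter> L' = L'"
      using fin card_seteq[of L "L \<inter> L'"] card_seteq[of L' "L \<inter> L'"] by auto
    then show False using ne by blast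
  qed
  moreover have "k = card (L \<inter> L')" using xs distinct_card[of xs] by (simp add: k_def)
  ultimately have k: "k \<le> n" by simp
  define T where "T = V (n - k)"
  have T: "T \<subseteq> V n" unfolding T_def by (rule V_mono) simp
  have TS: "T \<subseteq> V (Suc M)" using T VS by blast
  have TG: "is_subgroup (parab T)" by (rule parab_subgroup[OF TS])
  have PT: "P (Suc n - k) = parab T" using k n by (simp add: T_def Suc_diff_le P_Suc_eq)
  have fixT: "lact (B n k) u = B n k" if "u \<in> parab T" for u using B_fixed[OF n, of k u] k that PT by simp
  have xw: "xs \<in> inj_words (chamber n w) k" "xs \<in> inj_words (chamber n w') k"
    using xs w(2) w'(2) by (auto simp: inj_words_def k_def)
  obtain v where v: "v \<in> parab (J n)" "lact (B n k) (v + w) = xs" using words_transitive_chamber[OF n xw(1)] by blast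
  obtain v' where v': "v' \<in> parab (J n)" "lact (B n k) (v' + w') = xs" using words_transitive_chamber[OF n xw(2)] by blast
  define g where "g = v + w"
  define g' where "g' = v' + w'"
  have gV: "g \<in> parab (V n)" "g' \<in> parab (V n)"
    unfolding g_def g'_def using J_V v(1) v'(1) w(1) w'(1) is_subgroupD(2)[OF VG] by blast+
  have Lg: "chamber n g = L" "chamber n g' = L'"
    unfolding g_def g'_def using chamber_J_add[OF n] v(1) v'(1) w(2) w'(2) by auto
  have v0: "0 \<in> parab (J n)" by (rule is_subgroupD(1)[OF JG])
  have rg: "rkc n g \<le> rk n L" "rkc n g' \<le> rk n L'"
    using rkc_J[OF v(1), of w] rkc_J[OF v'(1), of w'] rkc_le[OF v0, of w] rkc_le[OF v0, of w'] w(3) w'(3)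
    by (auto simp: g_def g'_def)
  \<comment> \<open>h fixes the base word with k letters and therefore lies in its stabiliser
    W_{n-k}.\<close>
  define h where "h = g + - g'"
  have "lact (B n k) h = lact xs (- g')" unfolding h_def lact_add using v(2) by (simp add: g_def)
  also have "\<dots> = B n k" using v'(2) lact_minus[where xs = "B n k" and g = g'] by (simp add: g'_def)
  finally have "lact (B n k) h = B n k" .
  moreover have "h \<in> parab (V n)" unfolding h_def using gV is_subgroupD(2,3)[OF VG] by blast
  ultimately have h: "h \<in> parab T" using B_stabilizer[OF n, of k h] k PT PV by simp
  have hg: "g = h + g'" by (simp add: h_def)
  obtain u where u: "u \<in> parab T" "\<forall>t\<in>T. pos (ap (- (u + g)) (root t))"
    and alt: "chamber n (u + g) = L \<or> (\<exists>u' \<in> parab T. \<exists>t \<in> T. chamber n (u' + g) = L \<and>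
        chamber n (gw [t] + (u' + g)) \<noteq> L \<and> rkc n (gw [t] + (u' + g)) < rkc n g)"
    using descend[OF T gV(1)] unfolding Lg by blast
  obtain u' where u': "u' \<in> parab T" "\<forall>t\<in>T. pos (ap (- (u' + g')) (root t))"
    and alt': "chamber n (u' + g') = L' \<or> rkc n (u' + g') < rkc n g'"
    using descend[OF T gV(2)] unfolding Lg by blast
  have e: "u + g = u' + g'"
  proof -
    define x where "x = u + h + - u'"
    have x: "x \<in> parab T" unfolding x_def using u(1) h u'(1) is_subgroupD(2,3)[OF TG] by blast
    have xe: "x + (u' + g') = u + g"
      by (simp add: x_def hg add.assoc del: add_uminus_conv_diff)
    have "u' + g' \<in> parab (V n)" using u'(1) gV(2) parab_mono[OF T] is_subgroupD(2)[OF VG] by blast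
    then have "u' + g' \<in> parab (V (Suc M))" using parab_mono[OF VS] by blast
    from minimal_unique[OF TS this x] u(2) u'(2) xe have "x = 0" by simp
    then show ?thesis using xe by simp
  qed
  \<comment> \<open>Otherwise the descent from g' ends in L, which differs from L', so it lowers the
    rank; this gives rk L < rk L', against the assumption.\<close>
  have "chamber n (u + g) \<noteq> L"
  proof
    assume c: "chamber n (u + g) = L"
    then have "rkc n (u' + g') < rkc n g'" using alt' ne e by auto
    moreover have "u + g \<in> parab (V n)" using u(1) gV(1) parab_mono[OF T] is_subgroupD(2)[OF VG] by blast
    then have "rk n L \<le> rkc n (u + g)" using rk_le c by metis
    ultimately show False using e rg(2) r by simp
  qed
  then obtain u1 t where u1: "u1 \<in> parab T" "t \<in> T" "chamber n (u1 + g) = L"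
      "chamber n (gw [t] + (u1 + g)) \<noteq> L" "rkc n (gw [t] + (u1 + g)) < rkc n g"
    using alt by blast
  define g1 where "g1 = u1 + g"
  have g1V: "g1 \<in> parab (V n)" unfolding g1_def using u1(1) gV(1) parab_mono[OF T] is_subgroupD(2)[OF VG] by blast
  have tV: "t \<in> V n" using u1(2) T by blast
  have tg1: "gw [t] + g1 \<in> parab (V n)" using gen_in_parab[OF tV] g1V is_subgroupD(2)[OF VG] by blast
  \<comment> \<open>Reflections of the tail preserve the chamber, so the step leaving L belongs to a
    vertex of \<Gamma>_0. Such a reflection fixes every \<delta>_j with j > 0, and only the vertex
    \<delta>_0 g1 of L can be lost.\<close>
  have "t \<notin> J n"
  proof
    assume "t \<in> J n"
    then have "chamber n (gw [t] + g1) = chamber n g1" by (intro chamber_J_add[OF n] gen_in_parab)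
    then show False using u1(3,4) by (simp add: g1_def)
  qed
  then obtain a where a: "t = Inl a" "a \<in> S0" using tV by (cases t) (auto simp: J_def)
  have fix_t: "pull (\<delta> j) (gw [t]) = \<delta> j" if "j \<noteq> 0" for j
    using a that by (intro delta_fixed) (auto simp: delta_root_Inl)
  define f where "f = pull (\<delta> 0) g1"
  have fL: "f \<in> L" using u1(3) by (auto simp: f_def chamber_def g1_def)
  have "lact (B n k) g1 = xs"
    unfolding g1_def lact_add fixT[OF u1(1)] using v(2) by (simp add: g_def)
  then have xs_eq: "set xs = (\<lambda>i. pull (\<delta> (n - i)) g1) ` {..<k}" by (auto simp: base_def)
  \<comment> \<open>The common vertices are \<delta>_{n-i} g1 with i < k <= n, so none of them has
    index 0.\<close>
  have "f \<notin> set xs"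
  proof
    assume "f \<in> set xs"
    then obtain i where "i < k" "pull (\<delta> 0) g1 = pull (\<delta> (n - i)) g1" unfolding xs_eq f_def by blast
    then show False using pull_inj delta_inj k by fastforce
  qed
  then have fL': "f \<in> L - L'" using fL xs(1) by blast
  have "L - {f} \<subseteq> chamber n (gw [t] + g1)"
  proof
    fix x assume x: "x \<in> L - {f}"
    then obtain j where j: "j \<le> n" "x = pull (\<delta> j) g1" using u1(3) by (auto simp: chamber_def g1_def)
    then have "j \<noteq> 0" using x by (auto simp: f_def)
    then have "x = pull (\<delta> j) (gw [t] + g1)" using j(2) fix_t by (simp add: pull_add)
    then show "x \<in> chamber n (gw [t] + g1)" using j(1) by (auto simp: chamber_def)
  qed
  moreover have "rk n (chamber n (gw [t] + g1)) < rk n L"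
    using rk_le[OF tg1] u1(5) rg(1) by (simp add: g1_def)
  ultimately show ?thesis using fL' tg1 PV by blast
qed

end

lemma B_exact:
  fixes z :: "(('a + nat \<Rightarrow> real) \<Rightarrow> real) list \<Rightarrow>\<^sub>0 'c::ab_group_add"
  assumes n: "n \<le> M" and k: "k \<le> n" and z: "keys z \<subseteq> {lact (B n k) g |g. g \<in> P (Suc n)}" "bdl z = 0"
  shows "\<exists>b. keys b \<subseteq> {lact (B n (Suc k)) g |g. g \<in> P (Suc n)} \<and> bdl b = z"
proof -
  have ks: "k \<le> Suc n" "Suc k \<le> Suc n" using k by auto
  show ?thesis
    unfolding orbit_eq[OF n ks(2)]
  proof (rule shellable_exact[of "chamber n ` P (Suc n)" "Suc n" "rk n" z k])
    show "keys z \<subseteq> (\<Union>L\<in>chamber n ` P (Suc n). inj_words L k)" using z(1) orbit_eq[OF n ks(1)] by simp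
  qed (use card_chamber shelling[OF n] k z(2) in auto)
qed

sublocale tower: tower pull P \<delta> M "TYPE('c::ab_group_add)"
proof
  fix n k g i and t :: "(('a + nat \<Rightarrow> real) \<Rightarrow> real) list \<Rightarrow>\<^sub>0 'c"
  show "is_subgroup (P n)" by (rule P_subgroup)
  show "P n \<subseteq> P (Suc n)" by (rule P_mono_Suc)
  assume n: "n \<le> M"
  show "lact (B n k) g = B n k \<longleftrightarrow> g \<in> P (Suc n - k)" if "k \<le> Suc n" "g \<in> P (Suc n)"
    using B_fixed[OF n] B_stabilizer[OF n] that by blast
  assume k: "k \<le> n"
  show "\<exists>c \<in> P (Suc n). (\<forall>h \<in> P (n - k). h + c = c + h) \<and> del i (B n (Suc k)) = lact (B n k) c"
    if "i \<le> k" using B_face[OF n k that] .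
  show "\<exists>b. keys b \<subseteq> {lact (B n (Suc k)) g |g. g \<in> P (Suc n)} \<and> bdl b = t"
    if "keys t \<subseteq> {lact (B n k) g |g. g \<in> P (Suc n)}" "bdl t = 0"
    using B_exact[OF n k that] .
qed

end

section \<open>Transfer to the inhomogeneous bar complex of the quotient groups\<close>

definition tuples :: "('g, 'b) monoid_scheme \<Rightarrow> nat \<Rightarrow> 'g list set" where
  "tuples G k = {x. set x \<subseteq> carrier G \<and> length x = k}"

lemma bar_chains_lookup:
  fixes G :: "('a, 'b) monoid_scheme"
  shows "(bar_chains G k :: ('a list \<Rightarrow> 'c::ab_group_add) set) = lookup ` {p. keys p \<subseteq> tuples G k}"
proof
  show "bar_chains G k \<subseteq> lookup ` {p :: 'a list \<Rightarrow>\<^sub>0 'c. keys p \<subseteq> tuples G k}"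
  proof
    fix f :: "'a list \<Rightarrow> 'c" assume f: "f \<in> bar_chains G k"
    then have l: "lookup (Abs_poly_mapping f) = f" by (simp add: bar_chains_def)
    have "keys (Abs_poly_mapping f) \<subseteq> tuples G k"
      using f by (auto simp: in_keys_iff l bar_chains_def tuples_def)
    then show "f \<in> lookup ` {p. keys p \<subseteq> tuples G k}" using l by (intro image_eqI[of _ _ "Abs_poly_mapping f"]) auto
  qed
  show "lookup ` {p :: 'a list \<Rightarrow>\<^sub>0 'c. keys p \<subseteq> tuples G k} \<subseteq> bar_chains G k"
  proof
    fix f :: "'a list \<Rightarrow> 'c" assume "f \<in> lookup ` {p. keys p \<subseteq> tuples G k}"
    then obtain p where p: "f = lookup p" "keys p \<subseteq> tuples G k" by blast
    have "{x. f x \<noteq> 0} = keys p" by (auto simp: p(1) in_keys_iff)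
    then show "f \<in> bar_chains G k" using p by (auto simp: bar_chains_def tuples_def in_keys_iff)
  qed
qed

definition bar_bd_gen :: "('g, 'b) monoid_scheme \<Rightarrow> nat \<Rightarrow> 'g list \<Rightarrow> 'c::ab_group_add \<Rightarrow> ('g list \<Rightarrow>\<^sub>0 'c)" where
  "bar_bd_gen G k x c = (\<Sum>i\<in>{0..k}. single (bar_face G k i x) (sg i c))"

definition bar_bd :: "('g, 'b) monoid_scheme \<Rightarrow> nat \<Rightarrow> ('g list \<Rightarrow>\<^sub>0 'c::ab_group_add) \<Rightarrow> ('g list \<Rightarrow>\<^sub>0 'c)" where
  "bar_bd G k = lin (bar_bd_gen G k)"

lemma additive_bar_bd_gen: "additive (bar_bd_gen G k x)"
  by standard (simp add: bar_bd_gen_def sum.distrib single_add additive.add[OF additive_sg])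

lemma additive_bar_bd: "additive (bar_bd G k)"
  unfolding bar_bd_def by (rule additive_lin[OF additive_bar_bd_gen])

lemma bar_d_lookup: "k > 0 \<Longrightarrow> bar_d G k (lookup p) = lookup (bar_bd G k p)"
  by (rule ext)
    (simp add: bar_d_def bar_bd_def bar_bd_gen_def lin_def lookup_sum lookup_single when_def sg_def keys.rep_eq)

lemma bar_push_lookup: "bar_push \<phi> (lookup p) = lookup (push (map \<phi>) p)"
proof
  fix y
  have "lookup (push (map \<phi>) p) y = (\<Sum>x\<in>keys p. if map \<phi> x = y then lookup p x else 0)"
    by (simp add: push_def lin_def lookup_sum lookup_single when_def)
  also have "\<dots> = (\<Sum>x\<in>keys p \<inter> {x. map \<phi> x = y}. lookup p x)"
    by (simp add: sum.inter_restrict)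
  also have "keys p \<inter> {x. map \<phi> x = y} = {x. lookup p x \<noteq> 0 \<and> map \<phi> x = y}"
    by (auto simp: in_keys_iff)
  finally show "bar_push \<phi> (lookup p) y = lookup (push (map \<phi>) p) y" by (simp add: bar_push_def)
qed

lemma diffs_Cons_psums: "diffs (u # psums v gs) = (- u + v) # gs"
  using diffs_psums[of v gs] by (cases gs) auto

text \<open>Deleting a vertex merges two neighbouring differences, or drops the first or last one:
  exactly the faces of the inhomogeneous bar complex.\<close>

lemma diffs_del_psums:
  assumes "i \<le> length gs" "gs \<noteq> []"
  shows "diffs (del i (psums u gs)) =
    (if i = 0 then tl gs else if i = length gs then butlast gs
     else take (i - 1) gs @ [gs ! (i - 1) + gs ! i] @ drop (i + 1) gs)"
  using assms
proof (induction gs arbitrary: i u)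
  case (Cons g gs)
  show ?case
  proof (cases i)
    case 0
    then show ?thesis by (simp add: del_Cons)
  next
    case (Suc j)
    show ?thesis
    proof (cases j)
      case 0
      show ?thesis
      proof (cases gs)
        case Nil
        then show ?thesis by (simp add: Suc 0 del_Cons)
      next
        case (Cons g' gs')
        have "- u + (u + g + g') = g + g'" by (simp add: add.assoc)
        then show ?thesis by (simp add: Suc 0 del_Cons Cons diffs_Cons_psums)
      qed
    next
      case (Suc l)
      then have gs: "gs \<noteq> []" "j \<le> length gs" "j > 0" using Cons.prems \<open>i = Suc j\<close> by auto
      obtain vs where vs: "psums (u + g) gs = (u + g) # vs" by (cases gs) auto
      have "del j (psums (u + g) gs) = (u + g) # del l vs" by (simp add: vs Suc del_Cons)
      then have "diffs (del i (psums u (g # gs))) = g # diffs (del j (psums (u + g) gs))"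
        by (simp add: \<open>i = Suc j\<close> del_Cons add.assoc[symmetric])
      then show ?thesis
        using Cons.IH[OF gs(2,1), of "u + g"] gs \<open>i = Suc j\<close> Suc by simp
    qed
  qed
qed simp

lemma keys_bar_bd:
  assumes closed: "\<And>x y. x \<in> carrier G \<Longrightarrow> y \<in> carrier G \<Longrightarrow> x \<otimes>\<^bsub>G\<^esub> y \<in> carrier G"
    and p: "keys p \<subseteq> tuples G (Suc k)"
  shows "keys (bar_bd G (Suc k) p) \<subseteq> tuples G k"
proof (rule keys_additive_subset[OF additive_bar_bd])
  fix x and c assume "x \<in> keys p"
  then have x: "set x \<subseteq> carrier G" "length x = Suc k" using p by (auto simp: tuples_def)
  have face: "bar_face G (Suc k) i x \<in> tuples G k" if "i \<le> Suc k" for i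
  proof -
    consider "i = 0" | "i = Suc k" | "0 < i" "i < Suc k" using \<open>i \<le> Suc k\<close> by linarith
    then show ?thesis
    proof cases
      case 1
      then show ?thesis using x by (cases x) (auto simp: bar_face_def tuples_def)
    next
      case 2
      then show ?thesis using x by (auto simp: bar_face_def tuples_def dest: in_set_butlastD)
    next
      case 3
      then have "x ! (i - 1) \<in> carrier G" "x ! i \<in> carrier G" using x nth_mem[of "i - 1" x] nth_mem[of i x] by auto
      then have "x ! (i - 1) \<otimes>\<^bsub>G\<^esub> x ! i \<in> carrier G" by (rule closed)
      then show ?thesis using 3 x by (auto simp: bar_face_def tuples_def dest: in_set_takeD in_set_dropD)
    qed
  qed
  have "keys (bar_bd G (Suc k) (single x c)) \<subseteq> (\<Union>i\<in>{0..Suc k}. keys (single (bar_face G (Suc k) i x) (sg i c)))"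
    unfolding bar_bd_def lin_single[OF additive_bar_bd_gen] bar_bd_gen_def by (rule keys_sum_subset)
  also have "\<dots> \<subseteq> tuples G k" using face by (auto split: if_splits)
  finally show "keys (bar_bd G (Suc k) (single x c)) \<subseteq> tuples G k" .
qed

section \<open>Comparison of bar complexes over the empty word\<close>

context gset
begin

definition tr :: "('m \<Rightarrow> 'g) \<Rightarrow> ('m list \<Rightarrow>\<^sub>0 'c::ab_group_add) \<Rightarrow> ('x list \<times> 'g list \<Rightarrow>\<^sub>0 'c)" where
  "tr \<psi> = push (\<lambda>x. ([], map \<psi> x))"

lemma additive_tr: "additive (tr \<psi>)"
  unfolding tr_def by (rule additive_push)

context
  fixes G :: "('m, 'b) monoid_scheme" and \<psi> :: "'m \<Rightarrow> 'g" and H :: "'g set"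
  assumes bij: "bij_betw \<psi> (carrier G) H"
    and hom: "\<And>x y. x \<in> carrier G \<Longrightarrow> y \<in> carrier G \<Longrightarrow> \<psi> (x \<otimes>\<^bsub>G\<^esub> y) = \<psi> x + \<psi> y"
begin

lemma tr_CC:
  assumes p: "keys p \<subseteq> tuples G k"
  shows "tr \<psi> p \<in> CC {[]} H k"
proof -
  have "([], map \<psi> x) \<in> {[]} \<times> {gs. set gs \<subseteq> H \<and> length gs = k}" if "x \<in> keys p" for x
  proof -
    have "x \<in> tuples G k" using p that by blast
    then show ?thesis using bij_betw_imp_surj_on[OF bij] by (auto simp: tuples_def)
  qed
  then show ?thesis using keys_push[of "\<lambda>x. ([], map \<psi> x)" p] unfolding tr_def CC_def by blast
qed

lemma tr_surj:
  assumes y: "y \<in> CC {[]} H k"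
  shows "\<exists>p. keys p \<subseteq> tuples G k \<and> tr \<psi> p = y"
proof -
  define \<psi>' where "\<psi>' = inv_into (carrier G) \<psi>"
  have \<psi>': "\<psi>' h \<in> carrier G" "\<psi> (\<psi>' h) = h" if "h \<in> H" for h
    using bij_betw_imp_surj_on[OF bij] that by (auto simp: \<psi>'_def inv_into_into f_inv_into_f)
  define p where "p = push (\<lambda>u. map \<psi>' (snd u)) y"
  have "keys p \<subseteq> tuples G k"
    using keys_push[of "\<lambda>u. map \<psi>' (snd u)" y] y \<psi>'(1) unfolding p_def CC_def tuples_def by fastforce
  moreover have "tr \<psi> p = push (\<lambda>u. u) y"
    unfolding tr_def p_def push_push
  proof (rule push_cong)
    fix u assume "u \<in> keys y"
    then have "u \<in> {[]} \<times> {gs. set gs \<subseteq> H \<and> length gs = k}" using y unfolding CC_def by blast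
    then show "([], map \<psi> (map \<psi>' (snd u))) = u"
      using \<psi>'(2) by (cases u) (auto intro!: map_idI)
  qed
  ultimately show ?thesis by auto
qed

lemma tr_inj:
  fixes p q :: "'m list \<Rightarrow>\<^sub>0 'c::ab_group_add"
  assumes p: "keys p \<subseteq> tuples G k" and q: "keys q \<subseteq> tuples G k" and e: "tr \<psi> p = tr \<psi> q"
  shows "p = q"
proof -
  define \<psi>' where "\<psi>' = inv_into (carrier G) \<psi>"
  have \<psi>': "\<psi>' (\<psi> x) = x" if "x \<in> carrier G" for x
    using bij that by (simp add: \<psi>'_def bij_betw_def)
  have recover: "push (\<lambda>u. map \<psi>' (snd u)) (tr \<psi> p) = p" if "keys p \<subseteq> tuples G k" for p :: "'m list \<Rightarrow>\<^sub>0 'c"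
  proof -
    have "push (\<lambda>u. map \<psi>' (snd u)) (tr \<psi> p) = push (\<lambda>x. x) p"
      unfolding tr_def push_push
    proof (rule push_cong)
      fix x assume "x \<in> keys p"
      then have "x \<in> tuples G k" using that by blast
      then show "map \<psi>' (snd ([] :: 'x list, map \<psi> x)) = x"
        using \<psi>' by (auto simp: tuples_def intro!: map_idI)
    qed
    then show ?thesis by simp
  qed
  have "p = push (\<lambda>u. map \<psi>' (snd u)) (tr \<psi> p)" by (rule recover[OF p, symmetric])
  also have "\<dots> = q" unfolding e by (rule recover[OF q])
  finally show ?thesis .
qed

lemma tr_bd:
  assumes p: "keys p \<subseteq> tuples G (Suc k)"
  shows "tr \<psi> (bar_bd G (Suc k) p) = dv (tr \<psi> p)"
proof (rule additive_eqI[of "\<lambda>p. tr \<psi> (bar_bd G (Suc k) p)" "\<lambda>p. dv (tr \<psi> p)"])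
  show "additive (\<lambda>p. tr \<psi> (bar_bd G (Suc k) p))" by (rule additive_comp[OF additive_tr additive_bar_bd])
  show "additive (\<lambda>p. dv (tr \<psi> p))" by (rule additive_comp[OF additive_dv additive_tr])
  fix x and c assume "x \<in> keys p"
  then have x: "set x \<subseteq> carrier G" "length x = Suc k" using p by (auto simp: tuples_def)
  then have ne: "map \<psi> x \<noteq> []" by auto
  have face: "bar_simplex [] (del i (psums 0 (map \<psi> x))) = ([], map \<psi> (bar_face G (Suc k) i x))" if "i \<le> Suc k" for i
  proof -
    consider "i = 0" | "i = Suc k" | "0 < i" "i < Suc k" using \<open>i \<le> Suc k\<close> by linarith
    then have "diffs (del i (psums 0 (map \<psi> x))) = map \<psi> (bar_face G (Suc k) i x)"
    proof cases
      case 3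
      then have c: "x ! (i - 1) \<in> carrier G" "x ! i \<in> carrier G" using x nth_mem[of "i - 1" x] nth_mem[of i x] by auto
      have "i \<le> length (map \<psi> x)" using 3 x(2) by simp
      from diffs_del_psums[OF this ne] show ?thesis
        using 3 x(2) hom[OF c] by (simp add: bar_face_def take_map drop_map)
    qed (use diffs_del_psums[OF _ ne, of i] x(2) in \<open>simp_all add: bar_face_def map_tl map_butlast\<close>)
    then show ?thesis by (simp add: bar_simplex_def)
  qed
  have "dv (tr \<psi> (single x c)) = (\<Sum>i<length (psums 0 (map \<psi> x)). single (bar_simplex [] (del i (psums 0 (map \<psi> x)))) (sg i c))"
    unfolding tr_def push_single dv_single dv_gen_eq[OF ne] list_bd_sum push_sum push_single ..
  also have "{..<length (psums 0 (map \<psi> x))} = {0..Suc k}" using x(2) by auto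
  also have "(\<Sum>i\<in>{0..Suc k}. single (bar_simplex [] (del i (psums 0 (map \<psi> x)))) (sg i c)) =
      (\<Sum>i\<in>{0..Suc k}. single ([], map \<psi> (bar_face G (Suc k) i x)) (sg i c))"
    by (rule sum.cong) (auto simp: face)
  also have "\<dots> = tr \<psi> (bar_bd G (Suc k) (single x c))"
    unfolding tr_def bar_bd_def lin_single[OF additive_bar_bd_gen] bar_bd_gen_def push_sum push_single ..
  finally show "tr \<psi> (bar_bd G (Suc k) (single x c)) = dv (tr \<psi> (single x c))" ..
qed

lemma cycle_tr:
  assumes p: "keys p \<subseteq> tuples G k" and z: "lookup p \<in> bar_cycles G k"
  shows "tr \<psi> p \<in> bcyc H k"
proof (cases k)
  case 0
  then show ?thesis using tr_CC[OF p] dv_degree_0[of "tr \<psi> p" "{[]}" H] by (simp add: bcyc_def)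
next
  case (Suc j)
  have "lookup (bar_bd G k p) = (\<lambda>_. 0)" using z bar_d_lookup[of k G p] Suc by (simp add: bar_cycles_def)
  then have "bar_bd G k p = 0" by (intro poly_mapping_eqI) simp
  then show ?thesis using tr_CC[OF p] tr_bd[of p j] p Suc
    by (simp add: bcyc_def additive.zero[OF additive_tr])
qed

lemma tr_cycle:
  assumes closed: "\<And>x y. x \<in> carrier G \<Longrightarrow> y \<in> carrier G \<Longrightarrow> x \<otimes>\<^bsub>G\<^esub> y \<in> carrier G"
    and p: "keys p \<subseteq> tuples G k" and z: "tr \<psi> p \<in> bcyc H k"
  shows "lookup p \<in> bar_cycles G k"
proof (cases k)
  case 0
  then show ?thesis using p by (auto simp: bar_cycles_def bar_chains_lookup bar_d_def)
next
  case (Suc j)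
  have "tr \<psi> (bar_bd G k p) = tr \<psi> 0"
    using z tr_bd[of p j] p Suc by (simp add: bcyc_def additive.zero[OF additive_tr])
  moreover have "keys (bar_bd G k p) \<subseteq> tuples G j" unfolding Suc by (rule keys_bar_bd[OF closed]) (use p Suc in auto)
  ultimately have "bar_bd G k p = 0" by (intro tr_inj[of _ j]) auto
  then have "bar_d G k (lookup p) = (\<lambda>_. 0)" using bar_d_lookup[of k G p] Suc by auto
  then show ?thesis using p by (auto simp: bar_cycles_def bar_chains_lookup)
qed

lemma boundary_tr:
  assumes b: "lookup p \<in> bar_boundaries G k"
  shows "tr \<psi> p \<in> bbd H k"
proof -
  obtain q where q: "keys q \<subseteq> tuples G (Suc k)" "lookup p = bar_d G (Suc k) (lookup q)"
    using b by (auto simp: bar_boundaries_def bar_chains_lookup)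
  then have "p = bar_bd G (Suc k) q" using bar_d_lookup[of "Suc k" G q] by (intro poly_mapping_eqI) simp
  then show ?thesis using tr_bd[OF q(1)] tr_CC[OF q(1)] by (auto simp: bbd_def)
qed

lemma tr_boundary:
  assumes closed: "\<And>x y. x \<in> carrier G \<Longrightarrow> y \<in> carrier G \<Longrightarrow> x \<otimes>\<^bsub>G\<^esub> y \<in> carrier G"
    and p: "keys p \<subseteq> tuples G k" and b: "tr \<psi> p \<in> bbd H k"
  shows "lookup p \<in> bar_boundaries G k"
proof -
  obtain y where y: "y \<in> CC {[]} H (Suc k)" "tr \<psi> p = dv y" using b by (auto simp: bbd_def)
  obtain q where q: "keys q \<subseteq> tuples G (Suc k)" "tr \<psi> q = y" using tr_surj[OF y(1)] by blast
  have "p = bar_bd G (Suc k) q"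
    by (rule tr_inj[OF p keys_bar_bd[OF closed q(1)]]) (use tr_bd[OF q(1)] q(2) y(2) in auto)
  then have "lookup p = bar_d G (Suc k) (lookup q)" using bar_d_lookup[of "Suc k" G q] by simp
  then show ?thesis using q(1) by (auto simp: bar_boundaries_def bar_chains_lookup)
qed

end

text \<open>Both bar complexes are carried into that of one ambient group, where \<phi> becomes an
  inclusion of subsets. The transports are bijective on chains, so cycles and boundaries correspond
  exactly.\<close>

lemma induces_homology_iso_transfer:
  fixes G1 :: "('m1, 'b1) monoid_scheme" and G2 :: "('m2, 'b2) monoid_scheme"
  assumes 1: "bij_betw \<psi>1 (carrier G1) H1"
      "\<And>x y. x \<in> carrier G1 \<Longrightarrow> y \<in> carrier G1 \<Longrightarrow> \<psi>1 (x \<otimes>\<^bsub>G1\<^esub> y) = \<psi>1 x + \<psi>1 y"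
      "\<And>x y. x \<in> carrier G1 \<Longrightarrow> y \<in> carrier G1 \<Longrightarrow> x \<otimes>\<^bsub>G1\<^esub> y \<in> carrier G1"
    and 2: "bij_betw \<psi>2 (carrier G2) H2"
      "\<And>x y. x \<in> carrier G2 \<Longrightarrow> y \<in> carrier G2 \<Longrightarrow> \<psi>2 (x \<otimes>\<^bsub>G2\<^esub> y) = \<psi>2 x + \<psi>2 y"
      "\<And>x y. x \<in> carrier G2 \<Longrightarrow> y \<in> carrier G2 \<Longrightarrow> x \<otimes>\<^bsub>G2\<^esub> y \<in> carrier G2"
    and \<phi>: "\<And>x. x \<in> carrier G1 \<Longrightarrow> \<phi> x \<in> carrier G2" "\<And>x. x \<in> carrier G1 \<Longrightarrow> \<psi>2 (\<phi> x) = \<psi>1 x"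
    and inj: "\<And>z :: 'x list \<times> 'g list \<Rightarrow>\<^sub>0 'c::ab_group_add. z \<in> bcyc H1 k \<Longrightarrow> z \<in> bbd H2 k \<Longrightarrow> z \<in> bbd H1 k"
    and surj: "\<And>z :: 'x list \<times> 'g list \<Rightarrow>\<^sub>0 'c. z \<in> bcyc H2 k \<Longrightarrow> \<exists>z' \<in> bcyc H1 k. z - z' \<in> bbd H2 k"
  shows "induces_homology_iso G1 G2 \<phi> k TYPE('c)"
proof -
  have push_tr: "tr \<psi>2 (push (map \<phi>) p) = tr \<psi>1 p" if "keys p \<subseteq> tuples G1 k" for p :: "'m1 list \<Rightarrow>\<^sub>0 'c"
    unfolding tr_def push_push by (rule push_cong) (use that \<phi>(2) in \<open>fastforce simp: tuples_def\<close>)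
  have push_keys: "keys (push (map \<phi>) p) \<subseteq> tuples G2 k" if "keys p \<subseteq> tuples G1 k" for p :: "'m1 list \<Rightarrow>\<^sub>0 'c"
    using keys_push[of "map \<phi>" p] that \<phi>(1) by (fastforce simp: tuples_def)
  show ?thesis
    unfolding induces_homology_iso_def
  proof (intro conjI ballI impI)
    fix z :: "'m1 list \<Rightarrow> 'c"
    assume z: "z \<in> bar_cycles G1 k" and b: "bar_push \<phi> z \<in> bar_boundaries G2 k"
    then obtain p where p: "z = lookup p" "keys p \<subseteq> tuples G1 k" by (auto simp: bar_cycles_def bar_chains_lookup)
    have "tr \<psi>1 p \<in> bcyc H1 k" using cycle_tr[OF 1(1,2) p(2)] z p(1) by blast
    moreover have "tr \<psi>1 p \<in> bbd H2 k"
      using boundary_tr[OF 2(1,2), of "push (map \<phi>) p"] b p push_tr by (simp add: bar_push_lookup)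
    ultimately have "tr \<psi>1 p \<in> bbd H1 k" by (rule inj)
    then show "z \<in> bar_boundaries G1 k" using tr_boundary[OF 1 p(2)] p(1) by blast
  next
    fix z :: "'m2 list \<Rightarrow> 'c"
    assume z: "z \<in> bar_cycles G2 k"
    then obtain p where p: "z = lookup p" "keys p \<subseteq> tuples G2 k" by (auto simp: bar_cycles_def bar_chains_lookup)
    have "tr \<psi>2 p \<in> bcyc H2 k" using cycle_tr[OF 2(1,2) p(2)] z p(1) by blast
    then obtain y where y: "y \<in> bcyc H1 k" "tr \<psi>2 p - y \<in> bbd H2 k" using surj by blast
    obtain q where q: "keys q \<subseteq> tuples G1 k" "tr \<psi>1 q = y"
      using tr_surj[OF 1(1,2), of y k] y(1) by (auto simp: bcyc_def)
    have "lookup q \<in> bar_cycles G1 k" using tr_cycle[OF 1 q(1)] q(2) y(1) by blast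
    moreover have "(\<lambda>x. z x - bar_push \<phi> (lookup q) x) = lookup (p - push (map \<phi>) q)"
      by (rule ext) (simp add: p(1) bar_push_lookup lookup_minus)
    moreover have "lookup (p - push (map \<phi>) q) \<in> bar_boundaries G2 k"
    proof (rule tr_boundary[OF 2])
      show "keys (p - push (map \<phi>) q) \<subseteq> tuples G2 k"
        using keys_minus_subset[of p "push (map \<phi>) q"] p(2) push_keys[OF q(1)] by blast
      show "tr \<psi>2 (p - push (map \<phi>) q) \<in> bbd H2 k"
        using y(2) q(2) by (simp add: additive.diff[OF additive_tr] push_tr[OF q(1)])
    qed
    ultimately show "\<exists>z' \<in> bar_cycles G1 k. (\<lambda>x. z x - bar_push \<phi> z' x) \<in> bar_boundaries G2 k"
      by (intro bexI[of _ "lookup q"]) simp_all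
  qed
qed

end

section \<open>The presented Coxeter group as a group of bijections\<close>

context coxeter
begin

definition elt :: "'v list set \<Rightarrow> ('v \<Rightarrow> real) bijn" where
  "elt X = gw (SOME w. w \<in> X)"

lemma carrier_class:
  assumes X: "X \<in> carrier (coxeter_group T m)"
  shows "(SOME w. w \<in> X) \<in> X" "X \<subseteq> lists T" "u \<in> X \<Longrightarrow> w \<in> X \<Longrightarrow> (u, w) \<in> cox_rel T m"
    "u \<in> X \<Longrightarrow> X = cox_rel T m `` {u}"
proof -
  obtain w0 where w0: "w0 \<in> lists T" "X = cox_rel T m `` {w0}"
    using X by (auto simp: coxeter_group_def elim!: quotientE)
  have "w0 \<in> X" using w0 cox_rel.refl[OF w0(1)] by blast
  then show "(SOME w. w \<in> X) \<in> X" by (rule someI)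
  show "X \<subseteq> lists T" using w0(2) cox_rel_lists by blast
  show "(u, w) \<in> cox_rel T m" if "u \<in> X" "w \<in> X" for u w
    using that w0(2) cox_rel.sym cox_rel.trans by blast
  show "X = cox_rel T m `` {u}" if "u \<in> X"
    using that w0(2) cox_rel.sym cox_rel.trans by blast
qed

lemma elt_eq:
  assumes T: "T \<subseteq> S" and X: "X \<in> carrier (coxeter_group T m)" and w: "w \<in> X"
  shows "elt X = gw w"
proof -
  have "actw (SOME w. w \<in> X) = actw w"
    by (rule actw_cox_rel[OF carrier_class(3)[OF X carrier_class(1)[OF X] w] T])
  then show ?thesis unfolding elt_def gw_def by (rule arg_cong)
qed

lemma class_carrier: "w \<in> lists T \<Longrightarrow> cox_rel T m `` {w} \<in> carrier (coxeter_group T m)"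
  unfolding coxeter_group_def partial_object.simps by (rule quotientI)

lemma class_self: "w \<in> lists T \<Longrightarrow> w \<in> cox_rel T m `` {w}"
  by (rule ImageI[OF cox_rel.refl]) simp_all

text \<open>Injectivity is the faithfulness of the geometric representation; surjectivity holds
  because every word has a class.\<close>

lemma elt_bij:
  assumes T: "T \<subseteq> S"
  shows "bij_betw elt (carrier (coxeter_group T m)) (parab T)"
proof (rule bij_betwI')
  fix X Y assume X: "X \<in> carrier (coxeter_group T m)" and Y: "Y \<in> carrier (coxeter_group T m)"
  note x = carrier_class(1)[OF X] note y = carrier_class(1)[OF Y]
  have xT: "(SOME w. w \<in> X) \<in> lists T" "(SOME w. w \<in> Y) \<in> lists T"
    using x y carrier_class(2) X Y by blast+
  have xS: "(SOME w. w \<in> X) \<in> lists S" "(SOME w. w \<in> Y) \<in> lists S"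
    using xT lists_mono[OF T] by blast+
  show "elt X = elt Y \<longleftrightarrow> X = Y"
  proof
    assume "elt X = elt Y"
    then have "actw (SOME w. w \<in> X) = actw (SOME w. w \<in> Y)"
      unfolding elt_def by (simp only: gw_eq_iff[OF xS])
    then have "((SOME w. w \<in> X), (SOME w. w \<in> Y)) \<in> cox_rel T m" by (rule faithful_rel[OF T xT])
    then have "(SOME w. w \<in> Y) \<in> X" using carrier_class(4)[OF X x] by blast
    then show "X = Y" using carrier_class(4)[OF X] carrier_class(4)[OF Y y] by metis
  qed simp
next
  fix X assume X: "X \<in> carrier (coxeter_group T m)"
  show "elt X \<in> parab T"
    unfolding elt_def parab_def using carrier_class(1,2)[OF X] by blast
next
  fix g assume "g \<in> parab T"
  then obtain w where w: "w \<in> lists T" "g = gw w" by (auto simp: parab_def)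
  show "\<exists>X \<in> carrier (coxeter_group T m). g = elt X"
    using elt_eq[OF T class_carrier[OF w(1)] class_self[OF w(1)]] class_carrier[OF w(1)] w(2) by metis
qed

lemma elt_mult:
  assumes T: "T \<subseteq> S" and X: "X \<in> carrier (coxeter_group T m)" and Y: "Y \<in> carrier (coxeter_group T m)"
  shows "X \<otimes>\<^bsub>coxeter_group T m\<^esub> Y \<in> carrier (coxeter_group T m)"
    "elt (X \<otimes>\<^bsub>coxeter_group T m\<^esub> Y) = elt X + elt Y"
proof -
  define x where "x = (SOME w. w \<in> X)"
  define y where "y = (SOME w. w \<in> Y)"
  have xy: "x \<in> lists T" "y \<in> lists T"
    using carrier_class(1,2)[OF X] carrier_class(1,2)[OF Y] by (auto simp: x_def y_def)
  have xyS: "x \<in> lists S" "y \<in> lists S" using xy lists_mono[OF T] by blast+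
  have l: "x @ y \<in> lists T" using xy by simp
  have m: "X \<otimes>\<^bsub>coxeter_group T m\<^esub> Y = cox_rel T m `` {x @ y}"
    by (simp add: coxeter_group_def x_def y_def)
  show "X \<otimes>\<^bsub>coxeter_group T m\<^esub> Y \<in> carrier (coxeter_group T m)" unfolding m by (rule class_carrier[OF l])
  have "elt (X \<otimes>\<^bsub>coxeter_group T m\<^esub> Y) = gw (x @ y)"
    unfolding m by (rule elt_eq[OF T class_carrier[OF l] class_self[OF l]])
  also have "\<dots> = elt X + elt Y" unfolding elt_def x_def[symmetric] y_def[symmetric] by (rule gw_append[OF xyS])
  finally show "elt (X \<otimes>\<^bsub>coxeter_group T m\<^esub> Y) = elt X + elt Y" .
qed

lemma elt_parabolic_incl:
  assumes T: "T \<subseteq> T'" "T' \<subseteq> S" and X: "X \<in> carrier (coxeter_group T m)"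
  shows "parabolic_incl T' m X \<in> carrier (coxeter_group T' m)" "elt (parabolic_incl T' m X) = elt X"
proof -
  define x where "x = (SOME w. w \<in> X)"
  have x: "x \<in> X" "x \<in> lists T" using carrier_class(1,2)[OF X] by (auto simp: x_def)
  have xT': "x \<in> lists T'" using x(2) lists_mono[OF T(1)] by blast
  have "(x, w) \<in> cox_rel T' m" if "w \<in> X" for w
    using cox_rel_mono[OF carrier_class(3)[OF X x(1) that] T(1)] .
  then have e: "parabolic_incl T' m X = cox_rel T' m `` {x}"
    unfolding parabolic_incl_def using x(1) cox_rel.trans by blast
  show "parabolic_incl T' m X \<in> carrier (coxeter_group T' m)" unfolding e by (rule class_carrier[OF xT'])
  show "elt (parabolic_incl T' m X) = elt X"
    unfolding e elt_eq[OF T(2) class_carrier[OF xT'] class_self[OF xT']] by (simp add: elt_def x_def)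
qed

end

theorem mainTheorem1:
  fixes S0 :: "'a set" and M0 :: "'a \<Rightarrow> 'a \<Rightarrow> enat" and m1 :: "'a \<Rightarrow> enat"
  assumes "finite S0"
    and "is_coxeter_matrix S0 M0"
    and "\<forall>a\<in>S0. m1 a \<ge> 2"
    and "n \<ge> 1" and "2 * k \<le> n"
  shows "induces_homology_iso (W S0 M0 m1 (n - 1)) (W S0 M0 m1 n)
           (parabolic_incl (gamma_vertices S0 n) (gamma_matrix M0 m1)) k TYPE('c::ab_group_add)"
proof -
  \<comment> \<open>With the bound M = n the tower reaches W_n = \<open>P (Suc n)\<close>, and
    W_{n-1} is \<open>P n\<close>; the hypothesis n >= 1 identifies the latter with the group on the
    vertices of \<Gamma>_{n-1}.\<close>
  interpret gamma_family S0 M0 m1 n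
    by (rule gamma_family.intro) (use assms(1-3) in simp_all)
  note stab = tower.homology_stability[OF order_refl assms(5), where ?'c = 'c]
  have V: "V (n - 1) \<subseteq> V n" "V n \<subseteq> V (Suc n)" by (rule V_mono, simp)+
  then have V': "V (n - 1) \<subseteq> V (Suc n)" by blast
  have P: "P n = parab (V (n - 1))" "P (Suc n) = parab (V n)"
    using P_Suc_eq[of "n - 1"] P_Suc_eq[of n] assms(4) by simp_all
  show ?thesis
    unfolding W_def
  proof (rule induces_homology_iso_transfer[where ?\<psi>1.0 = elt and ?\<psi>2.0 = elt])
    show "bij_betw elt (carrier (coxeter_group (V (n - 1)) mm)) (P n)" unfolding P by (rule elt_bij[OF V'])
    show "bij_betw elt (carrier (coxeter_group (V n) mm)) (P (Suc n))" unfolding P by (rule elt_bij[OF V(2)])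
  next
    fix z :: "(('a + nat \<Rightarrow> real) \<Rightarrow> real) list \<times> ('a + nat \<Rightarrow> real) bijn list \<Rightarrow>\<^sub>0 'c"
    show "z \<in> bcyc (P n) k \<Longrightarrow> z \<in> bbd (P (Suc n)) k \<Longrightarrow> z \<in> bbd (P n) k"
      using stab unfolding tower.stab_inj_def by blast
    show "z \<in> bcyc (P (Suc n)) k \<Longrightarrow> \<exists>z' \<in> bcyc (P n) k. z - z' \<in> bbd (P (Suc n)) k"
      using stab unfolding tower.stab_surj_def by blast
  qed (use elt_mult[OF V'] elt_mult[OF V(2)] elt_parabolic_incl[OF V] in auto)
qed

end
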